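(* For every $\mathbf a\in\mathcal A$ representing a torsion element of $U^-$, the extension $\mathbb Q^{\mathrm{ab}}(\sqrt{\sin\mathbf a})/\mathbb Q$ is Galois.
   Context: $\mathbb Q^{\mathrm{ab}}\subset\mathbb C$ is the maximal abelian extension of $\mathbb Q$ in $\mathbb C$. $\mathcal A$ is the free abelian group on symbols $[a]$ ($a\in\mathbb Q$) modulo the identifications $[a]=[b]\Leftrightarrow a-b\in\mathbb Z$. The group $G^{\mathrm{ab}}=\mathrm{Gal}(\mathbb Q^{\mathrm{ab}}/\mathbb Q)$ acts on $\mathcal A$ by $\sigma[a]=[b]\Leftrightarrow\sigma(e^{2\pi ia})=e^{2\pi ib}$; let $\sigma_{-1}\in G^{\mathrm{ab}}$ be the restriction of complex conjugation, so $\sigma_{-1}[a]=[-a]$. For each prime $p$ let $Y_p:\mathcal A\to\mathcal A$ be the endomorphism with $Y_p[a]=[a]-\sum_{i=0}^{p-1}\left[\frac{a+i}{p}\right]$ ($a\in\mathbb Q$). The universal odd ordinary distribution is $$U^-:=\frac{\mathcal A}{(1+\sigma_{-1})\mathcal A+\sum_pY_p\mathcal A},$$ the sum being over all primes $p$. The homomorphism $\sin:\mathcal A\to\mathbb Q^{\mathrm{ab}\times}$ is given by $\sin[a]=2\sin\pi a$ for $a\in\mathbb Q\cap(0,1)$ and $\sin[0]=1$. *)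

theory Defs
  imports Complex_Main "HOL-Library.Poly_Mapping" "HOL-Algebra.Algebra"
    "HOL-Algebra.Algebraic_Closure_Type" "HOL-Computational_Algebra.Primes"
begin

section \<open>Galois theory of subfields of the complex numbers\<close>

abbreviation Cx :: "complex ring"
  where "Cx \<equiv> ring_of_type_algebra"

text \<open>Automorphisms are extensional on \<open>L\<close>, as in \<^const>\<open>BijGroup\<close>, so that each
  automorphism is represented by exactly one function.\<close>

definition Gal :: "complex set \<Rightarrow> complex set \<Rightarrow> (complex \<Rightarrow> complex) monoid"
  where "Gal L F = (BijGroup L)\<lparr>carrier :=
    {\<sigma> \<in> Bij L. \<sigma> \<in> ring_hom (Cx\<lparr>carrier := L\<rparr>) (Cx\<lparr>carrier := L\<rparr>) \<and> (\<forall>x\<in>F. \<sigma> x = x)}\<rparr>"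

text \<open>The extension \<open>L/F\<close> may be infinite: it is Galois if it is algebraic and \<open>F\<close> is the
  fixed field of its automorphism group.\<close>

definition galois_extension :: "complex set \<Rightarrow> complex set \<Rightarrow> bool"
  where "galois_extension L F \<longleftrightarrow>
    subfield F Cx \<and> subfield L Cx \<and> F \<subseteq> L \<and>
    (\<forall>x\<in>L. ring.algebraic Cx F x) \<and>
    {x \<in> L. \<forall>\<sigma>\<in>carrier (Gal L F). \<sigma> x = x} = F"

definition abelian_extension :: "complex set \<Rightarrow> complex set \<Rightarrow> bool"
  where "abelian_extension L F \<longleftrightarrow> galois_extension L F \<and> comm_group (Gal L F)"

definition adjoin :: "complex set \<Rightarrow> complex set \<Rightarrow> complex set"
  where "adjoin F S = generate_field Cx (F \<union> S)"

text \<open>A compositum of abelian extensions is abelian, so the maximal abelian extension of the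
  rationals is the compositum of all their abelian extensions.\<close>

definition Q_ab :: "complex set"
  where "Q_ab = generate_field Cx (\<Union>{K. abelian_extension K \<rat>})"


section \<open>The free abelian group on the rationals modulo the integers\<close>

quotient_type rat_mod_1 = rat / "\<lambda>a b :: rat. a - b \<in> \<int>"
proof (rule equivpI)
  show "reflp (\<lambda>a b :: rat. a - b \<in> \<int>)"
    by (simp add: reflp_def)
  show "symp (\<lambda>a b :: rat. a - b \<in> \<int>)"
    by (metis (no_types, lifting) Ints_minus minus_diff_eq sympI)
  show "transp (\<lambda>a b :: rat. a - b \<in> \<int>)"
    by (rule transpI) (metis (no_types, lifting) Ints_add diff_add_cancel add_diff_eq)
qed

lift_definition rat_class :: "rat \<Rightarrow> rat_mod_1" is "\<lambda>a. a" .

type_synonym symbols = "rat_mod_1 \<Rightarrow>\<^sub>0 int"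

abbreviation symbol :: "rat \<Rightarrow> symbols"
  where "symbol a \<equiv> frag_of (rat_class a)"

lemma rat_class_eq_iff: "rat_class a = rat_class b \<longleftrightarrow> a - b \<in> \<int>"
  by transfer simp

lemma symbol_eq_iff: "symbol a = symbol b \<longleftrightarrow> a - b \<in> \<int>"
  by (simp add: frag_of_eq rat_class_eq_iff)

abbreviation symbol_group :: "symbols monoid"
  where "symbol_group \<equiv> free_Abelian_group UNIV"

lemma carrier_symbol_group: "carrier symbol_group = UNIV"
  by (auto simp: free_Abelian_group_def)

lemma of_rat_diff_Ints:
  assumes "a - b \<in> \<int>"
  obtains k :: int where "(of_rat a :: 'a :: field_char_0) = of_rat b + of_int k"
proof -
  obtain k where "a - b = of_int k"
    using assms by (elim Ints_cases)
  then have "a = b + of_int k"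
    by (simp add: algebra_simps)
  then show ?thesis
    using that by (simp add: of_rat_add)
qed

lift_definition root_of_unity :: "rat_mod_1 \<Rightarrow> complex"
  is "\<lambda>a. exp (2 * of_real pi * \<i> * of_rat a)"
proof -
  fix a b :: rat
  assume "a - b \<in> \<int>"
  then obtain k :: int where "(of_rat a :: complex) = of_rat b + of_int k"
    by (rule of_rat_diff_Ints)
  moreover have "exp (2 * of_real pi * \<i> * of_int k) = (1 :: complex)"
    using cis_multiple_2pi[of "of_int k"] by (simp add: cis_conv_exp mult_ac)
  ultimately show "exp (2 * of_real pi * \<i> * of_rat a) = exp (2 * of_real pi * \<i> * of_rat b)"
    by (simp add: ring_distribs exp_add)
qed

text \<open>The action of a field automorphism on symbols, through its action on the roots of unity.\<close>

definition symbol_action :: "(complex \<Rightarrow> complex) \<Rightarrow> symbols \<Rightarrow> symbols"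
  where "symbol_action \<sigma> =
    frag_extend (\<lambda>q. frag_of (THE r. \<sigma> (root_of_unity q) = root_of_unity r))"

lemma root_of_unity_class: "root_of_unity (rat_class a) = cis (2 * pi * of_rat a)"
proof -
  have "(of_rat a :: complex) = of_real (of_rat a)"
    by (cases a) (simp add: of_rat_rat)
  then show ?thesis
    by (simp add: root_of_unity.abs_eq rat_class.abs_eq cis_conv_exp mult_ac)
qed

lemma root_of_unity_eq_iff: "root_of_unity q = root_of_unity r \<longleftrightarrow> q = r"
proof
  obtain a b where ab: "q = rat_class a" "r = rat_class b"
    by (metis Quotient_rat_mod_1 Quotient_abs_rep rat_class.abs_eq)
  assume "root_of_unity q = root_of_unity r"
  then have "cis (2 * pi * of_rat a) / cis (2 * pi * of_rat b) = 1"
    by (simp add: ab root_of_unity_class)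
  then have "cis (2 * pi * of_rat (a - b)) = 1"
    by (simp add: cis_divide of_rat_diff right_diff_distrib)
  then have "cos (2 * pi * of_rat (a - b)) = 1"
    by (metis cis.sel(1) one_complex.sel(1))
  then obtain k :: int where "2 * pi * of_rat (a - b) = of_int k * 2 * pi"
    by (auto simp: cos_one_2pi_int)
  then have "(of_rat (a - b) :: real) = of_rat (of_int k)"
    by simp
  then have "a - b = of_int k"
    by (simp only: of_rat_eq_iff)
  then show "q = r"
    by (simp add: ab rat_class_eq_iff)
qed simp

lemma symbol_action_symbol:
  assumes "\<sigma> (cis (2 * pi * of_rat a)) = cis (2 * pi * of_rat b)"
  shows "symbol_action \<sigma> (symbol a) = symbol b"
  using assms
  by (simp add: symbol_action_def root_of_unity_eq_iff flip: root_of_unity_class)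

definition sigma_minus_1 :: "complex \<Rightarrow> complex"
  where "sigma_minus_1 = restrict cnj Q_ab"

lemma sigma_minus_1_symbol:
  assumes "cis (2 * pi * of_rat a) \<in> Q_ab"
  shows "symbol_action sigma_minus_1 (symbol a) = symbol (- a)"
  using assms
  by (intro symbol_action_symbol) (simp add: sigma_minus_1_def cis_cnj of_rat_minus)

lift_definition symbol_divide :: "nat \<Rightarrow> rat_mod_1 \<Rightarrow> symbols"
  is "\<lambda>p a. \<Sum>i<p. symbol ((a + of_nat i) / of_nat p)"
proof -
  fix p :: nat and a b :: rat
  assume "a - b \<in> \<int>"
  then obtain k :: int where k: "a - b = of_int k"
    by (elim Ints_cases)
  show "(\<Sum>i<p. symbol ((a + of_nat i) / of_nat p)) = (\<Sum>i<p. symbol ((b + of_nat i) / of_nat p))"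
  proof (cases "p = 0")
    case False
    define f where "f i = nat ((int i + k) mod int p)" for i
    define g where "g i = nat ((int i - k) mod int p)" for i
    have fg: "f (g i) = i" "g (f i) = i" if "i < p" for i
      using that False by (simp_all add: f_def g_def mod_simps)
    have bnd: "f i < p" "g i < p" for i
      using False by (simp_all add: f_def g_def nat_less_iff)
    show ?thesis
    proof (rule sum.reindex_bij_witness[of _ g f])
      fix i assume i: "i \<in> {..<p}"
      define d where "d = (int i + k) div int p"
      have "int i + k = int p * d + int (f i)"
        using False by (simp add: d_def f_def)
      then have "of_int (int i + k) = (of_int (int p * d + int (f i)) :: rat)"
        by simp
      then have "(of_nat i :: rat) + of_int k = of_nat p * of_int d + of_nat (f i)"
        by simp
      moreover have "a = b + of_int k"
        using k by (simp add: algebra_simps)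
      ultimately have "(a + of_nat i) / of_nat p - (b + of_nat (f i)) / of_nat p = of_int d"
        using False by (simp add: field_simps)
      then show "symbol ((b + of_nat (f i)) / of_nat p) = symbol ((a + of_nat i) / of_nat p)"
        by (metis Ints_of_int symbol_eq_iff)
    qed (use fg bnd in auto)
  qed simp
qed

definition Y :: "nat \<Rightarrow> symbols \<Rightarrow> symbols"
  where "Y p = frag_extend (\<lambda>q. frag_of q - symbol_divide p q)"

lemma Y_symbol: "Y p (symbol a) = symbol a - (\<Sum>i<p. symbol ((a + of_nat i) / of_nat p))"
  by (simp add: Y_def symbol_divide.abs_eq rat_class.abs_eq)


section \<open>The universal odd ordinary distribution\<close>

definition odd_distribution_relations :: "symbols set"
  where "odd_distribution_relations = generate symbol_group
    (range (\<lambda>x. x + symbol_action sigma_minus_1 x) \<union> (\<Union>p\<in>{p::nat. Factorial_Ring.prime p}. range (Y p)))"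

definition U_minus :: "symbols set monoid"
  where "U_minus = symbol_group Mod odd_distribution_relations"

definition U_minus_class :: "symbols \<Rightarrow> symbols set"
  where "U_minus_class x = odd_distribution_relations #>\<^bsub>symbol_group\<^esub> x"

definition torsion_element :: "('a, 'b) monoid_scheme \<Rightarrow> 'a \<Rightarrow> bool"
  where "torsion_element G x \<longleftrightarrow> x \<in> carrier G \<and> (\<exists>n::nat. n > 0 \<and> x [^]\<^bsub>G\<^esub> n = \<one>\<^bsub>G\<^esub>)"


section \<open>The sine homomorphism\<close>

lift_definition sin_class :: "rat_mod_1 \<Rightarrow> complex"
  is "\<lambda>a. if a \<in> \<int> then 1 else of_real (2 * sin (pi * of_rat (frac a)))"
proof -
  fix a b :: rat
  assume "a - b \<in> \<int>"
  then obtain k where "a - b = of_int k"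
    by (elim Ints_cases)
  then have "a = b + of_int k"
    by (simp add: algebra_simps)
  then show "(if a \<in> \<int> then 1 else of_real (2 * sin (pi * of_rat (frac a))) :: complex) =
      (if b \<in> \<int> then 1 else of_real (2 * sin (pi * of_rat (frac b))))"
    by (simp add: frac_def)
qed

definition sin_hom :: "symbols \<Rightarrow> complex"
  where "sin_hom x = (\<Prod>q\<in>Poly_Mapping.keys x. sin_class q powi Poly_Mapping.lookup x q)"

lemma sin_hom_symbol_0: "sin_hom (symbol 0) = 1"
  by (simp add: sin_hom_def rat_class.abs_eq sin_class.abs_eq)

lemma sin_hom_symbol:
  assumes "0 < a" "a < 1"
  shows "sin_hom (symbol a) = of_real (2 * sin (pi * of_rat a))"
proof -
  have "frac a = a"
    using assms by (simp add: frac_eq)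
  moreover from this have "a \<notin> \<int>"
    using assms by (metis frac_eq_0_iff less_irrefl)
  ultimately show ?thesis
    by (simp add: sin_hom_def rat_class.abs_eq sin_class.abs_eq)
qed

lemma sin_class_nonzero: "sin_class q \<noteq> 0"
proof (transfer, goal_cases)
  case (1 a)
  have "sin (pi * of_rat (frac a)) > 0" if "a \<notin> \<int>"
  proof (rule sin_gt_zero)
    have "(0::real) < of_rat (frac a)" "of_rat (frac a) < (1::real)"
      using that by (simp_all add: frac_gt_0_iff frac_lt_1)
    then show "0 < pi * of_rat (frac a)" "pi * of_rat (frac a) < pi"
      by simp_all
  qed
  then show ?case by auto
qed

lemma sin_hom_add: "sin_hom (x + y) = sin_hom x * sin_hom y"
proof -
  let ?S = "Poly_Mapping.keys x \<union> Poly_Mapping.keys y"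
  let ?f = "\<lambda>z. \<Prod>q\<in>?S. sin_class q powi Poly_Mapping.lookup z q"
  have *: "sin_hom z = ?f z" if "Poly_Mapping.keys z \<subseteq> ?S" for z
    unfolding sin_hom_def using that
    by (intro prod.mono_neutral_left) (auto simp: in_keys_iff)
  have "?f (x + y) = ?f x * ?f y"
    by (simp add: lookup_add power_int_add sin_class_nonzero prod.distrib)
  then show ?thesis
    using * Poly_Mapping.keys_add[of x y] by simp
qed

end

theory Submission
  imports Defs "HOL-Number_Theory.Cong"
begin

text \<open>Write \<open>c\<close> for \<open>\<sigma>\<^sub>-\<^sub>1\<close>. An automorphism \<open>\<sigma>\<close> maps \<open>2 sin \<pi>a\<close> to \<open>sin (\<sigma>[a])\<close> up to a root of unity, and roots
  of unity are squares. The homomorphism \<open>sin\<close> maps the relations of \<open>U\<^sup>-\<close> to squares. Hence it is enough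
  that the Galois group acts trivially on the torsion of \<open>U\<^sup>-\<close>, and by the Chinese remainder theorem
  only for \<open>\<sigma>\<close> in the inertia group of one prime \<open>p\<close>. Modulo \<open>Y\<^sub>p\<close>, a symbol whose denominator is
  divisible by \<open>p\<close> can be pushed to a sum of symbols whose denominator is divisible by exactly \<open>p^K\<close>,
  with \<open>K\<close> large. The operator \<open>\<sigma> - 1\<close> kills the symbols with denominator prime to \<open>p\<close>, and also what
  remains of \<open>Y\<^sub>p\<close> on them. So everything follows once the group of symbols of exact level \<open>p^K\<close>
  modulo \<open>1 + c\<close> and all \<open>Y\<^sub>k\<close> with \<open>k \<noteq> p\<close> is torsion-free. There \<open>1 + c\<close> is divided out by a choice of
  representatives modulo \<open>\<plusminus>1\<close> at \<open>p\<close>, and the highest terms of the \<open>Y\<^sub>k\<close> form a system of commuting operators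
  with commuting left inverses.\<close>

section \<open>Quotients by operators with split leading terms\<close>

text \<open>The obstacle is that \<open>1 + c\<close> interferes with the leading terms of the
  \<open>Y k\<close>: a choice of representatives modulo +-1 has to survive division by every prime
  in play. The residue of the numerator at a fixed prime \<open>p\<close> survives each division by
  another prime \<open>k\<close> that enlarges the denominator, because such a division leaves the
  numerator alone. Division by \<open>p\<close> changes the modulus of this residue, hence one prime
  is taken out and everything is moved to one level. The condition \<open>p ^ K > 2\<close> ensures
  that negation has no fixed point there. As the left inverses also read nothing but numerator
  residues, they commute exactly, and not only up to lower terms, with the leading terms at other
  primes; this is what makes normal forms available. On the side of fields, being Galois over the
  rationals is reduced to stability under all embeddings of the algebraic numbers into the complex
  numbers. Such an embedding multiplies \<open>sin_hom a\<close> by the square of some \<beta> in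
  \<open>Q_ab\<close>, so it multiplies a square root by \<beta> or its negative.\<close>

text \<open>\<open>T i\<close> is the highest term of \<open>- Y i\<close> for the filtration \<open>D\<close>, and \<open>F i\<close> is a left inverse of it. The
  sum of the images of the \<open>Y i\<close> has the common kernel of the \<open>F i\<close> as a complement.\<close>

locale leading_terms =
  fixes D :: "nat \<Rightarrow> 'a::ab_group_add set" and I :: "nat set" and Y T F :: "nat \<Rightarrow> 'a \<Rightarrow> 'a"
  assumes finite_I: "finite I"
    and D_0: "D 0 = {0}"
    and D_diff: "\<And>m x y. x \<in> D m \<Longrightarrow> y \<in> D m \<Longrightarrow> x - y \<in> D m"
    and D_Suc: "\<And>m. D m \<subseteq> D (Suc m)"
    and add_Y: "\<And>i. i \<in> I \<Longrightarrow> additive (Y i)"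
    and add_T: "\<And>i. i \<in> I \<Longrightarrow> additive (T i)"
    and add_F: "\<And>i. i \<in> I \<Longrightarrow> additive (F i)"
    and T_D: "\<And>i m x. i \<in> I \<Longrightarrow> x \<in> D m \<Longrightarrow> T i x \<in> D (Suc m)"
    and F_D: "\<And>i m x. i \<in> I \<Longrightarrow> x \<in> D (Suc m) \<Longrightarrow> F i x \<in> D m"
    and YT_D: "\<And>i m x. i \<in> I \<Longrightarrow> x \<in> D m \<Longrightarrow> Y i x + T i x \<in> D m"
    and F_T: "\<And>i m x. i \<in> I \<Longrightarrow> x \<in> D m \<Longrightarrow> F i (T i x) = x"
    and F_T_commute: "\<And>i k m x. i \<in> I \<Longrightarrow> k \<in> I \<Longrightarrow> i \<noteq> k \<Longrightarrow> x \<in> D m \<Longrightarrow> F i (T k x) = T k (F i x)"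
    and F_commute: "\<And>i k x. i \<in> I \<Longrightarrow> k \<in> I \<Longrightarrow> F i (F k x) = F k (F i x)"
    and Y_commute: "\<And>i k x. i \<in> I \<Longrightarrow> k \<in> I \<Longrightarrow> Y i (Y k x) = Y k (Y i x)"
begin

lemmas additive_simps =
  additive.add[OF add_Y] additive.add[OF add_T] additive.add[OF add_F]
  additive.diff[OF add_Y] additive.diff[OF add_T] additive.diff[OF add_F]
  additive.minus[OF add_Y] additive.minus[OF add_T] additive.minus[OF add_F]
  additive.zero[OF add_Y] additive.zero[OF add_T] additive.zero[OF add_F]

lemma zero_D: "0 \<in> D m"
  using D_Suc by (induction m) (auto simp: D_0)

lemma minus_D: "x \<in> D m \<Longrightarrow> - x \<in> D m"
  using D_diff[OF zero_D] by fastforce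

lemma add_D: "x \<in> D m \<Longrightarrow> y \<in> D m \<Longrightarrow> x + y \<in> D m"
  using D_diff[OF _ minus_D] by fastforce

lemma sum_D: "(\<And>j. j \<in> J \<Longrightarrow> f j \<in> D m) \<Longrightarrow> (\<Sum>j\<in>J. f j) \<in> D m"
  by (induction J rule: infinite_finite_induct) (auto simp: zero_D add_D)

lemma Y_D: "i \<in> I \<Longrightarrow> x \<in> D m \<Longrightarrow> Y i x \<in> D (Suc m)"
  using D_diff[OF subsetD[OF D_Suc YT_D] T_D] by fastforce

text \<open>The sets \<open>A i\<close> may depend on \<open>i\<close>, so that one notion covers
  both arbitrary arguments and arguments in normal form.\<close>

definition relations :: "(nat \<Rightarrow> 'a set) \<Rightarrow> 'a set"
  where "relations A = {\<Sum>i\<in>I. Y i (y i) |y. \<forall>i\<in>I. y i \<in> A i}"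

lemma relations_add:
  assumes "\<And>i x y. i \<in> I \<Longrightarrow> x \<in> A i \<Longrightarrow> y \<in> A i \<Longrightarrow> x + y \<in> A i"
    and "s \<in> relations A" "t \<in> relations A"
  shows "s + t \<in> relations A"
proof -
  obtain y z where yz: "s = (\<Sum>i\<in>I. Y i (y i))" "t = (\<Sum>i\<in>I. Y i (z i))"
      "\<forall>i\<in>I. y i \<in> A i" "\<forall>i\<in>I. z i \<in> A i"
    using assms(2,3) unfolding relations_def by blast
  have "s + t = (\<Sum>i\<in>I. Y i (y i + z i))"
    using add_Y by (simp add: yz additive_simps flip: sum.distrib)
  with yz assms(1) show ?thesis
    unfolding relations_def by (intro CollectI exI[of _ "\<lambda>i. y i + z i"]) auto
qed

lemma relations_minus:
  assumes "\<And>i x. i \<in> I \<Longrightarrow> x \<in> A i \<Longrightarrow> - x \<in> A i" and "s \<in> relations A"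
  shows "- s \<in> relations A"
proof -
  obtain y where y: "s = (\<Sum>i\<in>I. Y i (y i))" "\<forall>i\<in>I. y i \<in> A i"
    using assms(2) unfolding relations_def by blast
  have "- s = (\<Sum>i\<in>I. Y i (- y i))"
    using add_Y by (simp add: y additive_simps sum_negf)
  with y assms(1) show ?thesis
    unfolding relations_def by (intro CollectI exI[of _ "\<lambda>i. - y i"]) auto
qed

lemma relations_single:
  assumes "i \<in> I" "x \<in> A i" "\<And>j. j \<in> I \<Longrightarrow> 0 \<in> A j"
  shows "Y i x \<in> relations A"
proof -
  have "Y i x = (\<Sum>j\<in>I. Y j (if j = i then x else 0))"
    using assms(1) finite_I add_Y by (subst sum.remove[of _ i]) (auto simp: additive_simps)
  with assms show ?thesis
    unfolding relations_def
    by (intro CollectI exI[of _ "\<lambda>j. if j = i then x else 0"]) auto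
qed

lemma zero_relations: "(\<And>i. i \<in> I \<Longrightarrow> 0 \<in> A i) \<Longrightarrow> 0 \<in> relations A"
  unfolding relations_def by (intro CollectI exI[of _ "\<lambda>_. 0"]) (simp add: additive_simps)

lemma relations_mono: "(\<And>i. i \<in> I \<Longrightarrow> A i \<subseteq> B i) \<Longrightarrow> relations A \<subseteq> relations B"
  unfolding relations_def by blast

text \<open>A relation can be written in several ways because the \<open>Y i\<close> commute: a part
  \<open>T k w\<close> in the argument of \<open>Y i\<close> can be moved, modulo lower terms, to
  the argument of \<open>Y k\<close>. The convention is to move it whenever
  \<open>i < k\<close>.\<close>

definition normal :: "nat \<Rightarrow> nat \<Rightarrow> 'a set"
  where "normal m i = {x \<in> D m. \<forall>k\<in>I. i < k \<longrightarrow> F k x = 0}"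

lemma normal_add: "x \<in> normal m i \<Longrightarrow> y \<in> normal m i \<Longrightarrow> x + y \<in> normal m i"
  and normal_minus: "x \<in> normal m i \<Longrightarrow> - x \<in> normal m i"
  and normal_zero: "0 \<in> normal m i"
  unfolding normal_def
  using add_D minus_D zero_D add_F by (auto simp: additive_simps)

lemma normal_relations_add:
  "s \<in> relations (normal m) \<Longrightarrow> t \<in> relations (normal m) \<Longrightarrow> s + t \<in> relations (normal m)"
  by (rule relations_add) (auto intro: normal_add)

lemma normal_Suc: "normal m i \<subseteq> normal (Suc m) i"
  unfolding normal_def using D_Suc by blast

lemma T_eq: "T k w = (Y k w + T k w) - Y k w"
  by simp

text \<open>The map subtracting \<open>T k (F k y)\<close> is the projection to the kernel of
  \<open>F k\<close> along the image of \<open>T k\<close>. It respects the kernels already reached,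
  since \<open>F j\<close> passes through both \<open>T k\<close> and \<open>F k\<close>, so the
  indices can be treated one after the other.\<close>

lemma clear_step:
  assumes "k \<in> I" "J \<subseteq> I" "k \<notin> J" "y \<in> D (Suc m)" "\<forall>j\<in>J. F j y = 0"
  shows "y - T k (F k y) \<in> D (Suc m)" "\<forall>j\<in>insert k J. F j (y - T k (F k y)) = 0"
proof -
  have w: "F k y \<in> D m"
    using F_D assms by blast
  then show "y - T k (F k y) \<in> D (Suc m)"
    using D_diff T_D assms by blast
  have "F k (y - T k (F k y)) = 0"
    using w assms add_F by (simp add: additive_simps F_T)
  moreover have "F j (y - T k (F k y)) = 0" if "j \<in> J" for j
  proof -
    have j: "j \<in> I" "j \<noteq> k"
      using that assms by auto
    then have "F j (y - T k (F k y)) = F j y - T k (F j (F k y))"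
      using assms by (simp add: additive_simps F_T_commute[OF _ _ _ w])
    also have "F j (F k y) = F k (F j y)"
      using F_commute assms that by blast
    finally show ?thesis
      using assms that add_F add_T by (simp add: additive_simps)
  qed
  ultimately show "\<forall>j\<in>insert k J. F j (y - T k (F k y)) = 0"
    by blast
qed

text \<open>Double induction: on the filtration step, and within a step on the number of indices
  after \<open>i\<close>. The conditions \<open>F k y' = 0\<close> are imposed one \<open>k\<close>
  at a time, and each discarded part is itself a normal relation.\<close>

lemma Y_in_normal_relations: "i \<in> I \<Longrightarrow> y \<in> D m \<Longrightarrow> Y i y \<in> relations (normal m)"
proof (induction m arbitrary: i y)
  case 0
  then show ?case
    using relations_single[of i 0 "normal 0"] by (simp add: D_0 normal_zero)
next
  case (Suc m)
  from Suc.prems show ?case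
  proof (induction "card {k \<in> I. i < k}" arbitrary: i y rule: less_induct)
    case less
    have later: "Y k z \<in> relations (normal (Suc m))" if "k \<in> I" "i < k" "z \<in> D (Suc m)" for k z
    proof (rule less.hyps)
      show "card {l \<in> I. k < l} < card {k \<in> I. i < k}"
        using that finite_I by (intro psubset_card_mono) auto
    qed (use that in auto)
    have "\<exists>y'\<in>D (Suc m). (\<forall>k\<in>J. F k y' = 0) \<and> Y i (y - y') \<in> relations (normal (Suc m))"
      if "J \<subseteq> {k \<in> I. i < k}" for J
    proof -
      have "finite J"
        using that finite_I by (simp add: finite_subset)
      from this that show ?thesis
      proof (induction J)
        case empty
        show ?case
          using less.prems relations_single[of i 0 "normal (Suc m)"]
          by (intro bexI[of _ y]) (auto simp: normal_zero)
      next
        case (insert k J)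
        then obtain y' where y': "y' \<in> D (Suc m)" "\<forall>k\<in>J. F k y' = 0"
            "Y i (y - y') \<in> relations (normal (Suc m))"
          by auto
        define w where "w = F k y'"
        have k: "k \<in> I" "i < k"
          using insert by auto
        have w: "w \<in> D m"
          using F_D k y' w_def by blast
        \<comment> \<open>The leading term \<open>T k w\<close> is traded for
          \<open>Y k w + T k w\<close>, which lies one step lower and falls to the outer induction,
          and for \<open>Y k (Y i w)\<close>, which falls to the inner one because \<open>k\<close>
          comes after \<open>i\<close>.\<close>
        have "Y i (T k w) = Y i (Y k w + T k w) - Y k (Y i w)"
          using add_Y less.prems k by (subst T_eq) (simp add: additive_simps Y_commute)
        moreover have "Y i (Y k w + T k w) \<in> relations (normal (Suc m))"
          using Suc.IH[OF less.prems(1) YT_D[OF k(1) w]] relations_mono normal_Suc by blast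
        moreover have "- Y k (Y i w) \<in> relations (normal (Suc m))"
          by (intro relations_minus normal_minus later k Y_D less.prems w)
        ultimately have "Y i (T k w) \<in> relations (normal (Suc m))"
          using normal_relations_add by force
        then have "Y i (y - y') + Y i (T k w) \<in> relations (normal (Suc m))"
          using normal_relations_add y'(3) by blast
        then have "Y i (y - (y' - T k w)) \<in> relations (normal (Suc m))"
          using add_Y less.prems by (simp add: additive_simps algebra_simps)
        with clear_step[of k J y' m] insert y' k show ?case
          unfolding w_def by blast
      qed
    qed
    from this[OF subset_refl] obtain y' where y': "y' \<in> D (Suc m)"
        "\<forall>k\<in>{k \<in> I. i < k}. F k y' = 0" "Y i (y - y') \<in> relations (normal (Suc m))"
      by blast
    then have "Y i y' \<in> relations (normal (Suc m))"
      using less.prems by (intro relations_single normal_zero) (auto simp: normal_def)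
    from normal_relations_add[OF y'(3) this] show ?case
      using add_Y less.prems by (simp add: additive_simps)
  qed
qed

text \<open>Clearing the \<open>F k\<close> subtracts terms \<open>T k w\<close>, each equal to
  \<open>- Y k w\<close> up to an error one filtration step lower. The errors are collected in
  \<open>g\<close>, to which the induction hypothesis applies.\<close>

lemma reduced_decomposition:
  "x \<in> D m \<Longrightarrow> \<exists>x0. (\<forall>k\<in>I. F k x0 = 0) \<and> x - x0 \<in> relations (\<lambda>_. D m)"
proof (induction m arbitrary: x)
  case 0
  then show ?case
    using zero_relations[of "\<lambda>_. D 0"] add_F by (auto simp: D_0 additive_simps intro!: exI[of _ "0"])
next
  case (Suc m)
  have rel_mono: "relations (\<lambda>_. D m) \<subseteq> relations (\<lambda>_. D (Suc m))"
    using relations_mono D_Suc by simp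
  have rel_add: "s + t \<in> relations (\<lambda>_. D (Suc m))"
    if "s \<in> relations (\<lambda>_. D (Suc m))" "t \<in> relations (\<lambda>_. D (Suc m))" for s t
    by (rule relations_add) (use that add_D in auto)
  have "\<exists>x'\<in>D (Suc m). (\<forall>k\<in>J. F k x' = 0) \<and>
      (\<exists>g\<in>D m. x - x' - g \<in> relations (\<lambda>_. D (Suc m)))" if "J \<subseteq> I" for J
  proof -
    have "finite J"
      using that finite_I by (simp add: finite_subset)
    from this that show ?thesis
    proof (induction J)
      case empty
      have "0 \<in> relations (\<lambda>_. D (Suc m))"
        by (intro zero_relations zero_D)
      then show ?case
        using Suc.prems by (intro bexI[of _ x]) (auto intro: bexI[of _ 0] simp: zero_D)
    next
      case (insert k J)
      then obtain x' g where x': "x' \<in> D (Suc m)" "\<forall>k\<in>J. F k x' = 0" "g \<in> D m"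
          "x - x' - g \<in> relations (\<lambda>_. D (Suc m))"
        by auto
      define w where "w = F k x'"
      have k: "k \<in> I"
        using insert by auto
      have w: "w \<in> D m"
        using F_D k x' w_def by blast
      have "- Y k w \<in> relations (\<lambda>_. D (Suc m))"
        using w k D_Suc by (intro relations_minus minus_D relations_single zero_D) auto
      from rel_add[OF x'(4) this] have "x - (x' - T k w) - (g + (Y k w + T k w)) \<in> relations (\<lambda>_. D (Suc m))"
        by (simp add: algebra_simps)
      moreover have "g + (Y k w + T k w) \<in> D m"
        using add_D x' YT_D k w by blast
      ultimately show ?case
        using clear_step[of k J x' m] insert x' k unfolding w_def by blast
    qed
  qed
  from this[OF subset_refl] obtain x' g where x': "\<forall>k\<in>I. F k x' = 0" "g \<in> D m"
      "x - x' - g \<in> relations (\<lambda>_. D (Suc m))"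
    by blast
  obtain g0 where g0: "\<forall>k\<in>I. F k g0 = 0" "g - g0 \<in> relations (\<lambda>_. D m)"
    using Suc.IH[OF x'(2)] by blast
  have "x - x' - g + (g - g0) \<in> relations (\<lambda>_. D (Suc m))"
    using rel_add x'(3) g0(2) rel_mono by blast
  then have "x - (x' + g0) \<in> relations (\<lambda>_. D (Suc m))"
    by (simp add: algebra_simps)
  moreover have "\<forall>k\<in>I. F k (x' + g0) = 0"
    using x' g0 add_F by (simp add: additive_simps)
  ultimately show ?case
    by blast
qed

text \<open>Compare leading terms by applying \<open>F i\<close>: the summand at
  \<open>j = i\<close> returns \<open>y i\<close> up to sign and lower terms, those at
  \<open>j < i\<close> vanish by normality of \<open>y j\<close>, and those at \<open>j > i\<close>
  are already one step lower if the indices are treated from the largest down. So every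
  \<open>y i\<close> drops a step, and finally all reach \<open>D 0\<close>.\<close>

lemma reduced_relation_zero:
  "s \<in> relations (normal m) \<Longrightarrow> \<forall>k\<in>I. F k s = 0 \<Longrightarrow> s = 0"
proof (induction m)
  case 0
  then show ?case
    using add_Y by (auto simp: relations_def normal_def D_0 additive_simps)
next
  case (Suc m)
  then obtain y where y: "s = (\<Sum>i\<in>I. Y i (y i))" "\<And>i. i \<in> I \<Longrightarrow> y i \<in> normal (Suc m) i"
    unfolding relations_def by blast
  have yD: "y i \<in> D (Suc m)" if "i \<in> I" for i
    using y(2)[OF that] by (simp add: normal_def)
  have "y i \<in> D m" if "i \<in> I" for i
    using that
  proof (induction "card {k \<in> I. i < k}" arbitrary: i rule: less_induct)
    case less
    have later: "y k \<in> D m" if "k \<in> I" "i < k" for k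
    proof (rule less.hyps)
      show "card {l \<in> I. k < l} < card {k \<in> I. i < k}"
        using that finite_I by (intro psubset_card_mono) auto
    qed (use that in auto)
    define u where "u = (\<Sum>j\<in>I. Y j (y j) + T j (y j))"
    have "u \<in> D (Suc m)"
      unfolding u_def using YT_D yD by (intro sum_D) auto
    then have "F i u \<in> D m"
      using F_D less.prems by blast
    moreover have "F i u = F i s + F i (\<Sum>j\<in>I. T j (y j))"
      using add_F less.prems by (simp add: u_def sum.distrib additive_simps y(1))
    moreover have "F i (\<Sum>j\<in>I. T j (y j)) = (\<Sum>j\<in>I. F i (T j (y j)))"
      using add_F less.prems by (simp add: additive.sum[OF add_F])
    moreover have "\<dots> = y i + (\<Sum>j\<in>I-{i}. F i (T j (y j)))"
      using less.prems finite_I by (simp add: sum.remove[of I i] F_T[OF _ yD])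
    moreover have "(\<Sum>j\<in>I-{i}. F i (T j (y j))) \<in> D m"
    proof (rule sum_D)
      fix j
      assume j: "j \<in> I - {i}"
      show "F i (T j (y j)) \<in> D m"
      proof (cases "j < i")
        case True
        then have "F i (y j) = 0"
          using y(2)[of j] j less.prems by (simp add: normal_def)
        then show ?thesis
          using j less.prems yD add_T zero_D by (simp add: F_T_commute[OF _ _ _ yD] additive_simps)
      next
        case False
        then have "y j \<in> D m"
          using j later by auto
        then show ?thesis
          using j less.prems F_D T_D by blast
      qed
    qed
    ultimately show ?case
      using Suc.prems(2) less.prems D_diff by fastforce
  qed
  then have "s \<in> relations (normal m)"
    using y unfolding relations_def normal_def by blast
  then show ?case
    using Suc.IH Suc.prems by blast
qed

text \<open>\<open>mul\<close> stands for multiplication by a nonzero integer. It keeps the reduced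
  part \<open>x0\<close> in the common kernel of the \<open>F k\<close>, where 0 is the only
  relation, so \<open>mul x0 = 0\<close>, and injectivity finishes.\<close>

theorem torsion_free_quotient:
  assumes "additive mul" "\<And>x. mul x = 0 \<Longrightarrow> x = 0"
    and mul_F: "\<And>i x. i \<in> I \<Longrightarrow> F i (mul x) = mul (F i x)"
    and mul_Y: "\<And>i x. i \<in> I \<Longrightarrow> Y i (mul x) = mul (Y i x)"
    and mul_D: "\<And>m x. x \<in> D m \<Longrightarrow> mul x \<in> D m"
    and "x \<in> D m" "mul x \<in> relations (\<lambda>_. D m)"
  shows "x \<in> relations (\<lambda>_. D m)"
proof -
  obtain x0 where x0: "\<forall>k\<in>I. F k x0 = 0" "x - x0 \<in> relations (\<lambda>_. D m)"
    using reduced_decomposition assms by blast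
  then obtain y where y: "x - x0 = (\<Sum>i\<in>I. Y i (y i))" "\<forall>i\<in>I. y i \<in> D m"
    unfolding relations_def by blast
  have "mul (x - x0) = (\<Sum>i\<in>I. Y i (mul (y i)))"
    unfolding y using mul_Y by (simp add: additive.sum[OF assms(1)])
  then have "mul (x - x0) \<in> relations (\<lambda>_. D m)"
    unfolding relations_def using y(2) mul_D by (intro CollectI exI[of _ "\<lambda>i. mul (y i)"]) auto
  then have "mul x + - mul (x - x0) \<in> relations (\<lambda>_. D m)"
    using assms(7) by (intro relations_add relations_minus add_D minus_D)
  then have "mul x0 \<in> relations (\<lambda>_. D m)"
    by (simp add: additive.diff[OF assms(1)])
  then obtain z where z: "mul x0 = (\<Sum>i\<in>I. Y i (z i))" "\<forall>i\<in>I. z i \<in> D m"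
    unfolding relations_def by blast
  have "(\<Sum>i\<in>J. Y i (z i)) \<in> relations (normal m)" if "J \<subseteq> I" for J
  proof -
    have "finite J"
      using that finite_I by (simp add: finite_subset)
    from this that show ?thesis
    proof (induction J)
      case empty
      show ?case
        using zero_relations[of "normal m"] normal_zero by simp
    next
      case (insert k J)
      then show ?case
        using Y_in_normal_relations z by (simp add: normal_relations_add)
    qed
  qed
  then have "mul x0 \<in> relations (normal m)"
    using z by auto
  then have "mul x0 = 0"
    by (rule reduced_relation_zero) (use x0 mul_F in \<open>simp add: additive.zero[OF assms(1)]\<close>)
  then have "x0 = 0"
    by (rule assms(2))
  then show ?thesis
    using x0 by simp
qed

end

section \<open>Rationals modulo the integers\<close>

lift_definition smul :: "int \<Rightarrow> rat_mod_1 \<Rightarrow> rat_mod_1" is "\<lambda>t a. of_int t * a"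
  by (metis Ints_mult Ints_of_int right_diff_distrib)

lemma smul_rat_class: "smul t (rat_class a) = rat_class (of_int t * a)"
  by (simp add: rat_class.abs_eq smul.abs_eq)

lemma smul_smul: "smul s (smul t x) = smul (s * t) x"
  by transfer (simp add: mult.assoc)

lemma smul_commute: "smul s (smul t x) = smul t (smul s x)"
  by (simp add: smul_smul mult.commute)

lemma smul_1 [simp]: "smul 1 x = x"
  by transfer simp

lemma smul_coprime_eqD:
  assumes "coprime s t" "smul s x = smul s y" "smul t x = smul t y"
  shows "x = y"
  using assms
proof transfer
  fix s t :: int and a b :: rat
  assume st: "coprime s t" and "of_int s * a - of_int s * b \<in> \<int>" "of_int t * a - of_int t * b \<in> \<int>"
  then have *: "of_int s * (a - b) \<in> \<int>" "of_int t * (a - b) \<in> \<int>"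
    by (simp_all add: right_diff_distrib)
  obtain i j where "i * s + j * t = 1"
    using bezout_int[of s t] st by auto
  then have "a - b = of_int (i * s + j * t) * (a - b)"
    by simp
  also have "\<dots> = of_int i * (of_int s * (a - b)) + of_int j * (of_int t * (a - b))"
    by (simp add: algebra_simps)
  also have "\<dots> \<in> \<int>"
    by (rule Ints_add[OF Ints_mult[OF Ints_of_int *(1)] Ints_mult[OF Ints_of_int *(2)]])
  finally show "a - b \<in> \<int>" .
qed

definition fraction :: "int \<Rightarrow> nat \<Rightarrow> rat_mod_1"
  where "fraction u d = rat_class (of_int u / of_nat d)"

lemma fraction_eq_iff:
  assumes "d > 0"
  shows "fraction u d = fraction v d \<longleftrightarrow> [u = v] (mod int d)"
proof -
  have "(of_int u / of_nat d - of_int v / of_nat d :: rat) \<in> \<int> \<longleftrightarrow> int d dvd u - v"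
  proof
    assume "(of_int u / of_nat d - of_int v / of_nat d :: rat) \<in> \<int>"
    then obtain k where "(of_int u / of_nat d - of_int v / of_nat d :: rat) = of_int k"
      by (elim Ints_cases)
    then have "(of_int (u - v) :: rat) = of_int (int d * k)"
      using assms by (simp add: field_simps)
    then show "int d dvd u - v"
      by (simp only: of_int_eq_iff) simp
  next
    assume "int d dvd u - v"
    then obtain k where "u - v = int d * k"
      by (elim dvdE)
    then have "of_int u - of_int v = (of_nat d * of_int k :: rat)"
      by (metis of_int_diff of_int_mult of_int_of_nat_eq)
    then have "(of_int u / of_nat d - of_int v / of_nat d :: rat) = of_int k"
      using assms by (simp flip: diff_divide_distrib)
    then show "(of_int u / of_nat d - of_int v / of_nat d :: rat) \<in> \<int>"
      by simp
  qed
  then show ?thesis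
    by (simp add: fraction_def rat_class_eq_iff cong_iff_dvd_diff)
qed

lemma fraction_cancel: "k > 0 \<Longrightarrow> fraction (int k * u) (k * d) = fraction u d"
  by (simp add: fraction_def)

lemma smul_fraction: "smul t (fraction u d) = fraction (t * u) d"
  by (simp add: fraction_def smul_rat_class)

lift_definition den :: "rat_mod_1 \<Rightarrow> nat" is "\<lambda>a. nat (snd (quotient_of a))"
proof -
  fix a b :: rat
  assume "a - b \<in> \<int>"
  then obtain k where "a - b = of_int k"
    by (elim Ints_cases)
  then have a: "a = b + of_int k"
    by (simp add: algebra_simps)
  obtain p q where pq: "quotient_of b = (p, q)"
    by fastforce
  then have "coprime p q" "q > 0" "b = of_int p / of_int q"
    by (simp_all add: quotient_of_coprime quotient_of_denom_pos quotient_of_div)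
  moreover from this have "coprime (p + k * q) q"
    using gcd_add_mult[of q k p] by (simp add: coprime_iff_gcd_eq_1 gcd.commute add.commute)
  moreover from \<open>q > 0\<close> have "a = Rat.Fract (p + k * q) q"
    unfolding a \<open>b = _\<close> Fract_of_int_quotient by (simp add: add_divide_distrib)
  ultimately have "quotient_of a = (p + k * q, q)"
    by (simp add: quotient_of_Fract normalize_stable)
  then show "nat (snd (quotient_of a)) = nat (snd (quotient_of b))"
    by (simp add: pq)
qed

lemma den_fraction:
  assumes "d > 0" "coprime u (int d)"
  shows "den (fraction u d) = d"
proof -
  have "quotient_of (of_int u / of_nat d) = (u, int d)"
    using assms quotient_of_Fract[of u "int d"] by (simp add: Fract_of_int_quotient normalize_stable)
  then show ?thesis
    by (simp add: fraction_def den.abs_eq rat_class.abs_eq)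
qed

lemma fraction_cases:
  obtains u where "coprime u (int (den x))" "x = fraction u (den x)" "den x > 0"
proof -
  obtain a where a: "x = rat_class a"
    by (metis Quotient_rat_mod_1 Quotient_abs_rep rat_class.abs_eq)
  obtain p q where pq: "quotient_of a = (p, q)"
    by fastforce
  then have "coprime p q" "q > 0" "a = of_int p / of_int q"
    by (simp_all add: quotient_of_coprime quotient_of_denom_pos quotient_of_div)
  then have "coprime p (int (nat q))" "x = fraction p (nat q)" "nat q > 0"
    by (simp_all add: fraction_def a)
  then show ?thesis
    using that den_fraction by metis
qed

lemma den_pos: "den x > 0"
  by (rule fraction_cases)

lemma smul_cong:
  assumes "[s = t] (mod int (den x))"
  shows "smul s x = smul t x"
proof (rule fraction_cases[of x])
  fix u
  assume "x = fraction u (den x)"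
  then show ?thesis
    using assms den_pos[of x] fraction_eq_iff[of "den x" "s * u" "t * u"]
    by (metis cong_mult cong_refl smul_fraction)
qed

lemma den_smul:
  assumes "coprime t (int (den x))"
  shows "den (smul t x) = den x"
proof (rule fraction_cases[of x])
  fix u
  assume "x = fraction u (den x)" "coprime u (int (den x))"
  then show ?thesis
    using assms den_pos[of x] den_fraction[of "den x" "t * u"]
    by (metis coprime_mult_left_iff smul_fraction)
qed

lemma den_smul_dvd:
  assumes "k dvd den x"
  shows "den x = k * den (smul (int k) x)"
proof (rule fraction_cases[of x])
  fix u
  assume u: "x = fraction u (den x)" "coprime u (int (den x))"
  obtain d where d: "den x = k * d"
    using assms by (elim dvdE)
  have pos: "k > 0" "d > 0"
    using den_pos[of x] d by auto
  have "smul (int k) x = fraction u d"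
    using u d pos fraction_cancel[of k u d] by (metis smul_fraction)
  moreover have "coprime u (int d)"
    using u d by (simp add: coprime_mult_right_iff)
  ultimately show ?thesis
    using d pos den_fraction by simp
qed

lemma fraction_smul_divisor:
  assumes "den b = k * den (smul (int k) b)" "b = fraction u (den b)" "coprime u (int (den b))"
  shows "smul (int k) b = fraction u (den (smul (int k) b))"
    "coprime u (int (den (smul (int k) b)))"
proof -
  let ?d = "den (smul (int k) b)"
  have "k > 0"
    using assms(1) den_pos[of b] by (cases k) auto
  then show "smul (int k) b = fraction u ?d"
    using assms fraction_cancel[of k u ?d] by (metis smul_fraction)
  show "coprime u (int ?d)"
    using assms by (metis coprime_mult_right_iff of_nat_mult)
qed

section \<open>Division by an integer in Q/Z\<close>

definition divisors :: "nat \<Rightarrow> rat_mod_1 \<Rightarrow> rat_mod_1 set"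
  where "divisors k x = {b. smul (int k) b = x}"

text \<open>Lists the fibre in the shape of the symbols \<open>(a + i) / p\<close> in the definition
  of \<open>Y\<close>, so that \<open>Y\<close> can be handled as a sum over a set.\<close>

lemma divisors_fraction:
  assumes "k > 0" "d > 0"
  shows "divisors k (fraction u d) = (\<lambda>i. fraction (u + int i * int d) (k * d)) ` {..<k}"
proof
  show "divisors k (fraction u d) \<subseteq> (\<lambda>i. fraction (u + int i * int d) (k * d)) ` {..<k}"
  proof
    fix b
    assume "b \<in> divisors k (fraction u d)"
    then have kb: "smul (int k) b = fraction u d"
      by (simp add: divisors_def)
    obtain w where w: "b = fraction w (den b)" "den b > 0"
      by (rule fraction_cases)
    have "b = fraction (int d * w) (d * den b)"
      using w assms fraction_cancel[of d] by simp
    have "fraction (int d * (int k * w)) (d * den b) = fraction (int (den b) * u) (d * den b)"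
      using kb w assms fraction_cancel[of d] fraction_cancel[of "den b" u d]
      by (metis mult.commute smul_fraction)
    then have "[int d * (int k * w) = int (den b) * u] (mod int (d * den b))"
      using assms w by (subst (asm) fraction_eq_iff) auto
    then obtain c where c: "int d * (int k * w) - int (den b) * u = int d * int (den b) * c"
      by (auto simp: cong_iff_dvd_diff elim: dvdE)
    define i where "i = nat (c mod int k)"
    have i: "int i = c mod int k" "i < k"
      using assms by (simp_all add: i_def nat_less_iff)
    have "b = fraction (int (k * d) * w) (k * d * den b)"
      using w assms fraction_cancel[of "k * d"] by simp
    also have "int (k * d) * w = int (den b) * (u + c * int d)"
      using c by (simp add: algebra_simps)
    also have "fraction (int (den b) * (u + c * int d)) (k * d * den b) = fraction (u + c * int d) (k * d)"
      using w fraction_cancel[of "den b" "u + c * int d" "k * d"] by (simp add: mult.commute mult.left_commute)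
    also have "\<dots> = fraction (u + int i * int d) (k * d)"
    proof -
      have "c = int k * (c div int k) + int i"
        using i by simp
      then have "(u + c * int d) - (u + int i * int d) = int (k * d) * (c div int k)"
        by (metis add_diff_cancel_left add_diff_cancel_right' left_diff_distrib mult.assoc mult.commute of_nat_mult)
      then show ?thesis
        using assms by (subst fraction_eq_iff) (auto simp: cong_iff_dvd_diff)
    qed
    finally show "b \<in> (\<lambda>i. fraction (u + int i * int d) (k * d)) ` {..<k}"
      using i by blast
  qed
  show "(\<lambda>i. fraction (u + int i * int d) (k * d)) ` {..<k} \<subseteq> divisors k (fraction u d)"
    using assms by (auto simp: divisors_def smul_fraction fraction_cancel fraction_eq_iff cong_def)
qed

lemma inj_on_divisors:
  assumes "k > 0" "d > 0"
  shows "inj_on (\<lambda>i. fraction (u + int i * int d) (k * d)) {..<k}"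
proof (rule inj_onI)
  fix i j
  assume ij: "i \<in> {..<k}" "j \<in> {..<k}"
    and "fraction (u + int i * int d) (k * d) = fraction (u + int j * int d) (k * d)"
  then have "int (k * d) dvd (u + int i * int d) - (u + int j * int d)"
    using assms by (subst (asm) fraction_eq_iff) (auto simp: cong_iff_dvd_diff)
  also have "(u + int i * int d) - (u + int j * int d) = (int i - int j) * int d"
    by (simp add: left_diff_distrib)
  finally have "int k dvd int i - int j"
    using assms by simp
  then have "[int i = int j] (mod int k)"
    by (simp add: cong_iff_dvd_diff)
  then show "i = j"
    using ij by (metis cong_int_iff cong_less_modulus_unique_nat lessThan_iff)
qed

lemma card_divisors: "k > 0 \<Longrightarrow> card (divisors k x) = k"
proof -
  assume k: "k > 0"
  obtain u where u: "x = fraction u (den x)" "den x > 0"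
    by (rule fraction_cases)
  have "card (divisors k (fraction u (den x))) = k"
    using u(2) k by (simp add: divisors_fraction card_image inj_on_divisors)
  with u(1) show ?thesis
    by metis
qed

lemma finite_divisors: "k > 0 \<Longrightarrow> finite (divisors k x)"
  using card_divisors[of k x] by (metis card.infinite less_irrefl)

text \<open>Injective because two elements of a fibre agree after multiplication by
  \<open>k\<close>, and \<open>t\<close> is coprime to \<open>k\<close>; surjective by counting, as
  both fibres have \<open>k\<close> elements.\<close>

lemma bij_betw_smul_divisors:
  assumes "coprime t (int k)" "k > 0"
  shows "bij_betw (smul t) (divisors k x) (divisors k (smul t x))"
proof -
  have inj: "inj_on (smul t) (divisors k x)"
    using smul_coprime_eqD[OF assms(1)] by (auto simp: inj_on_def divisors_def)
  have "smul t ` divisors k x \<subseteq> divisors k (smul t x)"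
    by (auto simp: divisors_def smul_commute)
  then have "smul t ` divisors k x = divisors k (smul t x)"
    using assms by (intro card_subset_eq finite_divisors) (auto simp: card_image[OF inj] card_divisors)
  with inj show ?thesis
    by (simp add: bij_betw_def)
qed

text \<open>If \<open>k\<close> divides \<open>den b\<close>, multiplication by \<open>k\<close>
  cancels exactly one factor \<open>k\<close>; otherwise it keeps the denominator. The first kind of
  \<open>b\<close> will carry the leading term of \<open>Y k\<close>.\<close>

lemma den_divisors:
  assumes "Factorial_Ring.prime k" "b \<in> divisors k x"
  shows "den b = k * den x \<or> den b = den x \<and> \<not> k dvd den x"
proof (cases "k dvd den b")
  case True
  then show ?thesis
    using den_smul_dvd[of k b] assms(2) by (simp add: divisors_def)
next
  case False
  then have "coprime (int k) (int (den b))"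
    using assms(1) by (simp add: prime_imp_coprime)
  then show ?thesis
    using False den_smul[of "int k" b] assms(2) by (auto simp: divisors_def)
qed

section \<open>Numerators at a prime and the selected division\<close>

definition num :: "rat_mod_1 \<Rightarrow> int"
  where "num x = (SOME u. x = fraction u (den x))"

lemma fraction_num: "x = fraction (num x) (den x)"
  unfolding num_def by (rule someI_ex) (metis fraction_cases)

text \<open>The numerator is determined modulo the denominator, hence modulo its
  \<open>p\<close>-part. It is the numerator that is reduced and not the \<open>p\<close>-primary
  component of \<open>x\<close>, since the latter would be multiplied by a unit under division by
  another prime.\<close>

definition residue :: "nat \<Rightarrow> rat_mod_1 \<Rightarrow> int"
  where "residue p x = num x mod int (p ^ multiplicity p (den x))"

lemma residue_fraction:
  assumes "x = fraction u (den x)"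
  shows "residue p x = u mod int (p ^ multiplicity p (den x))"
proof -
  have "[num x = u] (mod int (den x))"
    using assms fraction_num[of x] den_pos[of x] fraction_eq_iff by metis
  moreover have "int (p ^ multiplicity p (den x)) dvd int (den x)"
    using multiplicity_dvd of_nat_dvd_iff by blast
  ultimately show ?thesis
    unfolding residue_def cong_def[symmetric] by (rule cong_dvd_modulus)
qed

text \<open>If division by \<open>k\<close> enlarges the denominator, then \<open>b\<close> and
  \<open>smul (int k) b\<close> are fractions with the same numerator, and the \<open>p\<close>-part
  of the denominator does not see \<open>k\<close>.\<close>

lemma residue_divisor:
  assumes "Factorial_Ring.prime k" "Factorial_Ring.prime p" "k \<noteq> p"
    and "den b = k * den (smul (int k) b)"
  shows "multiplicity p (den b) = multiplicity p (den (smul (int k) b))"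
    and "residue p b = residue p (smul (int k) b)"
proof -
  let ?x = "smul (int k) b"
  have "den ?x \<noteq> 0" "k \<noteq> 0"
    using den_pos[of ?x] assms by auto
  then show m: "multiplicity p (den b) = multiplicity p (den ?x)"
    using assms by (simp add: prime_elem_multiplicity_mult_distrib prime_multiplicity_other)
  obtain u where u: "b = fraction u (den b)" "coprime u (int (den b))"
    by (rule fraction_cases)
  from residue_fraction[OF u(1)] residue_fraction[OF fraction_smul_divisor(1)[OF assms(4) u]] m
  show "residue p b = residue p ?x"
    by simp
qed

text \<open>Among the \<open>b\<close> with \<open>p b = x\<close> and \<open>den b = p * den x\<close> exactly one is selected, and the condition depends
  only on the numerator modulo the \<open>p\<close>-part of the denominator. The bound \<open>\<le>\<close> instead of \<open><\<close> makes the residue 1 the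
  selected one when \<open>p\<close> divides the denominator exactly once.\<close>

definition selected :: "nat \<Rightarrow> rat_mod_1 \<Rightarrow> bool"
  where "selected p x \<longleftrightarrow> p dvd den x \<and> residue p x \<le> int (p ^ (multiplicity p (den x) - 1))"

lemma selected_divisor:
  assumes "Factorial_Ring.prime k" "Factorial_Ring.prime p" "k \<noteq> p"
    and "den b = k * den (smul (int k) b)"
  shows "selected p b \<longleftrightarrow> selected p (smul (int k) b)"
proof -
  have "\<not> p dvd k"
    using assms primes_dvd_imp_eq by blast
  then have "p dvd den b \<longleftrightarrow> p dvd den (smul (int k) b)"
    using assms(2,4) prime_dvd_mult_iff by metis
  then show ?thesis
    using residue_divisor[OF assms] by (simp add: selected_def)
qed

lemma full_divisors_iff:
  assumes "k > 0" "x = fraction u (den x)"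
  shows "b \<in> divisors k x \<and> den b = k * den x \<longleftrightarrow>
    (\<exists>w. b = fraction w (k * den x) \<and> coprime w (int (k * den x)) \<and> [w = u] (mod int (den x)))"
proof
  assume b: "b \<in> divisors k x \<and> den b = k * den x"
  obtain w where w: "coprime w (int (den b))" "b = fraction w (den b)"
    by (rule fraction_cases)
  have "fraction w (den x) = smul (int k) b"
    using w b assms fraction_cancel[of k w "den x"] by (metis smul_fraction)
  then have "[w = u] (mod int (den x))"
    using b assms den_pos[of x] fraction_eq_iff by (metis (mono_tags) divisors_def mem_Collect_eq)
  with w b show "\<exists>w. b = fraction w (k * den x) \<and> coprime w (int (k * den x)) \<and> [w = u] (mod int (den x))"
    by auto
next
  assume "\<exists>w. b = fraction w (k * den x) \<and> coprime w (int (k * den x)) \<and> [w = u] (mod int (den x))"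
  then obtain w where w: "b = fraction w (k * den x)" "coprime w (int (k * den x))" "[w = u] (mod int (den x))"
    by blast
  have "smul (int k) b = fraction w (den x)"
    using w assms fraction_cancel[of k w "den x"] by (metis smul_fraction)
  also have "\<dots> = x"
    using w assms den_pos[of x] fraction_eq_iff by metis
  finally show "b \<in> divisors k x \<and> den b = k * den x"
    using w assms den_pos[of x] den_fraction[of "k * den x" w] by (simp add: divisors_def)
qed

text \<open>Let \<open>d = p ^ m * e\<close> with \<open>e\<close> prime to \<open>p\<close>. The
  candidates are numerators \<open>w\<close> modulo \<open>p * d\<close>, prime to
  \<open>p * d\<close> and congruent to \<open>u\<close> modulo \<open>d\<close>. Selection forces
  the residue of \<open>w\<close> modulo \<open>p ^ Suc m\<close> to be \<open>u mod p ^ m\<close>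
  if \<open>m > 0\<close> and 1 if \<open>m = 0\<close>; together with the residue modulo
  \<open>e\<close> this determines \<open>w\<close>.\<close>

lemma selected_unique:
  assumes "Factorial_Ring.prime p"
  shows "\<exists>!b. b \<in> divisors p x \<and> den b = p * den x \<and> selected p b"
proof -
  have p: "p > 1" "p > 0"
    using assms prime_gt_1_nat prime_gt_0_nat by auto
  obtain u where u: "coprime u (int (den x))" "x = fraction u (den x)"
    by (rule fraction_cases)
  define d where "d = den x"
  define m where "m = multiplicity p d"
  have d: "d > 0"
    using den_pos by (simp add: d_def)
  have "\<exists>e. d = p ^ m * e \<and> \<not> p dvd e"
    unfolding m_def
    by (rule multiplicity_decompose'[of d p]) (use p d in \<open>auto simp: assms\<close>)
  then obtain e where e: "d = p ^ m * e" "\<not> p dvd e"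
    by blast
  have pdvd: "p dvd d \<longleftrightarrow> m > 0"
    using e assms by (cases m) (auto simp: prime_dvd_mult_iff)
  have coprime_pe: "coprime (int e) (int p)"
    using prime_imp_coprime[of p e] e assms by (simp add: coprime_commute)
  have mult_pd: "multiplicity p (p * d) = Suc m"
    using assms d p by (simp add: m_def prime_elem_multiplicity_mult_distrib)
  note char = full_divisors_iff[OF p(2) u(2), folded d_def]
  have selected_iff: "selected p (fraction w (p * d)) \<longleftrightarrow> w mod int (p ^ Suc m) \<le> int (p ^ m)"
    if "coprime w (int (p * d))" for w
  proof -
    have "den (fraction w (p * d)) = p * d"
      using den_fraction that p d by simp
    then show ?thesis
      using residue_fraction[of "fraction w (p * d)" w p] mult_pd by (simp add: selected_def)
  qed
  show ?thesis
  proof (rule ex_ex1I)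
    define r where "r = (if m > 0 then u mod int (p ^ m) else 1)"
    have "int (p ^ m) dvd r - u"
      using e by (auto simp: r_def cong_def simp flip: cong_iff_dvd_diff)
    then obtain q where q: "r - u = int (p ^ m) * q"
      by (elim dvdE)
    obtain e' where "[int e * e' = 1] (mod int p)"
      using cong_solve_coprime_int[OF coprime_pe] by blast
    then obtain c where c: "int e * e' - 1 = int p * c"
      by (auto simp: cong_iff_dvd_diff elim: dvdE)
    \<comment> \<open>As \<open>e'\<close> inverts \<open>e\<close> modulo \<open>p\<close>, adding
      \<open>q * e'\<close> times \<open>d\<close> moves the numerator from \<open>u\<close> to
      \<open>r\<close> modulo \<open>p ^ Suc m\<close> and does not change it modulo
      \<open>d\<close>.\<close>
    define w where "w = u + q * e' * int d"
    have "w - r = int (p ^ m) * q * (int e * e' - 1)"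
      using q e by (simp add: w_def algebra_simps)
    also have "\<dots> = int (p ^ Suc m) * (q * c)"
      by (simp add: c)
    finally have wr: "[w = r] (mod int (p ^ Suc m))"
      by (simp add: cong_iff_dvd_diff)
    have wu: "[w = u] (mod int d)"
      by (simp add: w_def cong_iff_dvd_diff)
    have "coprime w (int d)"
      using u(1) wu d_def cong_imp_coprime cong_sym by metis
    moreover have "coprime w (int p)"
    proof (cases "m > 0")
      case True
      then have "int p dvd int d"
        using pdvd by simp
      with \<open>coprime w (int d)\<close> show ?thesis
        by (meson coprime_divisors dvd_refl)
    next
      case False
      then show ?thesis
        using wr cong_imp_coprime[of 1 w "int p"] by (simp add: r_def cong_sym)
    qed
    ultimately have w: "coprime w (int (p * d))"
      by simp
    have r: "0 \<le> r" "r \<le> int (p ^ m)"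
      using p by (auto simp: r_def intro: less_imp_le)
    then have "r < int (p ^ Suc m)"
      using p by (metis less_le_trans not_le of_nat_less_iff of_nat_le_iff order.strict_trans1 power_strict_increasing_iff lessI)
    then have "w mod int (p ^ Suc m) = r"
      using wr r by (simp add: cong_def)
    then have "selected p (fraction w (p * d))"
      using r w selected_iff by simp
    with w wu show "\<exists>b. b \<in> divisors p x \<and> den b = p * den x \<and> selected p b"
      using char[of "fraction w (p * d)"] unfolding d_def by blast
  next
    fix b b'
    assume "b \<in> divisors p x \<and> den b = p * den x \<and> selected p b"
      and "b' \<in> divisors p x \<and> den b' = p * den x \<and> selected p b'"
    then obtain w w' where w: "b = fraction w (p * d)" "coprime w (int (p * d))" "[w = u] (mod int d)"
        "w mod int (p ^ Suc m) \<le> int (p ^ m)"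
      and w': "b' = fraction w' (p * d)" "coprime w' (int (p * d))" "[w' = u] (mod int d)"
        "w' mod int (p ^ Suc m) \<le> int (p ^ m)"
      using char selected_iff d_def by metis
    have ww: "[w = w'] (mod int d)"
      using w(3) w'(3) cong_sym cong_trans by blast
    \<comment> \<open>Admissible numerators are prime to \<open>p\<close>. So the residue is not 0,
      and for \<open>m > 0\<close> it cannot attain the bound \<open>p ^ m\<close>.\<close>
    have bound: "0 < v mod int (p ^ Suc m)" "m > 0 \<Longrightarrow> v mod int (p ^ Suc m) < int (p ^ m)"
      if "coprime v (int (p * d))" "v mod int (p ^ Suc m) \<le> int (p ^ m)" for v
    proof -
      have "\<not> int p dvd v"
        using that(1) p coprime_common_divisor[of v "int (p * d)" "int p"] by auto
      moreover have "int p dvd int (p ^ Suc m)"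
        by simp
      ultimately have *: "\<not> int p dvd v mod int (p ^ Suc m)"
        using dvd_mod_iff by blast
      then have "v mod int (p ^ Suc m) \<noteq> 0"
        by auto
      then show "0 < v mod int (p ^ Suc m)"
        using p by (metis of_nat_0_less_iff order_less_le pos_mod_sign zero_less_power)
      assume "m > 0"
      then have "int p dvd int (p ^ m)"
        by simp
      then show "v mod int (p ^ Suc m) < int (p ^ m)"
        using * that by (metis order_less_le)
    qed
    have "w mod int (p ^ Suc m) = w' mod int (p ^ Suc m)"
    proof (cases "m > 0")
      case True
      have "[w = w'] (mod int (p ^ m))"
        using ww by (rule cong_dvd_modulus) (simp add: e)
      then have "w mod int (p ^ Suc m) mod int (p ^ m) = w' mod int (p ^ Suc m) mod int (p ^ m)"
        by (simp add: mod_mod_cancel cong_def)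
      then show ?thesis
        using bound[OF w(2,4)] bound[OF w'(2,4)] True by simp
    next
      case False
      then show ?thesis
        using bound(1)[OF w(2,4)] bound(1)[OF w'(2,4)] w(4) w'(4) by simp
    qed
    then have "[w = w'] (mod int (p ^ Suc m))"
      by (simp add: cong_def)
    moreover have "[w = w'] (mod int e)"
      using ww by (rule cong_dvd_modulus) (simp add: e)
    moreover have "coprime (int (p ^ Suc m)) (int e)"
      using coprime_pe by (metis coprime_commute coprime_power_right_iff of_nat_power)
    ultimately have "[w = w'] (mod int (p ^ Suc m) * int e)"
      by (rule coprime_cong_mult)
    also have "int (p ^ Suc m) * int e = int (p * d)"
      by (simp add: e)
    finally show "b = b'"
      using w(1) w'(1) p d by (simp add: fraction_eq_iff)
  qed
qed

section \<open>Operators on symbols\<close>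

lemma additive_frag_extend: "additive (frag_extend f)"
  by (simp add: additive_def frag_extend_add)

lemma frag_additive_eqI:
  assumes "additive f" "additive g" "\<And>x. x \<in> Poly_Mapping.keys z \<Longrightarrow> f (frag_of x) = g (frag_of x)"
  shows "f z = g z"
  by (rule frag_induction[of z "Poly_Mapping.keys z"])
    (use assms in \<open>auto simp: additive.zero[of f] additive.zero[of g] additive.diff[of f] additive.diff[of g]\<close>)

definition supported :: "'a set \<Rightarrow> ('a \<Rightarrow>\<^sub>0 int) set"
  where "supported S = {z. Poly_Mapping.keys z \<subseteq> S}"

lemma supported_diff: "x \<in> supported S \<Longrightarrow> y \<in> supported S \<Longrightarrow> x - y \<in> supported S"
  using keys_diff[of x y] unfolding supported_def by blast

lemma supported_0: "0 \<in> supported S"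
  by (simp add: supported_def)

lemma supported_minus: "x \<in> supported S \<Longrightarrow> - x \<in> supported S"
  using supported_diff[OF supported_0] by force

lemma supported_add: "x \<in> supported S \<Longrightarrow> y \<in> supported S \<Longrightarrow> x + y \<in> supported S"
  using supported_diff[OF _ supported_minus] by force

lemma supported_sum: "(\<And>i. i \<in> A \<Longrightarrow> f i \<in> supported S) \<Longrightarrow> (\<Sum>i\<in>A. f i) \<in> supported S"
  by (induction A rule: infinite_finite_induct) (auto simp: supported_0 supported_add)

lemma supported_frag_of: "frag_of x \<in> supported S \<longleftrightarrow> x \<in> S"
  by (simp add: supported_def)

lemma additive_supported:
  assumes "additive h" "z \<in> supported S" "\<And>x. x \<in> S \<Longrightarrow> h (frag_of x) \<in> supported S'"
  shows "h z \<in> supported S'"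
  using assms(2) unfolding supported_def mem_Collect_eq
  by (rule frag_induction[where P = "\<lambda>z. Poly_Mapping.keys (h z) \<subseteq> S'"])
    (use assms supported_diff[of _ S'] in
      \<open>auto simp: supported_def additive.zero[OF assms(1)] additive.diff[OF assms(1)]\<close>)

definition dilate :: "int \<Rightarrow> symbols \<Rightarrow> symbols"
  where "dilate t = frag_extend (\<lambda>x. frag_of (smul t x))"

definition split :: "nat \<Rightarrow> symbols \<Rightarrow> symbols"
  where "split k = frag_extend (\<lambda>x. \<Sum>b\<in>divisors k x. frag_of b)"

definition full_divisors :: "nat \<Rightarrow> rat_mod_1 \<Rightarrow> rat_mod_1 set"
  where "full_divisors k x = {b \<in> divisors k x. den b = k * den x}"

text \<open>The part of \<open>split k\<close> that increases the number of prime factors of the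
  denominator, hence the leading term of \<open>- Y k\<close> for the filtration by that
  number.\<close>

definition raise :: "nat \<Rightarrow> symbols \<Rightarrow> symbols"
  where "raise k = frag_extend (\<lambda>x. \<Sum>b\<in>full_divisors k x. frag_of b)"

text \<open>A left inverse of \<open>raise k\<close>: exactly one symbol in the image of
  \<open>x\<close> is selected, and it is sent back to \<open>x\<close>.\<close>

definition select :: "nat \<Rightarrow> symbols \<Rightarrow> symbols"
  where "select k = frag_extend (\<lambda>x. if selected k x then frag_of (smul (int k) x) else 0)"

lemma additive_operators:
  "additive (dilate t)" "additive (split k)" "additive (raise k)" "additive (select k)"
  by (simp_all add: dilate_def split_def raise_def select_def additive_frag_extend)

lemmas dilate_simps = additive.add[OF additive_operators(1)] additive.diff[OF additive_operators(1)]
  additive.minus[OF additive_operators(1)] additive.zero[OF additive_operators(1)]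
  additive.sum[OF additive_operators(1)]
lemmas split_simps = additive.add[OF additive_operators(2)] additive.diff[OF additive_operators(2)]
  additive.minus[OF additive_operators(2)] additive.zero[OF additive_operators(2)]
  additive.sum[OF additive_operators(2)]
lemmas raise_simps = additive.add[OF additive_operators(3)] additive.diff[OF additive_operators(3)]
  additive.minus[OF additive_operators(3)] additive.zero[OF additive_operators(3)]
  additive.sum[OF additive_operators(3)]
lemmas select_simps = additive.add[OF additive_operators(4)] additive.diff[OF additive_operators(4)]
  additive.minus[OF additive_operators(4)] additive.zero[OF additive_operators(4)]
  additive.sum[OF additive_operators(4)]

lemma dilate_frag_of: "dilate t (frag_of x) = frag_of (smul t x)"
  and split_frag_of: "split k (frag_of x) = (\<Sum>b\<in>divisors k x. frag_of b)"
  and raise_frag_of: "raise k (frag_of x) = (\<Sum>b\<in>full_divisors k x. frag_of b)"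
  and select_frag_of: "select k (frag_of x) = (if selected k x then frag_of (smul (int k) x) else 0)"
  by (simp_all add: dilate_def split_def raise_def select_def)

lemma Y_eq_split:
  assumes "k > 0"
  shows "Y k z = z - split k z"
proof (rule frag_additive_eqI[where z = z])
  show "additive (Y k)"
    by (simp add: Y_def additive_frag_extend)
  show "additive (\<lambda>z. z - split k z)"
    by (simp add: additive_def split_simps)
  fix x
  obtain u d where x: "x = fraction u d" and d: "d > 0"
    using fraction_cases by blast
  have "Y k (frag_of x) = frag_of x - (\<Sum>i<k. symbol ((of_int u / of_nat d + of_nat i) / of_nat k))"
    unfolding x fraction_def Y_symbol ..
  also have "(\<Sum>i<k. symbol ((of_int u / of_nat d + of_nat i) / of_nat k)) =
      (\<Sum>i<k. frag_of (fraction (u + int i * int d) (k * d)))"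
  proof (rule sum.cong[OF refl])
    fix i
    have "(of_int u / of_nat d + of_nat i) / of_nat k =
        (of_int (u + int i * int d) / of_nat (k * d) :: rat)"
      using assms d by (simp add: add_divide_distrib mult.commute)
    then show "symbol ((of_int u / of_nat d + of_nat i) / of_nat k) =
        frag_of (fraction (u + int i * int d) (k * d))"
      by (simp only: fraction_def)
  qed
  also have "\<dots> = (\<Sum>b\<in>divisors k x. frag_of b)"
    using assms d by (simp add: x divisors_fraction sum.reindex inj_on_divisors)
  finally show "Y k (frag_of x) = frag_of x - split k (frag_of x)"
    by (simp only: split_frag_of)
qed

lemma additive_Y: "additive (Y k)"
  by (simp add: Y_def additive_frag_extend)

lemmas Y_simps = additive.add[OF additive_Y] additive.diff[OF additive_Y]
  additive.minus[OF additive_Y] additive.zero[OF additive_Y] additive.sum[OF additive_Y]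

lemma split_split:
  assumes "k > 0" "l > 0"
  shows "split l (split k z) = split (l * k) z"
proof (rule frag_additive_eqI[where z = z])
  fix x
  have *: "divisors (l * k) x = (\<Union>b\<in>divisors k x. divisors l b)"
    by (auto simp: divisors_def smul_smul mult.commute)
  show "split l (split k (frag_of x)) = split (l * k) (frag_of x)"
    unfolding split_frag_of split_simps *
    by (subst sum.UNION_disjoint) (use assms finite_divisors in \<open>auto simp: divisors_def\<close>)
qed (simp_all add: additive_def split_simps)

lemma split_commute:
  assumes "k > 0" "l > 0"
  shows "split l (split k z) = split k (split l z)"
  using assms by (simp add: split_split mult.commute)

lemma dilate_split:
  assumes "coprime t (int k)" "k > 0"
  shows "dilate t (split k z) = split k (dilate t z)"
proof (rule frag_additive_eqI[where z = z])
  fix x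
  show "dilate t (split k (frag_of x)) = split k (dilate t (frag_of x))"
    unfolding split_frag_of dilate_simps dilate_frag_of
    by (rule sum.reindex_bij_betw[OF bij_betw_smul_divisors[OF assms]])
qed (simp_all add: additive_def split_simps dilate_simps)

lemma dilate_dilate: "dilate s (dilate t z) = dilate (s * t) z"
  by (rule frag_additive_eqI[where z = z]) (simp_all add: additive_def dilate_simps dilate_frag_of smul_smul)

lemma Y_commute: "k > 0 \<Longrightarrow> l > 0 \<Longrightarrow> Y k (Y l z) = Y l (Y k z)"
  by (simp add: Y_eq_split split_simps split_commute[of k l])

lemma dilate_Y: "coprime t (int k) \<Longrightarrow> k > 0 \<Longrightarrow> dilate t (Y k z) = Y k (dilate t z)"
  by (simp add: Y_eq_split dilate_simps dilate_split)

lemma select_raise: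
  assumes "Factorial_Ring.prime k"
  shows "select k (raise k z) = z"
proof (rule frag_additive_eqI[where z = z])
  fix x
  obtain b where b: "{b \<in> full_divisors k x. selected k b} = {b}"
    using selected_unique[OF assms, of x] unfolding full_divisors_def by blast
  have fin: "finite (full_divisors k x)"
    using finite_divisors[OF prime_gt_0_nat[OF assms]] by (simp add: full_divisors_def)
  have "select k (raise k (frag_of x)) = (\<Sum>b\<in>full_divisors k x. if selected k b then frag_of x else 0)"
    unfolding raise_frag_of select_simps
    by (intro sum.cong refl) (simp add: select_frag_of full_divisors_def divisors_def)
  also have "\<dots> = (\<Sum>b\<in>{b \<in> full_divisors k x. selected k b}. frag_of x)"
    using fin by (simp add: sum.inter_filter)
  finally show "select k (raise k (frag_of x)) = frag_of x"
    by (simp add: b)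
qed (simp_all add: additive_def raise_simps select_simps)

text \<open>Full division by \<open>k\<close> changes neither the residue at \<open>l\<close> nor
  the \<open>l\<close>-part of the denominator, so being selected at \<open>l\<close> is constant on
  \<open>full_divisors k x\<close>. For selected \<open>x\<close>, multiplication by
  \<open>l\<close> removes one factor \<open>l\<close> from every denominator involved and therefore
  matches the full divisions of \<open>x\<close> with those of
  \<open>smul (int l) x\<close>.\<close>

lemma select_raise_commute:
  assumes "Factorial_Ring.prime k" "Factorial_Ring.prime l" "k \<noteq> l"
  shows "select l (raise k z) = raise k (select l z)"
proof (rule frag_additive_eqI[where z = z])
  fix x
  have sel: "selected l b \<longleftrightarrow> selected l x" if "b \<in> full_divisors k x" for b
    using selected_divisor[of k l b] that assms by (simp add: full_divisors_def divisors_def)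
  show "select l (raise k (frag_of x)) = raise k (select l (frag_of x))"
  proof (cases "selected l x")
    case False
    then show ?thesis
      using sel by (simp add: raise_frag_of select_simps select_frag_of raise_simps)
  next
    case True
    then have lx: "l dvd den x"
      by (simp add: selected_def)
    have l: "l > 0" and k: "k > 0"
      using assms prime_gt_0_nat by auto
    have coprime: "coprime (int l) (int k)"
      using assms primes_coprime[of l k] by simp
    have "bij_betw (smul (int l)) (full_divisors k x) (full_divisors k (smul (int l) x))"
    proof -
      have "den (smul (int l) b) = k * den (smul (int l) x) \<longleftrightarrow> den b = k * den x"
        if "b \<in> divisors k x" for b
      proof -
        have "l dvd den b"
          using that den_divisors[OF assms(1) that] lx by auto
        then have "den b = l * den (smul (int l) b)"
          by (rule den_smul_dvd)
        moreover have "den x = l * den (smul (int l) x)"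
          using lx by (rule den_smul_dvd)
        ultimately show ?thesis
          using l by (metis mult.left_commute nat_mult_eq_cancel1)
      qed
      moreover have bij: "bij_betw (smul (int l)) (divisors k x) (divisors k (smul (int l) x))"
        by (rule bij_betw_smul_divisors[OF coprime k])
      ultimately have "smul (int l) ` full_divisors k x = full_divisors k (smul (int l) x)"
        unfolding full_divisors_def bij_betw_imp_surj_on[OF bij, symmetric] by auto
      moreover have "inj_on (smul (int l)) (full_divisors k x)"
        using bij unfolding full_divisors_def bij_betw_def by (auto intro: inj_on_subset)
      ultimately show ?thesis
        by (simp add: bij_betw_def)
    qed
    then show ?thesis
      using True sel unfolding raise_frag_of select_simps select_frag_of
      by (simp add: raise_frag_of sum.reindex_bij_betw[symmetric])
  qed
qed (simp_all add: additive_def raise_simps select_simps)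

lemma select_commute:
  assumes "Factorial_Ring.prime k" "Factorial_Ring.prime l"
  shows "select l (select k z) = select k (select l z)"
proof (cases "k = l")
  case False
  show ?thesis
  proof (rule frag_additive_eqI[where z = z])
    fix x
    have *: "selected i (smul (int j) x) \<longleftrightarrow> selected i x"
      if "selected j x" "Factorial_Ring.prime i" "Factorial_Ring.prime j" "i \<noteq> j" for i j
      using that selected_divisor[of j i x] den_smul_dvd[of j x] by (simp add: selected_def[of j])
    show "select l (select k (frag_of x)) = select k (select l (frag_of x))"
      using *[of k l] *[of l k] assms False
      by (auto simp: select_frag_of select_simps smul_commute)
  qed (simp_all add: additive_def select_simps)
qed simp

section \<open>Torsion-freeness at a fixed level\<close>

definition level :: "nat \<Rightarrow> rat_mod_1 \<Rightarrow> nat"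
  where "level p x = multiplicity p (den x)"

text \<open>Chooses one of \<open>x\<close> and its negative, provided that
  \<open>p ^ level p x > 2\<close>. As it depends only on the residue and the level, full division
  by other primes preserves the choice.\<close>

definition half :: "nat \<Rightarrow> rat_mod_1 \<Rightarrow> bool"
  where "half p x \<longleftrightarrow> 2 * residue p x < int (p ^ level p x)"

lemma den_uminus: "den (smul (- 1) x) = den x"
  by (rule den_smul) simp

lemma smul_uminus_uminus: "smul (- 1) (smul (- 1) x) = x"
  by (simp add: smul_smul)

lemma level_uminus: "level p (smul (- 1) x) = level p x"
  by (simp add: level_def den_uminus)

text \<open>With \<open>q = p ^ level p x\<close>, negation turns the residue \<open>r\<close> into
  \<open>q - r\<close>. The middle value \<open>2 * r = q\<close> cannot occur since
  \<open>r\<close> is prime to \<open>q > 2\<close>.\<close>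

lemma half_uminus:
  assumes "p ^ level p x > 2"
  shows "half p (smul (- 1) x) \<longleftrightarrow> \<not> half p x"
proof -
  obtain u where u: "coprime u (int (den x))" "x = fraction u (den x)"
    by (rule fraction_cases)
  define q where "q = int (p ^ level p x)"
  have q: "q > 2"
    using assms by (simp add: q_def flip: of_nat_power)
  have "q dvd int (den x)"
    unfolding q_def level_def using multiplicity_dvd of_nat_dvd_iff by blast
  then have coprime: "coprime u q"
    using u(1) coprime_divisors dvd_refl by blast
  define r where "r = u mod q"
  have "gcd r q = 1"
    using coprime q by (simp add: r_def coprime_iff_gcd_eq_1 gcd_mod_left)
  then have "coprime r q"
    by (simp add: coprime_iff_gcd_eq_1)
  have "2 * r \<noteq> q"
  proof
    assume "2 * r = q"
    then have "r dvd q"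
      by (metis dvd_triv_right)
    then have "is_unit r"
      using \<open>coprime r q\<close> by (meson coprime_common_divisor dvd_refl)
    then show False
      using \<open>2 * r = q\<close> q by auto
  qed
  have "r \<noteq> 0"
    using \<open>coprime r q\<close> q by auto
  have "residue p x = r"
    using residue_fraction[OF u(2)] by (simp add: r_def q_def level_def)
  moreover have "residue p (smul (- 1) x) = (- u) mod q"
  proof -
    have "smul (- 1) x = fraction (- u) (den (smul (- 1) x))"
      unfolding den_uminus using u(2) smul_fraction[of "- 1" u "den x"] by simp
    from residue_fraction[OF this, of p] show ?thesis
      by (simp add: den_uminus q_def level_def)
  qed
  moreover have "(- u) mod q = q - r"
    using \<open>r \<noteq> 0\<close> by (simp add: r_def zmod_zminus1_eq_if)
  ultimately show ?thesis
    using \<open>2 * r \<noteq> q\<close> by (auto simp: half_def level_uminus q_def)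
qed

lemma level_divisors:
  assumes "Factorial_Ring.prime k" "Factorial_Ring.prime p" "k \<noteq> p" "b \<in> divisors k x"
  shows "level p b = level p x"
  using den_divisors[OF assms(1,4)] residue_divisor(1)[OF assms(1-3), of b] assms(4)
  by (auto simp: level_def divisors_def)

text \<open>Realizes level \<open>K\<close> modulo \<open>1 + c\<close> as the free group on the
  chosen half, so that one can compute with symbols instead of cosets.\<close>

definition fold_level :: "nat \<Rightarrow> nat \<Rightarrow> symbols \<Rightarrow> symbols"
  where "fold_level p K = frag_extend (\<lambda>x. if level p x \<noteq> K then 0
    else if half p x then frag_of x else - frag_of (smul (- 1) x))"

lemma additive_fold: "additive (fold_level p K)"
  by (simp add: fold_level_def additive_frag_extend)

lemmas fold_simps = additive.add[OF additive_fold] additive.diff[OF additive_fold]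
  additive.minus[OF additive_fold] additive.zero[OF additive_fold] additive.sum[OF additive_fold]

lemma fold_frag_of: "fold_level p K (frag_of x) = (if level p x \<noteq> K then 0
    else if half p x then frag_of x else - frag_of (smul (- 1) x))"
  by (simp add: fold_level_def)

lemma fold_even:
  assumes "p ^ K > 2"
  shows "fold_level p K (z + dilate (- 1) z) = 0"
proof -
  have "fold_level p K (z + dilate (- 1) z) = (\<lambda>_. 0) z"
  proof (rule frag_additive_eqI[where z = z])
    fix x
    show "fold_level p K (frag_of x + dilate (- 1) (frag_of x)) = 0"
      using half_uminus[of p x] assms
      by (auto simp: fold_simps dilate_frag_of fold_frag_of level_uminus smul_uminus_uminus)
  qed (simp_all add: additive_def fold_simps dilate_simps)
  then show ?thesis .
qed

text \<open>\<open>Y k\<close> keeps the level and commutes with negation, so it descends to the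
  quotient by \<open>1 + c\<close>. This makes the folded operators commute with each other.\<close>

lemma fold_Y:
  assumes "Factorial_Ring.prime k" "Factorial_Ring.prime p" "k \<noteq> p" "p ^ K > 2"
  shows "fold_level p K (Y k (fold_level p K z)) = fold_level p K (Y k z)"
proof (rule frag_additive_eqI[where z = z])
  fix x
  have k: "k > 0"
    using assms prime_gt_0_nat by auto
  consider "level p x \<noteq> K" | "level p x = K" "half p x" | "level p x = K" "\<not> half p x"
    by blast
  then show "fold_level p K (Y k (fold_level p K (frag_of x))) = fold_level p K (Y k (frag_of x))"
  proof cases
    case 1
    then show ?thesis
      using level_divisors[OF assms(1-3), of _ x] k
      by (simp add: fold_frag_of Y_eq_split split_simps split_frag_of fold_simps)
  next
    case 2
    then show ?thesis
      by (simp add: fold_frag_of)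
  next
    case 3
    have "fold_level p K (Y k (frag_of x) + dilate (- 1) (Y k (frag_of x))) = 0"
      using assms(4) by (rule fold_even)
    moreover have "dilate (- 1) (Y k (frag_of x)) = Y k (frag_of (smul (- 1) x))"
      using k by (simp add: dilate_Y dilate_frag_of)
    ultimately show ?thesis
      using 3 by (simp add: fold_frag_of Y_simps fold_simps add_eq_0_iff)
  qed
qed (simp_all add: additive_def Y_simps fold_simps)

text \<open>The filtration counts prime factors of the denominator with multiplicity. The strict
  inequality makes step 0 empty, as \<open>D 0 = {0}\<close> demands.\<close>

definition half_symbols :: "nat \<Rightarrow> nat \<Rightarrow> nat \<Rightarrow> rat_mod_1 set"
  where "half_symbols p K m =
    {x. level p x = K \<and> half p x \<and> size (prime_factorization (den x)) < m}"

lemma size_full_divisors: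
  assumes "Factorial_Ring.prime k" "b \<in> full_divisors k x"
  shows "size (prime_factorization (den b)) = Suc (size (prime_factorization (den x)))"
  using assms den_pos[of x] prime_gt_0_nat[of k]
  by (simp add: full_divisors_def prime_factorization_mult prime_factorization_prime)

lemma half_symbols_full_divisors:
  assumes "Factorial_Ring.prime k" "Factorial_Ring.prime p" "k \<noteq> p" "b \<in> full_divisors k x"
  shows "b \<in> half_symbols p K (Suc m) \<longleftrightarrow> x \<in> half_symbols p K m"
proof -
  have b: "den b = k * den (smul (int k) b)" "smul (int k) b = x"
    using assms(4) by (auto simp: full_divisors_def divisors_def)
  show ?thesis
    using residue_divisor[OF assms(1-3) b(1)] size_full_divisors[OF assms(1,4)]
    by (simp add: half_symbols_def half_def level_def b(2))
qed

text \<open>Full divisions stay in the chosen half, so folding does not affect \<open>raise\<close>.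
  The other divisions may leave the half, but they keep the denominator and so does folding, hence
  they contribute only to the same filtration step.\<close>

lemma leading_terms_fold:
  assumes "Factorial_Ring.prime p" "p ^ K > 2" "finite I"
    and I: "\<And>k. k \<in> I \<Longrightarrow> Factorial_Ring.prime k \<and> k \<noteq> p"
  shows "leading_terms (\<lambda>m. supported (half_symbols p K m)) I (\<lambda>k z. fold_level p K (Y k z)) raise select"
proof (rule leading_terms.intro)
  have I_pos: "k > 0" if "k \<in> I" for k
    using I that prime_gt_0_nat by blast
  show "finite I" by fact
  show "supported (half_symbols p K 0) = {0}"
    by (auto simp: supported_def half_symbols_def)
  show "x - y \<in> supported (half_symbols p K m)"
    if "x \<in> supported (half_symbols p K m)" "y \<in> supported (half_symbols p K m)" for m x y
    using that by (rule supported_diff)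
  show "supported (half_symbols p K m) \<subseteq> supported (half_symbols p K (Suc m))" for m
    by (fastforce simp: supported_def half_symbols_def)
  show "additive (\<lambda>z. fold_level p K (Y i z))" for i
    by (simp add: additive_def fold_simps Y_simps)
  show "additive (raise i)" for i
    by (rule additive_operators)
  show "additive (select i)" for i
    by (rule additive_operators)
  show "raise i x \<in> supported (half_symbols p K (Suc m))"
    if "i \<in> I" "x \<in> supported (half_symbols p K m)" for i m x
    using additive_operators(3) that(2)
  proof (rule additive_supported)
    fix y
    assume "y \<in> half_symbols p K m"
    then show "raise i (frag_of y) \<in> supported (half_symbols p K (Suc m))"
      unfolding raise_frag_of
      using I that assms half_symbols_full_divisors[of i p _ y K m]
      by (intro supported_sum) (simp add: supported_frag_of)
  qed
  show "select i x \<in> supported (half_symbols p K m)"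
    if "i \<in> I" "x \<in> supported (half_symbols p K (Suc m))" for i m x
    using additive_operators(4) that(2)
  proof (rule additive_supported)
    fix y
    assume y: "y \<in> half_symbols p K (Suc m)"
    show "select i (frag_of y) \<in> supported (half_symbols p K m)"
    proof (cases "selected i y")
      case True
      then have "y \<in> full_divisors i (smul (int i) y)"
        using den_smul_dvd[of i y] by (simp add: selected_def full_divisors_def divisors_def)
      then have "smul (int i) y \<in> half_symbols p K m"
        using y half_symbols_full_divisors I that(1) assms by blast
      then show ?thesis
        using True by (simp add: select_frag_of supported_frag_of)
    qed (simp add: select_frag_of supported_0)
  qed
  show "fold_level p K (Y i x) + raise i x \<in> supported (half_symbols p K m)"
    if i: "i \<in> I" and x: "x \<in> supported (half_symbols p K m)" for i m x
  proof (rule additive_supported[where h = "\<lambda>x. fold_level p K (Y i x) + raise i x", OF _ x])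
    show "additive (\<lambda>x. fold_level p K (Y i x) + raise i x)"
      by (simp add: additive_def fold_simps Y_simps raise_simps)
    fix y
    assume y: "y \<in> half_symbols p K m"
    have fin: "finite (divisors i y)"
      using I_pos i by (simp add: finite_divisors)
    have sub: "full_divisors i y \<subseteq> divisors i y"
      by (auto simp: full_divisors_def)
    have full: "fold_level p K (frag_of b) = frag_of b" if "b \<in> full_divisors i y" for b
    proof -
      have "b \<in> half_symbols p K (Suc m)"
        using that y I i assms half_symbols_full_divisors by blast
      then show ?thesis
        by (simp add: half_symbols_def fold_frag_of)
    qed
    have rest: "fold_level p K (frag_of b) \<in> supported (half_symbols p K m)"
      if "b \<in> divisors i y - full_divisors i y" for b
    proof -
      have "den b = den y"
        using that den_divisors[of i b y] I i by (auto simp: full_divisors_def)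
      moreover from this have "level p b = K"
        using y by (simp add: level_def half_symbols_def)
      ultimately show ?thesis
        using y half_uminus[of p b] assms(2)
        by (auto simp: fold_frag_of supported_frag_of half_symbols_def level_uminus den_uminus
            intro!: supported_minus)
    qed
    have "fold_level p K (Y i (frag_of y)) + raise i (frag_of y) =
        frag_of y - (\<Sum>b\<in>divisors i y - full_divisors i y. fold_level p K (frag_of b))"
      using y I_pos[OF i] sum.subset_diff[OF sub fin, of "\<lambda>b. fold_level p K (frag_of b)"] full
      by (simp add: Y_eq_split split_frag_of fold_simps raise_frag_of half_symbols_def fold_frag_of[of p K y])
    also have "\<dots> \<in> supported (half_symbols p K m)"
      using y rest by (intro supported_diff supported_sum) (auto simp: supported_frag_of)
    finally show "fold_level p K (Y i (frag_of y)) + raise i (frag_of y) \<in> supported (half_symbols p K m)" .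
  qed
  show "select i (raise i x) = x" if "i \<in> I" for i x
    using I that by (simp add: select_raise)
  show "select i (raise k x) = raise k (select i x)" if "i \<in> I" "k \<in> I" "i \<noteq> k" for i k x
    using I that by (simp add: select_raise_commute)
  show "select i (select k x) = select k (select i x)" if "i \<in> I" "k \<in> I" for i k x
    using I that by (simp add: select_commute)
  show "fold_level p K (Y i (fold_level p K (Y k x))) = fold_level p K (Y k (fold_level p K (Y i x)))"
    if "i \<in> I" "k \<in> I" for i k x
    using I that assms I_pos Y_commute[of i k x] by (simp add: fold_Y)
qed

text \<open>The relations of \<open>U_minus\<close> that use only the primes in \<open>I\<close>. By
  additivity one argument for each of \<open>1 + c\<close> and the \<open>Y k\<close> is enough;
  \<open>dilate (- 1)\<close> is the action of \<open>c\<close>.\<close>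

definition odd_relations :: "nat set \<Rightarrow> symbols set"
  where "odd_relations I = {w + dilate (- 1) w + (\<Sum>k\<in>I. Y k (y k)) |w y. True}"

lemma odd_relationsI:
  "x = w + dilate (- 1) w + (\<Sum>k\<in>I. Y k (y k)) \<Longrightarrow> x \<in> odd_relations I"
  unfolding odd_relations_def by blast

lemma odd_relations_add: "x \<in> odd_relations I \<Longrightarrow> y \<in> odd_relations I \<Longrightarrow> x + y \<in> odd_relations I"
proof -
  assume "x \<in> odd_relations I" "y \<in> odd_relations I"
  then obtain v w f g where "x = v + dilate (- 1) v + (\<Sum>k\<in>I. Y k (f k))"
      "y = w + dilate (- 1) w + (\<Sum>k\<in>I. Y k (g k))"
    unfolding odd_relations_def by blast
  then have "x + y = (v + w) + dilate (- 1) (v + w) + (\<Sum>k\<in>I. Y k (f k + g k))"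
    by (simp add: dilate_simps Y_simps sum.distrib)
  then show ?thesis
    by (rule odd_relationsI)
qed

lemma odd_relations_minus: "x \<in> odd_relations I \<Longrightarrow> - x \<in> odd_relations I"
proof -
  assume "x \<in> odd_relations I"
  then obtain v f where "x = v + dilate (- 1) v + (\<Sum>k\<in>I. Y k (f k))"
    unfolding odd_relations_def by blast
  then have "- x = - v + dilate (- 1) (- v) + (\<Sum>k\<in>I. Y k (- f k))"
    by (simp add: dilate_simps Y_simps sum_negf)
  then show ?thesis
    by (rule odd_relationsI)
qed

lemma odd_relations_even: "w + dilate (- 1) w \<in> odd_relations I"
proof -
  have "w + dilate (- 1) w = w + dilate (- 1) w + (\<Sum>k\<in>I. Y k 0)"
    by (simp add: Y_simps)
  then show ?thesis
    by (rule odd_relationsI)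
qed

lemma odd_relations_sum_Y: "(\<Sum>k\<in>I. Y k (y k)) \<in> odd_relations I"
proof -
  have "(\<Sum>k\<in>I. Y k (y k)) = 0 + dilate (- 1) 0 + (\<Sum>k\<in>I. Y k (y k))"
    by (simp add: dilate_simps)
  then show ?thesis
    by (rule odd_relationsI)
qed

lemma odd_relations_Y:
  assumes "finite I" "k \<in> I"
  shows "Y k z \<in> odd_relations I"
proof -
  have "Y k z = (\<Sum>i\<in>I. Y i (if i = k then z else 0))"
    using assms by (subst sum.remove[of I k]) (auto simp: Y_simps)
  then show ?thesis
    by (metis odd_relations_sum_Y)
qed

lemma finite_supported_half:
  assumes "z \<in> supported {x. level p x = K \<and> half p x}"
  shows "\<exists>m. z \<in> supported (half_symbols p K m)"
proof -
  have "finite ((\<lambda>x. size (prime_factorization (den x))) ` Poly_Mapping.keys z)"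
    by simp
  then obtain m where "\<forall>x\<in>Poly_Mapping.keys z. size (prime_factorization (den x)) < m"
    by (metis finite_nat_set_iff_bounded image_eqI)
  with assms show ?thesis
    by (auto simp: supported_def half_symbols_def intro!: exI[of _ m])
qed

lemma fold_supported:
  assumes "p ^ K > 2"
  shows "fold_level p K z \<in> supported {x. level p x = K \<and> half p x}"
proof (rule additive_supported[OF additive_fold, of z UNIV])
  fix x
  show "fold_level p K (frag_of x) \<in> supported {x. level p x = K \<and> half p x}"
    using half_uminus[of p x] assms
    by (auto simp: fold_frag_of supported_frag_of supported_0 level_uminus intro!: supported_minus)
qed (simp add: supported_def)

text \<open>On a single symbol the difference is 0 in the chosen half and
  \<open>frag_of x + frag_of (smul (- 1) x)\<close> outside it.\<close>

lemma fold_cong_even: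
  assumes "z \<in> supported {x. level p x = K}"
  shows "\<exists>w. z - fold_level p K z = w + dilate (- 1) w"
  using assms unfolding supported_def mem_Collect_eq
proof (rule frag_induction[where P = "\<lambda>z. \<exists>w. z - fold_level p K z = w + dilate (- 1) w"])
  show "\<exists>w. 0 - fold_level p K 0 = w + dilate (- 1) w"
    by (rule exI[of _ 0]) (simp add: fold_simps dilate_simps)
next
  fix x
  assume "x \<in> {x. level p x = K}"
  then have "frag_of x - fold_level p K (frag_of x) =
      (if half p x then 0 else frag_of x) + dilate (- 1) (if half p x then 0 else frag_of x)"
    by (simp add: fold_frag_of dilate_simps dilate_frag_of)
  then show "\<exists>w. frag_of x - fold_level p K (frag_of x) = w + dilate (- 1) w"
    by blast
next
  fix x y
  assume "\<exists>w. x - fold_level p K x = w + dilate (- 1) w" "\<exists>w. y - fold_level p K y = w + dilate (- 1) w"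
  then obtain v w where "x - fold_level p K x = v + dilate (- 1) v" "y - fold_level p K y = w + dilate (- 1) w"
    by blast
  then have "x - y - fold_level p K (x - y) = (v - w) + dilate (- 1) (v - w)"
    by (simp add: fold_simps dilate_simps algebra_simps)
  then show "\<exists>w. x - y - fold_level p K (x - y) = w + dilate (- 1) w"
    by blast
qed

lemma Y_supported_level:
  assumes "Factorial_Ring.prime k" "Factorial_Ring.prime p" "k \<noteq> p"
    and "z \<in> supported {x. level p x = K}"
  shows "Y k z \<in> supported {x. level p x = K}"
  using additive_Y assms(4)
proof (rule additive_supported)
  fix x
  assume "x \<in> {x. level p x = K}"
  then show "Y k (frag_of x) \<in> supported {x. level p x = K}"
    using level_divisors[OF assms(1-3)] prime_gt_0_nat[OF assms(1)]
    by (auto simp: Y_eq_split split_frag_of supported_frag_of intro!: supported_diff supported_sum)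
qed

text \<open>Folding kills the even part of the relation and leads to the system of leading terms. On
  the way back, \<open>Y k (v k)\<close> and its fold differ by an even element because
  \<open>v k\<close>, and with it \<open>Y k (v k)\<close>, has level \<open>K\<close>.\<close>

theorem odd_distribution_level_torsion_free:
  assumes "Factorial_Ring.prime p" "p ^ K > 2" "finite I"
    and I: "\<And>k. k \<in> I \<Longrightarrow> Factorial_Ring.prime k \<and> k \<noteq> p"
    and z: "z \<in> supported {x. level p x = K}"
    and n: "n \<noteq> 0" "frag_cmul n z \<in> odd_relations I"
  shows "z \<in> odd_relations I"
proof -
  define S where "S = (\<lambda>m. supported (half_symbols p K m))"
  interpret leading_terms S I "\<lambda>k z. fold_level p K (Y k z)" raise select
    unfolding S_def using assms(1-4) by (rule leading_terms_fold)
  obtain w y where wy: "frag_cmul n z = w + dilate (- 1) w + (\<Sum>k\<in>I. Y k (y k))"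
    using n(2) unfolding odd_relations_def by blast
  have S_mono: "S m \<subseteq> S m'" if "m \<le> m'" for m m'
    using that by (auto simp: S_def supported_def half_symbols_def)
  have "\<forall>x. \<exists>m. fold_level p K x \<in> S m"
    unfolding S_def using fold_supported[OF assms(2)] finite_supported_half by blast
  then obtain f where f: "\<And>x. fold_level p K x \<in> S (f x)"
    by metis
  \<comment> \<open>The abstract theorem works inside a single filtration step, so one is taken that
    contains the folds of \<open>z\<close> and of all \<open>y k\<close>.\<close>
  define m where "m = Max (insert (f z) ((\<lambda>k. f (y k)) ` I))"
  have m: "fold_level p K z \<in> S m" "\<And>k. k \<in> I \<Longrightarrow> fold_level p K (y k) \<in> S m"
    using f S_mono assms(3) unfolding m_def by (meson Max_ge finite_imageI finite_insert imageI insertI1 insertI2 subsetD)+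
  have cmul_fold: "frag_cmul n (fold_level p K x) = fold_level p K (frag_cmul n x)" for x
    by (simp add: fold_level_def frag_extend_cmul)
  have "frag_cmul n (fold_level p K z) = (\<Sum>k\<in>I. fold_level p K (Y k (y k)))"
    unfolding cmul_fold wy using fold_even[OF assms(2), of w] fold_simps by simp
  also have "\<dots> = (\<Sum>k\<in>I. fold_level p K (Y k (fold_level p K (y k))))"
    using I assms(1,2) by (intro sum.cong refl) (simp add: fold_Y)
  finally have "frag_cmul n (fold_level p K z) \<in> relations (\<lambda>_. S m)"
    unfolding relations_def using m(2)
    by (intro CollectI exI[of _ "\<lambda>k. fold_level p K (y k)"] conjI ballI)
  then have "fold_level p K z \<in> relations (\<lambda>_. S m)"
  proof (rule torsion_free_quotient[rotated -1])
    show "additive (frag_cmul n :: symbols \<Rightarrow> _)"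
      by (simp add: additive_def frag_cmul_distrib2)
    show "x = 0" if "frag_cmul n x = 0" for x :: symbols
      using that n by simp
    show "select i (frag_cmul n x) = frag_cmul n (select i x)" for i x
      by (simp add: select_def frag_extend_cmul)
    show "fold_level p K (Y i (frag_cmul n x)) = frag_cmul n (fold_level p K (Y i x))" for i x
      by (simp add: cmul_fold Y_def frag_extend_cmul)
    show "frag_cmul n x \<in> S m" if "x \<in> S m" for x m
      using that keys_cmul[of n x] by (auto simp: S_def supported_def)
    show "fold_level p K z \<in> S m" by (rule m)
  qed
  then obtain v where v: "fold_level p K z = (\<Sum>k\<in>I. fold_level p K (Y k (v k)))" "\<forall>k\<in>I. v k \<in> S m"
    unfolding relations_def by blast
  have "Y k (v k) - fold_level p K (Y k (v k)) \<in> odd_relations I" if "k \<in> I" for k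
  proof -
    have "v k \<in> supported {x. level p x = K}"
      using v that by (auto simp: S_def supported_def half_symbols_def)
    then have "Y k (v k) \<in> supported {x. level p x = K}"
      using I that assms(1) Y_supported_level by blast
    from fold_cong_even[OF this] show ?thesis
      using odd_relations_even by metis
  qed
  then have "(\<Sum>k\<in>J. Y k (v k) - fold_level p K (Y k (v k))) \<in> odd_relations I" if "J \<subseteq> I" for J
  proof -
    have "finite J"
      using that assms(3) finite_subset by blast
    from this that \<open>\<And>k. k \<in> I \<Longrightarrow> _ k \<in> odd_relations I\<close> show ?thesis
    proof (induction J)
      case empty
      then show ?case
        using odd_relations_even[of 0] by (simp add: dilate_simps)
    qed (simp add: odd_relations_add)
  qed
  then have *: "(\<Sum>k\<in>I. Y k (v k)) - fold_level p K z \<in> odd_relations I"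
    unfolding v(1) sum_subtractf[symmetric] by blast
  obtain w' where "z - fold_level p K z = w' + dilate (- 1) w'"
    using fold_cong_even[OF z] by blast
  then have "z - fold_level p K z \<in> odd_relations I"
    using odd_relations_even by metis
  then have "(z - fold_level p K z) + (- ((\<Sum>k\<in>I. Y k (v k)) - fold_level p K z) + (\<Sum>k\<in>I. Y k (v k)))
      \<in> odd_relations I"
    using * odd_relations_sum_Y by (intro odd_relations_add odd_relations_minus)
  then show ?thesis
    by simp
qed

section \<open>Galois invariance of torsion\<close>

lemma additive_frag_cmul: "additive (frag_cmul n)"
  by (simp add: additive_def frag_cmul_distrib2)

text \<open>Common factors of \<open>t\<close> and the denominator are prime to \<open>p\<close>,
  and cancelling them leaves the \<open>p\<close>-part as it is.\<close>

lemma level_smul: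
  assumes "Factorial_Ring.prime p" "\<not> int p dvd t"
  shows "level p (smul t x) = level p x"
proof -
  obtain u where u: "coprime u (int (den x))" "x = fraction u (den x)"
    by (rule fraction_cases)
  define g where "g = nat (gcd t (int (den x)))"
  have g: "int g = gcd t (int (den x))" "g > 0"
    using den_pos[of x] by (auto simp: g_def)
  have "g dvd den x"
    using g(1) by (metis gcd_dvd2 of_nat_dvd_iff)
  then obtain e where e: "den x = g * e"
    by (elim dvdE)
  obtain s where s: "t = int g * s"
    using g(1) gcd_dvd1 by (metis dvdE)
  have "e > 0"
    using den_pos[of x] e by (cases e) auto
  have "int g * gcd s (int e) = gcd t (int (den x))"
    using gcd_mult_distrib_int[of "int g" s "int e"] by (simp add: s e)
  then have "int g * gcd s (int e) = int g * 1"
    using g(1) by simp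
  then have "coprime s (int e)"
    using g(2) by (simp add: coprime_iff_gcd_eq_1)
  moreover have "coprime u (int e)"
    using u(1) e by simp
  moreover have "smul t x = fraction (s * u) e"
    using u(2) fraction_cancel[OF g(2), of "s * u" e] by (metis e mult.assoc s smul_fraction)
  ultimately have "den (smul t x) = e"
    using \<open>e > 0\<close> by (simp add: den_fraction)
  moreover have "\<not> p dvd g"
    using assms(2) s by (metis dvd_mult2 of_nat_dvd_iff)
  ultimately show ?thesis
    using assms(1) g(2) \<open>e > 0\<close>
    by (simp add: level_def e prime_elem_multiplicity_mult_distrib not_dvd_imp_multiplicity_0)
qed

text \<open>Once \<open>p\<close> divides the denominator, each further division by \<open>p\<close>
  must enlarge it.\<close>

lemma den_divisors_power:
  assumes "Factorial_Ring.prime p" "p dvd den x"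
  shows "b \<in> divisors (p ^ j) x \<Longrightarrow> den b = p ^ j * den x"
proof (induction j arbitrary: b)
  case 0
  then show ?case
    by (simp add: divisors_def)
next
  case (Suc j)
  then have "smul (int p) b \<in> divisors (p ^ j) x"
    by (simp add: divisors_def smul_smul mult.commute)
  then have "den (smul (int p) b) = p ^ j * den x"
    by (rule Suc.IH)
  then show ?case
    using den_divisors[OF assms(1), of b "smul (int p) b"] assms(2) by (auto simp: divisors_def)
qed

lemma level_pos_iff: "Factorial_Ring.prime p \<Longrightarrow> 0 < level p x \<longleftrightarrow> p dvd den x"
  using den_pos[of x] by (auto simp: level_def prime_multiplicity_gt_zero_iff)

text \<open>Modulo \<open>Y p\<close> a symbol equals its \<open>split p\<close>, and in positive
  level this raises the level of all its terms by one until \<open>K\<close> is reached. In level 0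
  the split would contain a term of level 0 again; such symbols are sent to 0, and
  \<open>dilate t - 1\<close> will take care of them. Levels above \<open>K\<close> do not occur, as
  \<open>K\<close> is chosen large.\<close>

definition push :: "nat \<Rightarrow> nat \<Rightarrow> symbols \<Rightarrow> symbols"
  where "push p K = frag_extend (\<lambda>x. if 0 < level p x \<and> level p x \<le> K
    then split (p ^ (K - level p x)) (frag_of x) else 0)"

lemma additive_push: "additive (push p K)"
  by (simp add: push_def additive_frag_extend)

lemmas push_simps = additive.add[OF additive_push] additive.diff[OF additive_push]
  additive.minus[OF additive_push] additive.zero[OF additive_push] additive.sum[OF additive_push]

lemma push_frag_of: "push p K (frag_of x) = (if 0 < level p x \<and> level p x \<le> K
    then split (p ^ (K - level p x)) (frag_of x) else 0)"
  by (simp add: push_def)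

lemma push_dilate_uminus:
  assumes "p > 0"
  shows "push p K (dilate (- 1) z) = dilate (- 1) (push p K z)"
proof (rule frag_additive_eqI[where z = z])
  fix x
  show "push p K (dilate (- 1) (frag_of x)) = dilate (- 1) (push p K (frag_of x))"
    using assms by (simp add: dilate_frag_of push_frag_of level_uminus dilate_split dilate_simps)
qed (simp_all add: additive_def push_simps dilate_simps)

lemma push_Y:
  assumes "Factorial_Ring.prime k" "Factorial_Ring.prime p" "k \<noteq> p"
  shows "push p K (Y k z) = Y k (push p K z)"
proof (rule frag_additive_eqI[where z = z])
  fix x
  have pos: "k > 0" "p > 0"
    using assms prime_gt_0_nat by auto
  have "push p K (split k (frag_of x)) = split k (push p K (frag_of x))"
  proof (cases "0 < level p x \<and> level p x \<le> K")
    case True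
    then have "push p K (split k (frag_of x)) = split (p ^ (K - level p x)) (split k (frag_of x))"
      using level_divisors[OF assms, of _ x]
      by (simp add: split_frag_of[of k] push_simps push_frag_of split_simps)
    also have "\<dots> = split k (split (p ^ (K - level p x)) (frag_of x))"
      using pos by (intro split_commute) simp_all
    finally show ?thesis
      using True by (simp add: push_frag_of)
  next
    case False
    then have "push p K (frag_of b) = 0" if "b \<in> divisors k x" for b
      using level_divisors[OF assms that] by (auto simp: push_frag_of)
    with False show ?thesis
      by (auto simp: split_frag_of[of k] push_simps push_frag_of[of p K x] split_simps)
  qed
  then show "push p K (Y k (frag_of x)) = Y k (push p K (frag_of x))"
    using pos by (simp add: Y_eq_split push_simps)
qed (simp_all add: additive_def push_simps Y_simps)

lemma push_supported:
  assumes "Factorial_Ring.prime p"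
  shows "push p K z \<in> supported {x. level p x = K}"
proof (rule additive_supported[OF additive_push, of z UNIV])
  fix x
  have "level p b = K" if x: "0 < level p x" "level p x \<le> K" and b: "b \<in> divisors (p ^ (K - level p x)) x" for b
  proof -
    have "den b = p ^ (K - level p x) * den x"
      using b x level_pos_iff[OF assms] by (intro den_divisors_power[OF assms]) auto
    then have "level p b = (K - level p x) + level p x"
      using den_pos[of x] assms prime_gt_0_nat[OF assms]
      by (simp add: level_def prime_elem_multiplicity_mult_distrib prime_elem_multiplicity_power_distrib)
    then show ?thesis
      using x by simp
  qed
  then show "push p K (frag_of x) \<in> supported {x. level p x = K}"
    unfolding push_frag_of split_frag_of
    by (cases "0 < level p x \<and> level p x \<le> K")
      (simp_all only: if_True if_False simp_thms supported_0 supported_frag_of mem_Collect_eq supported_sum)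
qed (simp add: supported_def)

text \<open>In positive level, \<open>x\<close> and \<open>split p x\<close> are pushed to the same
  element, so nothing remains of \<open>Y p\<close>. In level 0 there remains, up to sign, the push
  of the divisions of level 1, and \<open>t\<close> permutes these because it fixes
  \<open>x\<close>.\<close>

lemma push_Y_same:
  assumes p: "Factorial_Ring.prime p" and t: "\<not> int p dvd t"
    and z: "z \<in> supported {x. level p x < K \<and> (level p x = 0 \<longrightarrow> smul t x = x)}"
  shows "dilate t (push p K (Y p z)) = push p K (Y p z)"
proof (rule frag_additive_eqI[where z = z])
  fix x
  assume "x \<in> Poly_Mapping.keys z"
  with z have x: "level p x < K" "level p x = 0 \<longrightarrow> smul t x = x"
    by (auto simp: supported_def)
  have pos: "p > 0"
    using p prime_gt_0_nat by auto
  have cop: "coprime t (int p)"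
    using t p by (metis coprime_commute prime_imp_coprime prime_nat_int_transfer)
  have fin: "finite (divisors p x)"
    using pos by (simp add: finite_divisors)
  show "dilate t (push p K (Y p (frag_of x))) = push p K (Y p (frag_of x))"
  proof (cases "level p x = 0")
    case False
    have lev: "level p b = Suc (level p x)" if "b \<in> divisors p x" for b
    proof -
      have "den b = p * den x"
        using den_divisors_power[OF p, of x b 1] that False level_pos_iff[OF p, of x] by simp
      then show ?thesis
        using den_pos[of x] p pos by (simp add: level_def prime_elem_multiplicity_mult_distrib)
    qed
    have "push p K (split p (frag_of x)) = (\<Sum>b\<in>divisors p x. push p K (frag_of b))"
      by (simp add: split_frag_of push_simps)
    also have "\<dots> = (\<Sum>b\<in>divisors p x. split (p ^ (K - Suc (level p x))) (frag_of b))"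
      using lev x(1) by (intro sum.cong refl) (simp add: push_frag_of)
    also have "\<dots> = split (p ^ (K - Suc (level p x))) (split p (frag_of x))"
      by (simp add: split_frag_of[of p] split_simps)
    also have "\<dots> = split (p ^ (K - level p x)) (frag_of x)"
    proof -
      have "p ^ (K - Suc (level p x)) * p = p ^ (K - level p x)"
        using x(1) by (metis Suc_diff_Suc mult.commute power_Suc)
      then show ?thesis
        using pos by (simp add: split_split)
    qed
    finally have "push p K (Y p (frag_of x)) = 0"
      using pos False x(1) by (simp add: Y_eq_split push_simps push_frag_of)
    then show ?thesis
      by (simp add: dilate_simps)
  next
    case True
    let ?B = "{b \<in> divisors p x. 0 < level p b}"
    have lev: "level p b = 1" if "b \<in> ?B" for b
    proof -
      have "den b = p * den x"
        using that True den_divisors[OF p, of b x] by (auto simp: level_def)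
      then show ?thesis
        using den_pos[of x] p pos True by (simp add: level_def prime_elem_multiplicity_mult_distrib)
    qed
    have "push p K (split p (frag_of x)) = (\<Sum>b\<in>divisors p x. push p K (frag_of b))"
      by (simp add: split_frag_of push_simps)
    also have "\<dots> = (\<Sum>b\<in>?B. split (p ^ (K - 1)) (frag_of b))"
    proof (rule sum.mono_neutral_cong_right[OF fin])
      show "push p K (frag_of b) = split (p ^ (K - 1)) (frag_of b)" if "b \<in> ?B" for b
        using lev[OF that] x(1) by (simp add: push_frag_of)
    qed (auto simp: push_frag_of)
    also have "\<dots> = split (p ^ (K - 1)) (\<Sum>b\<in>?B. frag_of b)"
      by (simp add: split_simps)
    finally have push: "push p K (Y p (frag_of x)) = - split (p ^ (K - 1)) (\<Sum>b\<in>?B. frag_of b)"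
      using pos True by (simp add: Y_eq_split push_simps push_frag_of)
    have bij: "bij_betw (smul t) (divisors p x) (divisors p x)"
      using bij_betw_smul_divisors[OF cop pos, of x] x(2) True by simp
    have "smul t ` ?B = {b \<in> smul t ` divisors p x. 0 < level p b}"
      using level_smul[OF p t] by auto
    then have "smul t ` ?B = ?B"
      using bij by (simp add: bij_betw_imp_surj_on)
    moreover have "inj_on (smul t) ?B"
      using bij unfolding bij_betw_def by (auto intro: inj_on_subset)
    ultimately have "bij_betw (smul t) ?B ?B"
      by (simp add: bij_betw_def)
    then have "dilate t (\<Sum>b\<in>?B. frag_of b) = (\<Sum>b\<in>?B. frag_of b)"
      unfolding dilate_simps dilate_frag_of by (rule sum.reindex_bij_betw)
    then show ?thesis
      using cop pos by (simp add: push dilate_simps(3) dilate_split)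
  qed
qed (simp_all add: additive_def push_simps dilate_simps Y_simps)

lemma split_power_cong_Y:
  assumes "p > 0"
  shows "\<exists>w. z - split (p ^ j) z = Y p w"
proof (induction j)
  case 0
  have "split 1 z = z"
    by (rule frag_additive_eqI[where z = z])
      (simp_all add: additive_def split_simps split_frag_of divisors_def)
  then show ?case
    by (intro exI[of _ 0]) (simp add: Y_simps)
next
  case (Suc j)
  then obtain w where w: "z - split (p ^ j) z = Y p w"
    by blast
  have "Y p (split (p ^ j) z) = split (p ^ j) z - split (p ^ Suc j) z"
    using assms by (simp add: Y_eq_split split_split)
  then have "z - split (p ^ Suc j) z = Y p (w + split (p ^ j) z)"
    by (simp add: Y_simps(1) flip: w)
  then show ?case
    by blast
qed

text \<open>In positive level, pushing changes a symbol only by an element of the image of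
  \<open>Y p\<close>. In level 0 \<open>push\<close> loses the symbol, but \<open>t\<close> fixes
  it, so both differences are 0.\<close>

lemma push_cong_Y:
  assumes p: "Factorial_Ring.prime p" and t: "\<not> int p dvd t"
    and z: "z \<in> supported {x. level p x \<le> K \<and> (level p x = 0 \<longrightarrow> smul t x = x)}"
  shows "\<exists>w. (dilate t z - z) - (dilate t (push p K z) - push p K z) = Y p w"
  using z unfolding supported_def mem_Collect_eq
proof (rule frag_induction[where P = "\<lambda>z. \<exists>w. (dilate t z - z) - (dilate t (push p K z) - push p K z) = Y p w"])
  show "\<exists>w. (dilate t 0 - 0) - (dilate t (push p K 0) - push p K 0) = Y p w"
    by (rule exI[of _ 0]) (simp add: dilate_simps push_simps Y_simps)
next
  fix x
  assume x: "x \<in> {x. level p x \<le> K \<and> (level p x = 0 \<longrightarrow> smul t x = x)}"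
  have pos: "p > 0"
    using p prime_gt_0_nat by auto
  have cop: "coprime t (int p)"
    using t p by (metis coprime_commute prime_imp_coprime prime_nat_int_transfer)
  show "\<exists>w. (dilate t (frag_of x) - frag_of x) - (dilate t (push p K (frag_of x)) - push p K (frag_of x)) = Y p w"
  proof (cases "level p x = 0")
    case True
    then show ?thesis
      using x by (intro exI[of _ 0]) (simp add: dilate_frag_of push_frag_of dilate_simps Y_simps)
  next
    case False
    then have "push p K (frag_of x) = split (p ^ (K - level p x)) (frag_of x)"
      using x by (simp add: push_frag_of)
    with split_power_cong_Y[OF pos, of "frag_of x" "K - level p x"]
    obtain w where w: "frag_of x - push p K (frag_of x) = Y p w"
      by auto
    have "(dilate t (frag_of x) - frag_of x) - (dilate t (push p K (frag_of x)) - push p K (frag_of x)) =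
        dilate t (frag_of x - push p K (frag_of x)) - (frag_of x - push p K (frag_of x))"
      by (simp add: dilate_simps)
    also have "\<dots> = Y p (dilate t w - w)"
      using cop pos by (simp add: w dilate_Y Y_simps)
    finally show ?thesis
      by blast
  qed
next
  fix x y
  assume "\<exists>w. (dilate t x - x) - (dilate t (push p K x) - push p K x) = Y p w"
    "\<exists>w. (dilate t y - y) - (dilate t (push p K y) - push p K y) = Y p w"
  then obtain v w where "(dilate t x - x) - (dilate t (push p K x) - push p K x) = Y p v"
    "(dilate t y - y) - (dilate t (push p K y) - push p K y) = Y p w"
    by blast
  then have "(dilate t (x - y) - (x - y)) - (dilate t (push p K (x - y)) - push p K (x - y)) = Y p (v - w)"
    by (simp add: dilate_simps push_simps Y_simps(2) algebra_simps flip: \<open>_ = Y p v\<close> \<open>_ = Y p w\<close>)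
  then show "\<exists>w. (dilate t (x - y) - (x - y)) - (dilate t (push p K (x - y)) - push p K (x - y)) = Y p w"
    by blast
qed

section \<open>From inertia at one prime to all exponents coprime to the denominators\<close>

lemma odd_relations_mono:
  assumes "finite J" "I \<subseteq> J"
  shows "odd_relations I \<subseteq> odd_relations J"
proof
  fix x
  assume "x \<in> odd_relations I"
  then obtain w y where x: "x = w + dilate (- 1) w + (\<Sum>k\<in>I. Y k (y k))"
    unfolding odd_relations_def by blast
  have "(\<Sum>k\<in>I. Y k (y k)) = (\<Sum>k\<in>J. Y k (if k \<in> I then y k else 0))"
    using assms by (intro sum.mono_neutral_cong_left) (auto simp: Y_simps)
  with x show "x \<in> odd_relations J"
    by (metis odd_relationsI)
qed

lemma dilate_odd_relations:
  assumes "\<And>k. k \<in> I \<Longrightarrow> coprime t (int k) \<and> k > 0" "x \<in> odd_relations I"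
  shows "dilate t x \<in> odd_relations I"
proof -
  obtain w y where x: "x = w + dilate (- 1) w + (\<Sum>k\<in>I. Y k (y k))"
    using assms(2) unfolding odd_relations_def by blast
  have "dilate t x = dilate t w + dilate (- 1) (dilate t w) + (\<Sum>k\<in>I. Y k (dilate t (y k)))"
    using assms(1) by (simp add: x dilate_simps dilate_dilate dilate_Y)
  then show ?thesis
    by (rule odd_relationsI)
qed

text \<open>Here \<open>t\<close> acts like an inertia element at \<open>p\<close>. The operator
  \<open>D\<close>, which is \<open>dilate t - 1\<close> after \<open>push\<close>, kills the
  \<open>Y p\<close> term and turns the relation into one at level \<open>K\<close> that involves
  only the other primes. Torsion-freeness there gives \<open>D a\<close>, and \<open>D a\<close>
  agrees with \<open>dilate t a - a\<close> modulo \<open>Y p\<close>.\<close>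

lemma torsion_invariant_prime_power:
  assumes I: "finite I" "\<And>k. k \<in> I \<Longrightarrow> Factorial_Ring.prime k" and p: "p \<in> I"
    and t: "\<And>k. k \<in> I \<Longrightarrow> coprime t (int k)"
    and fixed: "\<And>x. x \<in> Poly_Mapping.keys a \<union> Poly_Mapping.keys (y p) \<Longrightarrow> level p x = 0 \<Longrightarrow> smul t x = x"
    and n: "n \<noteq> 0" "frag_cmul n a = w + dilate (- 1) w + (\<Sum>k\<in>I. Y k (y k))"
  shows "dilate t a - a \<in> odd_relations I"
proof -
  have prime: "Factorial_Ring.prime p" and pos: "p > 0" and p2: "p \<ge> 2"
    using I p prime_gt_0_nat prime_ge_2_nat by blast+
  have tp: "\<not> int p dvd t"
    using t[OF p] prime by (metis coprime_common_divisor dvd_refl not_prime_unit prime_nat_int_transfer)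
  have "finite (level p ` (Poly_Mapping.keys a \<union> Poly_Mapping.keys (y p)))"
    by simp
  then obtain L where L: "\<And>x. x \<in> Poly_Mapping.keys a \<union> Poly_Mapping.keys (y p) \<Longrightarrow> level p x < L"
    by (metis finite_nat_set_iff_bounded image_eqI)
  \<comment> \<open>All occurring levels are below \<open>L\<close>; the summand 2 gives
    \<open>p ^ K > 2\<close> even for \<open>p = 2\<close>.\<close>
  define K where "K = L + 2"
  have "2 < (2::nat) ^ 2"
    by simp
  also have "\<dots> \<le> p ^ K"
    using p2 by (metis K_def le_add2 le_trans one_le_numeral power_increasing power_mono zero_le_numeral)
  finally have K: "p ^ K > 2" .
  define D where "D z = dilate t (push p K z) - push p K z" for z
  have D_add: "D (x + y) = D x + D y" for x y
    by (simp add: D_def dilate_simps push_simps)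
  have D_sum: "D (\<Sum>k\<in>J. f k) = (\<Sum>k\<in>J. D (f k))" for f and J :: "nat set"
    by (simp add: D_def dilate_simps push_simps sum_subtractf)
  have D_even: "D (dilate (- 1) x) = dilate (- 1) (D x)" for x
    using pos by (simp add: D_def push_dilate_uminus dilate_simps dilate_dilate)
  have D_Y: "D (Y k x) = Y k (D x)" if "k \<in> I" "k \<noteq> p" for k x
    using that I(2)[OF that(1)] t prime prime_gt_0_nat[of k] by (simp add: D_def push_Y dilate_Y Y_simps)
  have "D (Y p (y p)) = 0"
    using push_Y_same[OF prime tp, of "y p" K] L fixed by (auto simp: D_def supported_def K_def less_Suc_eq)
  then have "D (frag_cmul n a) = D w + dilate (- 1) (D w) + (\<Sum>k\<in>I-{p}. Y k (D (y k)))"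
    unfolding n(2) D_add D_sum D_even using p I(1) D_Y by (simp add: sum.remove)
  moreover have "D (frag_cmul n a) = frag_cmul n (D a)"
    by (simp add: D_def dilate_def push_def frag_extend_cmul additive.diff[OF additive_frag_cmul])
  ultimately have rel: "frag_cmul n (D a) \<in> odd_relations (I - {p})"
    by (metis odd_relationsI)
  have D_supported: "D a \<in> supported {x. level p x = K}"
    unfolding D_def
  proof (intro supported_diff push_supported prime)
    show "dilate t (push p K a) \<in> supported {x. level p x = K}"
      by (rule additive_supported[OF additive_operators(1) push_supported[OF prime]])
        (simp add: dilate_frag_of supported_frag_of level_smul[OF prime tp])
  qed
  have "D a \<in> odd_relations (I - {p})"
    by (rule odd_distribution_level_torsion_free[OF prime K _ _ D_supported n(1) rel]) (use I in auto)
  then have Da: "D a \<in> odd_relations I"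
    using odd_relations_mono[OF I(1)] by blast
  have "a \<in> supported {x. level p x \<le> K \<and> (level p x = 0 \<longrightarrow> smul t x = x)}"
    using L fixed by (force simp: supported_def K_def)
  then obtain v where "(dilate t a - a) - D a = Y p v"
    using push_cong_Y[OF prime tp] unfolding D_def by blast
  then have "(dilate t a - a) - D a \<in> odd_relations I"
    using odd_relations_Y[OF I(1) p] by metis
  from odd_relations_add[OF this Da] show ?thesis
    by simp
qed

lemma cong_prod_coprime_int:
  fixes x y :: int
  assumes "\<And>i j. i \<in> A \<Longrightarrow> j \<in> A \<Longrightarrow> i \<noteq> j \<Longrightarrow> coprime (m i) (m j)"
    and "\<And>i. i \<in> A \<Longrightarrow> [x = y] (mod m i)"
  shows "[x = y] (mod (\<Prod>i\<in>A. m i))"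
  using assms
proof (induction A rule: infinite_finite_induct)
  case (insert i A)
  then have "coprime (m i) (\<Prod>i\<in>A. m i)"
    by (intro prod_coprime_right) auto
  with insert show ?case
    by (simp add: coprime_cong_mult)
qed auto

text \<open>Modulo \<open>M\<close>, any \<open>t\<close> is a product of factors each of which is
  trivial away from one prime. \<open>M\<close> contains the denominators of the relation too, since
  inertia must fix the symbols of \<open>y p\<close> that are prime to \<open>p\<close>, and it
  contains the primes in \<open>I\<close>, so that \<open>dilate t\<close> commutes with their
  \<open>Y k\<close>.\<close>

theorem odd_distribution_torsion_invariant:
  assumes I: "finite I" "\<And>k. k \<in> I \<Longrightarrow> Factorial_Ring.prime k"
    and n: "n \<noteq> 0" "frag_cmul n a \<in> odd_relations I"
  obtains M J where "M > 0" "finite J" "\<And>k. k \<in> J \<Longrightarrow> Factorial_Ring.prime k"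
    "\<And>x. x \<in> Poly_Mapping.keys a \<Longrightarrow> den x dvd M"
    "\<And>t. coprime t (int M) \<Longrightarrow> dilate t a - a \<in> odd_relations J"
proof -
  obtain w y0 where wy0: "frag_cmul n a = w + dilate (- 1) w + (\<Sum>k\<in>I. Y k (y0 k))"
    using n(2) unfolding odd_relations_def by blast
  define Q where "Q = Poly_Mapping.keys a \<union> (\<Union>k\<in>I. Poly_Mapping.keys (y0 k))"
  have Q: "finite Q"
    using I(1) by (simp add: Q_def)
  define M where "M = (\<Prod>k\<in>I. k) * (\<Prod>x\<in>Q. den x)"
  \<comment> \<open>Primes that occur only in denominators are included, with zero argument
    \<open>y k\<close>, because the step at a prime \<open>p\<close> uses \<open>Y p\<close> as a
    relation.\<close>
  define J where "J = Factorial_Ring.prime_factors M"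
  define y where "y k = (if k \<in> I then y0 k else 0)" for k
  have "(\<Prod>k\<in>I. k) > 0"
    using I prime_gt_0_nat by (intro prod_pos) auto
  then have M: "M > 0"
    using den_pos by (simp add: M_def prod_pos)
  have den_M: "den x dvd M" if "x \<in> Q" for x
    using that Q unfolding M_def by (meson dvd_mult dvd_prodI)
  have IJ: "I \<subseteq> J"
  proof
    fix k
    assume k: "k \<in> I"
    then have "k dvd M"
      using dvd_prodI[OF I(1) k, of "\<lambda>x. x"] by (simp add: M_def)
    then show "k \<in> J"
      using k I(2) M by (simp add: J_def prime_factors_dvd)
  qed
  have J: "finite J" "\<And>k. k \<in> J \<Longrightarrow> Factorial_Ring.prime k" "\<And>k. k \<in> J \<Longrightarrow> k dvd M"
    by (auto simp: J_def prime_factors_dvd)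
  have "(\<Sum>k\<in>I. Y k (y0 k)) = (\<Sum>k\<in>J. Y k (y k))"
    using J(1) IJ by (intro sum.mono_neutral_cong_left) (auto simp: y_def Y_simps)
  then have wy: "frag_cmul n a = w + dilate (- 1) w + (\<Sum>k\<in>J. Y k (y k))"
    by (simp add: wy0)
  have keys_Q: "Poly_Mapping.keys a \<union> Poly_Mapping.keys (y k) \<subseteq> Q" for k
    by (auto simp: Q_def y_def)
  have dilate_cong: "dilate s a = dilate t a" if "[s = t] (mod int M)" for s t
  proof (rule frag_additive_eqI[where z = a])
    fix x
    assume "x \<in> Poly_Mapping.keys a"
    then have "[s = t] (mod int (den x))"
      using that den_M cong_dvd_modulus by (metis UnCI Q_def of_nat_dvd_iff)
    then show "dilate s (frag_of x) = dilate t (frag_of x)"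
      by (simp add: dilate_frag_of smul_cong[of s t])
  qed (rule additive_operators)+
  have dilate_1: "dilate 1 a = a"
    by (rule frag_additive_eqI[where z = a]) (simp_all add: additive_def dilate_simps dilate_frag_of)
  define v where "v p = multiplicity p M" for p
  have claim: "dilate t a - a \<in> odd_relations J"
    if "S \<subseteq> J" "coprime t (int M)" "\<And>p. p \<in> J - S \<Longrightarrow> [t = 1] (mod int (p ^ v p))" for S t
  proof -
    have "finite S"
      using that(1) J(1) finite_subset by blast
    from this that show ?thesis
    proof (induction S arbitrary: t)
      case empty
      have "M = (\<Prod>p\<in>J. p ^ v p)"
        using M by (simp add: J_def v_def prime_factorization_nat)
      moreover have "[t = 1] (mod (\<Prod>p\<in>J. int (p ^ v p)))"
        using empty J
        by (intro cong_prod_coprime_int) (auto simp: primes_coprime coprime_power_left_iff coprime_power_right_iff)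
      ultimately have "dilate t a = dilate 1 a"
        by (intro dilate_cong) simp
      then show ?case
        using odd_relations_even[of 0 J] by (simp add: dilate_1 dilate_simps)
    next
      case (insert p S)
      have p: "Factorial_Ring.prime p" "p \<in> J"
        using insert J by auto
      obtain N where N: "M = p ^ v p * N" "\<not> p dvd N"
        unfolding v_def using multiplicity_decompose'[of M p] M p
        by (metis not_prime_unit not_gr0)
      have cop: "coprime (int (p ^ v p)) (int N)"
        using N(2) p by (simp add: prime_imp_coprime)
      \<comment> \<open>\<open>s\<close> carries the action of \<open>t\<close> at \<open>p\<close>
        and is trivial at the other primes; \<open>r\<close> is trivial at \<open>p\<close> and
        carries the rest.\<close>
      obtain s where s: "[s = t] (mod int (p ^ v p))" "[s = 1] (mod int N)"
        using binary_chinese_remainder_int[OF cop] by blast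
      obtain r where r: "[r = 1] (mod int (p ^ v p))" "[r = t] (mod int N)"
        using binary_chinese_remainder_int[OF cop] by blast
      have t: "coprime t (int (p ^ v p))" "coprime t (int N)"
        using insert.prems(2) by (auto simp: N(1))
      have "coprime s (int M)" "coprime r (int M)"
        using t s r cong_imp_coprime[of t s "int (p ^ v p)"] cong_imp_coprime[of 1 s "int N"]
          cong_imp_coprime[of 1 r "int (p ^ v p)"] cong_imp_coprime[of t r "int N"]
        by (auto simp: N(1) cong_sym simp del: of_nat_power)
      have coprime_J: "coprime s (int k) \<and> k > 0" if "k \<in> J" for k
        using J(2,3)[OF that] \<open>coprime s (int M)\<close> prime_gt_0_nat
        by (metis coprime_divisors dvd_refl of_nat_dvd_iff)
      have "[s * r = t * 1] (mod int (p ^ v p))" "[s * r = 1 * t] (mod int N)"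
        by (rule cong_mult[OF s(1) r(1)], rule cong_mult[OF s(2) r(2)])
      then have "[s * r = t] (mod int (p ^ v p) * int N)"
        using cop by (intro coprime_cong_mult) auto
      then have "dilate t a = dilate s (dilate r a)"
        unfolding dilate_dilate by (intro dilate_cong) (simp add: N(1) cong_sym)
      \<comment> \<open>The cocycle identity \<open>s * r - 1 = s * (r - 1) + (s - 1)\<close>: the
        first summand falls to the induction hypothesis, the second to the case of one
        prime.\<close>
      then have "dilate t a - a = dilate s (dilate r a - a) + (dilate s a - a)"
        by (simp add: dilate_simps)
      moreover have "dilate r a - a \<in> odd_relations J"
      proof (rule insert.IH)
        show "[r = 1] (mod int (q ^ v q))" if q: "q \<in> J - S" for q
        proof (cases "q = p")
          case False
          have "coprime (q ^ v q) (p ^ v p)"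
            using J(2)[of q] q p False by (simp add: primes_coprime)
          moreover have "q ^ v q dvd p ^ v p * N"
            unfolding v_def N(1)[symmetric, unfolded v_def] by (rule multiplicity_dvd)
          ultimately have "q ^ v q dvd N"
            by (simp add: coprime_dvd_mult_right_iff)
          then have "[r = t] (mod int (q ^ v q))"
            using r(2) cong_dvd_modulus of_nat_dvd_iff by blast
          then show ?thesis
            using insert.prems(3)[of q] q False cong_trans by blast
        qed (use r in simp)
      qed (use insert.prems \<open>coprime r (int M)\<close> in auto)
      then have "dilate s (dilate r a - a) \<in> odd_relations J"
        using coprime_J by (rule dilate_odd_relations[rotated])
      moreover have "dilate s a - a \<in> odd_relations J"
      proof (rule torsion_invariant_prime_power[OF J(1,2) p(2) _ _ n(1) wy])
        show "coprime s (int k)" if "k \<in> J" for k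
          using coprime_J that by blast
        fix x
        assume x: "x \<in> Poly_Mapping.keys a \<union> Poly_Mapping.keys (y p)" and "level p x = 0"
        then have "\<not> p dvd den x"
          using level_pos_iff[OF p(1), of x] by simp
        then have "coprime (den x) (p ^ v p)"
          using p by (simp add: prime_imp_coprime coprime_commute)
        moreover have "den x dvd p ^ v p * N"
          using x den_M keys_Q by (auto simp flip: N(1))
        ultimately have "den x dvd N"
          by (simp add: coprime_dvd_mult_right_iff)
        then have "[s = 1] (mod int (den x))"
          using s(2) cong_dvd_modulus of_nat_dvd_iff by blast
        from smul_cong[OF this] show "smul s x = x"
          by simp
      qed
      ultimately show ?case
        by (metis odd_relations_add)
    qed
  qed
  show ?thesis
    using M J(1,2) den_M claim[of J] by (intro that[of M J]) (auto simp: Q_def)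
qed

section \<open>Embeddings of the algebraic numbers\<close>

lemma field_Cx: "Ring.field Cx"
  by (rule field_from_type_algebra)

lemma ring_Cx: "Ring.ring Cx"
  by (rule ring_from_type_algebra)

lemma Cx_simps: "carrier Cx = UNIV" "x \<otimes>\<^bsub>Cx\<^esub> y = x * y" "\<one>\<^bsub>Cx\<^esub> = 1" "\<zero>\<^bsub>Cx\<^esub> = 0" "x \<oplus>\<^bsub>Cx\<^esub> y = x + y"
  by (simp_all add: ring_of_type_algebra_def)

lemma Cx_minus: "\<ominus>\<^bsub>Cx\<^esub> x = - x"
proof -
  interpret Cx: Ring.field Cx
    by (rule field_Cx)
  show ?thesis
    by (rule Cx.minus_equality) (simp_all add: Cx_simps)
qed

lemma Cx_inverse:
  assumes "x \<noteq> 0"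
  shows "inv\<^bsub>Cx\<^esub> x = inverse x"
proof -
  interpret Cx: Ring.field Cx
    by (rule field_Cx)
  show ?thesis
    by (rule Cx.comm_inv_char) (use assms in \<open>simp_all add: Cx_simps\<close>)
qed

lemma Cx_power: "x [^]\<^bsub>Cx\<^esub> (n::nat) = x ^ n"
  by (induction n) (simp_all add: Cx_simps mult.commute)

text \<open>Since \<open>inverse 0 = 0\<close>, closure under inverses can be stated without
  excluding 0, and 0 itself arises as \<open>1 + - 1\<close>.\<close>

definition subfield_of_C :: "complex set \<Rightarrow> bool"
  where "subfield_of_C L \<longleftrightarrow> 1 \<in> L \<and> (\<forall>x\<in>L. - x \<in> L \<and> inverse x \<in> L) \<and>
    (\<forall>x\<in>L. \<forall>y\<in>L. x + y \<in> L \<and> x * y \<in> L)"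

lemma subfield_Cx_iff: "subfield L Cx \<longleftrightarrow> subfield_of_C L"
proof
  assume L: "subfield L Cx"
  note sub = subringE[OF subfieldE(1)[OF L], unfolded Cx_simps Cx_minus]
  have "inverse x \<in> L" if "x \<in> L" for x
  proof (cases "x = 0")
    case False
    then have "inv\<^bsub>Cx\<^esub> x \<in> L"
      using ring.subfield_m_inv(1)[OF ring_Cx L, of x] that by (simp add: Cx_simps)
    then show ?thesis
      using False by (simp add: Cx_inverse)
  qed (use sub in simp)
  with sub show "subfield_of_C L"
    by (simp add: subfield_of_C_def)
next
  assume L: "subfield_of_C L"
  show "subfield L Cx"
  proof (rule field.subfieldI'[OF field_Cx])
    show "subring L Cx"
      using L by (intro ring.subringI[OF ring_Cx]) (auto simp: Cx_simps Cx_minus subfield_of_C_def)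
    show "inv\<^bsub>Cx\<^esub> k \<in> L" if "k \<in> L - {\<zero>\<^bsub>Cx\<^esub>}" for k
      using L that by (simp add: Cx_simps Cx_inverse subfield_of_C_def)
  qed
qed

lemma subfield_of_CD:
  assumes "subfield_of_C L"
  shows "0 \<in> L" "1 \<in> L" "x \<in> L \<Longrightarrow> - x \<in> L" "x \<in> L \<Longrightarrow> inverse x \<in> L"
    "x \<in> L \<Longrightarrow> y \<in> L \<Longrightarrow> x + y \<in> L" "x \<in> L \<Longrightarrow> y \<in> L \<Longrightarrow> x * y \<in> L"
    "x \<in> L \<Longrightarrow> y \<in> L \<Longrightarrow> x - y \<in> L" "x \<in> L \<Longrightarrow> y \<in> L \<Longrightarrow> x / y \<in> L"
    "x \<in> L \<Longrightarrow> x ^ n \<in> L" "x \<in> L \<Longrightarrow> x powi k \<in> L"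
proof -
  show *: "1 \<in> L" "x \<in> L \<Longrightarrow> - x \<in> L" "x \<in> L \<Longrightarrow> inverse x \<in> L"
    "x \<in> L \<Longrightarrow> y \<in> L \<Longrightarrow> x + y \<in> L" "x \<in> L \<Longrightarrow> y \<in> L \<Longrightarrow> x * y \<in> L" for x y
    using assms by (auto simp: subfield_of_C_def)
  show "0 \<in> L"
    using *(4)[OF *(1) *(2)[OF *(1)]] by simp
  show "x \<in> L \<Longrightarrow> y \<in> L \<Longrightarrow> x - y \<in> L"
    using *(4)[of x "- y"] *(2) by simp
  show "x \<in> L \<Longrightarrow> y \<in> L \<Longrightarrow> x / y \<in> L"
    using *(5)[of x "inverse y"] *(3) by (simp add: divide_inverse)
  show pow: "x \<in> L \<Longrightarrow> x ^ n \<in> L" for x n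
    by (induction n) (use * in auto)
  show "x \<in> L \<Longrightarrow> x powi k \<in> L"
    using pow * by (simp add: power_int_def)
qed

lemma subfield_of_C_prod:
  assumes "subfield_of_C L" "\<And>i. i \<in> S \<Longrightarrow> f i \<in> L"
  shows "(\<Prod>i\<in>S. f i) \<in> L"
  using assms(2) by (induction S rule: infinite_finite_induct) (auto simp: subfield_of_CD[OF assms(1)])

lemma Rats_subset_subfield:
  assumes "subfield_of_C L"
  shows "\<rat> \<subseteq> L"
proof
  fix x :: complex
  assume "x \<in> \<rat>"
  then obtain m n :: int where "x = of_int m / of_int n"
    by (elim Rats_cases') auto
  have nat: "(of_nat k :: complex) \<in> L" for k
    by (induction k) (auto simp: subfield_of_CD[OF assms])
  have "(of_int k :: complex) \<in> L" for k
    using nat subfield_of_CD(3)[OF assms] by (cases k rule: int_cases2) auto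
  then show "x \<in> L"
    using \<open>x = _\<close> subfield_of_CD(8)[OF assms] by blast
qed

lemma subfield_of_C_Rats: "subfield_of_C \<rat>"
  by (auto simp: subfield_of_C_def)

lemma generate_field_subfield: "subfield_of_C (generate_field Cx S)"
  using field.generate_field_is_subfield[OF field_Cx, of S] by (simp add: Cx_simps subfield_Cx_iff)

lemma generate_field_subset: "S \<subseteq> generate_field Cx S"
  by (auto intro: generate_field.incl)

lemma generate_field_least: "subfield_of_C L \<Longrightarrow> S \<subseteq> L \<Longrightarrow> generate_field Cx S \<subseteq> L"
  using field.generate_field_min_subfield1[OF field_Cx, of S L] by (simp add: Cx_simps subfield_Cx_iff)

section \<open>Algebraic numbers and rational polynomials\<close>

abbreviation algebraic_number :: "complex \<Rightarrow> bool"
  where "algebraic_number x \<equiv> ring.algebraic Cx \<rat> x"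

definition rational_poly :: "complex Polynomial.poly \<Rightarrow> bool"
  where "rational_poly p \<longleftrightarrow> (\<forall>i. Polynomial.coeff p i \<in> \<rat>)"

text \<open>In HOL-Algebra a coefficient list begins with the leading coefficient, for
  \<open>Poly\<close> with the constant one; hence the reversal.\<close>

lemma Cx_eval: "ring.eval Cx p x = Polynomial.poly (Poly (rev p)) x"
proof (induction p)
  case Nil
  then show ?case
    by (simp add: Cx_simps ring.eval.simps[OF ring_Cx])
next
  case (Cons a p)
  then show ?case
    by (simp add: Cx_simps Cx_power Poly_snoc poly_monom ring.eval.simps[OF ring_Cx])
qed

lemma algebraic_number_iff:
  "algebraic_number x \<longleftrightarrow> (\<exists>p. rational_poly p \<and> p \<noteq> 0 \<and> Polynomial.poly p x = 0)"
proof
  have "subring \<rat> Cx"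
    using subfield_of_C_Rats subfieldE(1) subfield_Cx_iff by blast
  moreover assume "algebraic_number x"
  ultimately obtain p where p: "polynomial\<^bsub>Cx\<^esub> \<rat> p" "p \<noteq> []" "ring.eval Cx p x = \<zero>\<^bsub>Cx\<^esub>"
    using domain.algebraicE[OF field.axioms(1)[OF field_Cx], of \<rat> x] by (auto simp: Cx_simps univ_poly_def over_def)
  then have hd: "hd p \<noteq> 0" "set p \<subseteq> \<rat>"
    by (auto simp: polynomial_def Cx_simps)
  have "rational_poly (Poly (rev p))"
    using hd(2) by (auto simp: rational_poly_def nth_default_def rev_nth)
  moreover have "Polynomial.coeff (Poly (rev p)) (length p - 1) = hd p"
    using p(2) by (simp add: nth_default_def rev_nth hd_conv_nth)
  then have "Poly (rev p) \<noteq> 0"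
    using hd(1) by (metis coeff_0)
  ultimately show "\<exists>p. rational_poly p \<and> p \<noteq> 0 \<and> Polynomial.poly p x = 0"
    using p(3) by (auto simp: Cx_eval Cx_simps)
next
  assume "\<exists>p. rational_poly p \<and> p \<noteq> 0 \<and> Polynomial.poly p x = 0"
  then obtain p where p: "rational_poly p" "p \<noteq> 0" "Polynomial.poly p x = 0"
    by blast
  have "set (coeffs p) \<subseteq> \<rat>"
    using p(1) by (auto simp: rational_poly_def coeffs_def)
  then have "polynomial\<^bsub>Cx\<^esub> \<rat> (rev (coeffs p))"
    using p(2) by (auto simp: polynomial_def Cx_simps hd_rev last_coeffs_eq_coeff_degree)
  moreover have "ring.eval Cx (rev (coeffs p)) x = \<zero>\<^bsub>Cx\<^esub>"
    by (simp add: Cx_eval Cx_simps p)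
  ultimately show "algebraic_number x"
    using ring.algebraicI[OF ring_Cx, of "rev (coeffs p)" \<rat> x] p(2) by (simp add: univ_poly_def over_def)
qed

lemma subfield_algebraic_numbers: "subfield_of_C {x. algebraic_number x}"
  using field.subfield_of_algebraics[OF field_Cx, of \<rat>] subfield_of_C_Rats
  by (simp add: Cx_simps over_def flip: subfield_Cx_iff)

text \<open>Partial embeddings are represented by their graphs. A ring of algebraic numbers that contains
  the rationals is a field, so that nothing has to be said about inverses or injectivity.\<close>

definition partial_embedding :: "(complex \<times> complex) set \<Rightarrow> bool"
  where "partial_embedding G \<longleftrightarrow> (\<forall>q\<in>\<rat>. (q, q) \<in> G) \<and> (\<forall>(x, y)\<in>G. algebraic_number x) \<and>
    (\<forall>(x, y)\<in>G. \<forall>(x', y')\<in>G. (x + x', y + y') \<in> G \<and> (x * x', y * y') \<in> G) \<and>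
    (\<forall>y. (0, y) \<in> G \<longrightarrow> y = 0)"

lemma partial_embedding_Rats: "partial_embedding {(q, q) |q. q \<in> \<rat>}"
  using Rats_subset_subfield[OF subfield_algebraic_numbers] by (auto simp: partial_embedding_def)

lemma partial_embedding_Union:
  assumes "C \<noteq> {}" "\<And>G. G \<in> C \<Longrightarrow> partial_embedding G" "\<And>G H. G \<in> C \<Longrightarrow> H \<in> C \<Longrightarrow> G \<subseteq> H \<or> H \<subseteq> G"
  shows "partial_embedding (\<Union>C)"
proof -
  have closed: "(x + x', y + y') \<in> \<Union>C \<and> (x * x', y * y') \<in> \<Union>C"
    if "(x, y) \<in> \<Union>C" "(x', y') \<in> \<Union>C" for x y x' y'
  proof -
    obtain G H where "G \<in> C" "H \<in> C" "(x, y) \<in> G" "(x', y') \<in> H"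
      using \<open>(x, y) \<in> \<Union>C\<close> \<open>(x', y') \<in> \<Union>C\<close> by blast
    then obtain G where "G \<in> C" "(x, y) \<in> G" "(x', y') \<in> G"
      using assms(3) by blast
    then show ?thesis
      using assms(2)[of G] unfolding partial_embedding_def by blast
  qed
  obtain G where "G \<in> C"
    using assms(1) by blast
  then have "\<forall>q\<in>\<rat>. (q, q) \<in> \<Union>C"
    using assms(2)[of G] unfolding partial_embedding_def by blast
  moreover have "\<forall>(x, y)\<in>\<Union>C. algebraic_number x" "\<forall>y. (0, y) \<in> \<Union>C \<longrightarrow> y = 0"
    using assms(2) unfolding partial_embedding_def by blast+
  ultimately show ?thesis
    using closed unfolding partial_embedding_def by blast
qed

section \<open>Extending a partial embedding by one algebraic number\<close>

context
  fixes G
  assumes G: "partial_embedding G"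
begin

lemma graph_Rats: "q \<in> \<rat> \<Longrightarrow> (q, q) \<in> G"
  and graph_algebraic: "(x, y) \<in> G \<Longrightarrow> algebraic_number x"
  and graph_add: "(x, y) \<in> G \<Longrightarrow> (x', y') \<in> G \<Longrightarrow> (x + x', y + y') \<in> G"
  and graph_mult: "(x, y) \<in> G \<Longrightarrow> (x', y') \<in> G \<Longrightarrow> (x * x', y * y') \<in> G"
  and graph_0: "(0, y) \<in> G \<Longrightarrow> y = 0"
  using G unfolding partial_embedding_def by blast+

lemma graph_minus: "(x, y) \<in> G \<Longrightarrow> (- x, - y) \<in> G"
  using graph_mult[OF graph_Rats[of "- 1"]] by simp

lemma graph_diff: "(x, y) \<in> G \<Longrightarrow> (x', y') \<in> G \<Longrightarrow> (x - x', y - y') \<in> G"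
  using graph_add[OF _ graph_minus] by fastforce

lemma graph_unique: "(x, y) \<in> G \<Longrightarrow> (x, y') \<in> G \<Longrightarrow> y = y'"
  using graph_diff[of x y x y'] graph_0[of "y - y'"] by simp

lemma graph_sum: "(\<And>i. i \<in> S \<Longrightarrow> (f i, g i) \<in> G) \<Longrightarrow> ((\<Sum>i\<in>S. f i), (\<Sum>i\<in>S. g i)) \<in> G"
  by (induction S rule: infinite_finite_induct) (auto intro: graph_add graph_Rats)

lemma graph_poly:
  assumes "(x, y) \<in> G"
  shows "rational_poly p \<Longrightarrow> (Polynomial.poly p x, Polynomial.poly p y) \<in> G"
proof (induction p)
  case (pCons a p)
  have "a \<in> \<rat>" "rational_poly p"
    using pCons.prems unfolding rational_poly_def by (metis coeff_pCons_0, metis coeff_pCons_Suc)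
  then show ?case
    using pCons.IH assms by (auto intro!: graph_add graph_mult graph_Rats)
qed (auto intro: graph_Rats)

text \<open>A rational polynomial \<open>pCons c r\<close> with root \<open>x\<close> and
  \<open>c \<noteq> 0\<close> gives \<open>x * poly r x = - c\<close>. So the inverse of
  \<open>x\<close> is a rational polynomial in \<open>x\<close>, and the graph respects such
  polynomials.\<close>

lemma graph_inverse:
  assumes "(x, y) \<in> G" "x \<noteq> 0"
  shows "(inverse x, inverse y) \<in> G"
proof -
  obtain p where p: "rational_poly p" "p \<noteq> 0" "Polynomial.poly p x = 0"
    using graph_algebraic[OF assms(1)] algebraic_number_iff by blast
  \<comment> \<open>Powers of the variable can be cancelled because \<open>x \<noteq> 0\<close>,
    until the constant term is nonzero.\<close>
  have "\<exists>q. rational_poly q \<and> Polynomial.coeff q 0 \<noteq> 0 \<and> Polynomial.poly q x = 0"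
    using p
  proof (induction p)
    case (pCons a p)
    show ?case
    proof (cases "a = 0")
      case True
      then have "rational_poly p"
        using pCons.prems unfolding rational_poly_def by (metis coeff_pCons_Suc)
      then show ?thesis
        using True pCons assms(2) by auto
    next
      case False
      then show ?thesis
        using pCons.prems by (metis coeff_pCons_0)
    qed
  qed simp
  then obtain q where q: "rational_poly q" "Polynomial.coeff q 0 \<noteq> 0" "Polynomial.poly q x = 0"
    by blast
  obtain c r where r: "q = pCons c r"
    by (cases q) auto
  have c: "c \<noteq> 0" "c \<in> \<rat>"
    using q(1,2) unfolding r rational_poly_def by (auto dest: spec[of _ 0])
  have "rational_poly r"
    using q(1) unfolding r rational_poly_def by (metis coeff_pCons_Suc)
  then have *: "(- inverse c * Polynomial.poly r x, - inverse c * Polynomial.poly r y) \<in> G"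
    using graph_poly[OF assms(1)] c by (intro graph_mult graph_Rats) auto
  have "x * Polynomial.poly r x = - c"
    using q(3) by (simp add: r add_eq_0_iff)
  then have inv: "x * (- inverse c * Polynomial.poly r x) = 1"
    using c by (simp add: field_simps)
  then have "(1, y * (- inverse c * Polynomial.poly r y)) \<in> G"
    using graph_mult[OF assms(1) *] by simp
  then have "y * (- inverse c * Polynomial.poly r y) = 1"
    using graph_unique[OF graph_Rats[of 1]] by simp
  with inv * show ?thesis
    by (metis inverse_unique)
qed

text \<open>Says that \<open>q\<close> arises from \<open>p\<close> by applying the partial
  embedding to the coefficients.\<close>

definition poly_pair :: "complex Polynomial.poly \<Rightarrow> complex Polynomial.poly \<Rightarrow> bool"
  where "poly_pair p q \<longleftrightarrow> (\<forall>i. (Polynomial.coeff p i, Polynomial.coeff q i) \<in> G)"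

lemma poly_pair_add: "poly_pair p q \<Longrightarrow> poly_pair p' q' \<Longrightarrow> poly_pair (p + p') (q + q')"
  by (simp add: poly_pair_def graph_add)

lemma poly_pair_diff: "poly_pair p q \<Longrightarrow> poly_pair p' q' \<Longrightarrow> poly_pair (p - p') (q - q')"
  by (simp add: poly_pair_def graph_diff)

lemma poly_pair_mult: "poly_pair p q \<Longrightarrow> poly_pair p' q' \<Longrightarrow> poly_pair (p * p') (q * q')"
  by (simp add: poly_pair_def coeff_mult graph_sum graph_mult)

lemma poly_pair_monom: "(a, b) \<in> G \<Longrightarrow> poly_pair (Polynomial.monom a n) (Polynomial.monom b n)"
  using graph_Rats[of 0] by (simp add: poly_pair_def)

lemma poly_pair_smult: "(a, b) \<in> G \<Longrightarrow> poly_pair p q \<Longrightarrow> poly_pair (smult a p) (smult b q)"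
  by (simp add: poly_pair_def graph_mult)

lemma poly_pair_rational: "rational_poly p \<Longrightarrow> poly_pair p p"
  by (simp add: poly_pair_def rational_poly_def graph_Rats)

lemma poly_pair_0: "poly_pair 0 q \<Longrightarrow> q = 0"
  by (simp add: poly_pair_def graph_0 poly_eq_iff)

lemma poly_pair_monic:
  assumes "poly_pair m m'" "Polynomial.lead_coeff m = 1"
  shows "Polynomial.degree m' = Polynomial.degree m" "Polynomial.lead_coeff m' = 1"
proof -
  have "(1, Polynomial.coeff m' (Polynomial.degree m)) \<in> G"
    using assms unfolding poly_pair_def by metis
  then have 1: "Polynomial.coeff m' (Polynomial.degree m) = 1"
    using graph_unique[OF graph_Rats[of 1]] by simp
  have "Polynomial.coeff m' i = 0" if "i > Polynomial.degree m" for i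
    using assms(1) that unfolding poly_pair_def by (metis coeff_eq_0 graph_0)
  then have "Polynomial.degree m' \<le> Polynomial.degree m"
    by (simp add: degree_le)
  moreover have "Polynomial.degree m \<le> Polynomial.degree m'"
    using 1 by (simp add: le_degree)
  ultimately show "Polynomial.degree m' = Polynomial.degree m"
    by simp
  with 1 show "Polynomial.lead_coeff m' = 1"
    by simp
qed

text \<open>Long division of \<open>p\<close> by the monic \<open>m\<close>, each step being copied
  to \<open>q\<close> and \<open>m'\<close>: the partner of the leading coefficient of
  \<open>p\<close> is the coefficient of \<open>q\<close> at the same degree. A degree bound for
  \<open>r\<close> suffices, since \<open>r = 0\<close> forces \<open>s = 0\<close>.\<close>

lemma poly_pair_div:
  assumes m: "poly_pair m m'" "Polynomial.lead_coeff m = 1" "Polynomial.degree m > 0"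
  shows "poly_pair p q \<Longrightarrow> \<exists>a b r s. poly_pair r s \<and> p = a * m + r \<and> q = b * m' + s \<and>
    Polynomial.degree r < Polynomial.degree m"
proof (induction "Polynomial.degree p" arbitrary: p q rule: less_induct)
  case less
  let ?d = "Polynomial.degree m"
  show ?case
  proof (cases "Polynomial.degree p < ?d")
    case True
    then show ?thesis
      using less.prems by (intro exI[of _ 0] exI[of _ p] exI[of _ q]) auto
  next
    case False
    let ?n = "Polynomial.degree p - ?d"
    let ?a = "Polynomial.monom (Polynomial.lead_coeff p) ?n"
    let ?b = "Polynomial.monom (Polynomial.coeff q (Polynomial.degree p)) ?n"
    have "p \<noteq> 0"
      using False m(3) by auto
    have "poly_pair ?a ?b"
      using less.prems by (intro poly_pair_monom) (simp add: poly_pair_def)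
    then have pair: "poly_pair (p - ?a * m) (q - ?b * m')"
      using less.prems m(1) by (intro poly_pair_diff poly_pair_mult)
    have "Polynomial.degree (?a * m) = Polynomial.degree p"
      using False m \<open>p \<noteq> 0\<close> by (subst degree_mult_eq) (auto simp: degree_monom_eq)
    moreover have "Polynomial.lead_coeff (?a * m) = Polynomial.lead_coeff p"
      using m(2) by (simp only: lead_coeff_mult lead_coeff_monom mult_1_right)
    ultimately have "Polynomial.degree (p - ?a * m) < Polynomial.degree p"
      using False m(3) by (intro degree_lessI) (auto intro: degree_diff_le simp: le_less coeff_eq_0)
    from less.hyps[OF this pair] obtain a b r s where "poly_pair r s" "p - ?a * m = a * m + r"
        "q - ?b * m' = b * m' + s" "Polynomial.degree r < ?d"
      by blast
    moreover from this have "p = (a + ?a) * m + r" "q = (b + ?b) * m' + s"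
      by (simp_all add: algebra_simps)
    ultimately show ?thesis
      by blast
  qed
qed

text \<open>\<open>m\<close> is the minimal polynomial of \<open>x\<close> over the domain of
  \<open>G\<close>: an annihilating polynomial of least degree, divided by its leading coefficient,
  whose inverse lies in the domain by \<open>graph_inverse\<close>.\<close>

lemma minimal_poly_pair:
  assumes "algebraic_number x"
  obtains m m' where "poly_pair m m'" "Polynomial.lead_coeff m = 1" "Polynomial.poly m x = 0"
    "Polynomial.degree m > 0"
    "\<forall>p q. poly_pair p q \<longrightarrow> Polynomial.poly p x = 0 \<longrightarrow> p \<noteq> 0 \<longrightarrow>
      Polynomial.degree m \<le> Polynomial.degree p"
proof -
  define P where "P n \<longleftrightarrow> (\<exists>p q. poly_pair p q \<and> p \<noteq> 0 \<and> Polynomial.poly p x = 0 \<and> Polynomial.degree p = n)" for n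
  have "\<exists>n. P n"
    using assms poly_pair_rational unfolding P_def algebraic_number_iff by blast
  then have "P (LEAST n. P n)"
    by (rule LeastI_ex)
  then obtain p q where p: "poly_pair p q" "p \<noteq> 0" "Polynomial.poly p x = 0"
      "Polynomial.degree p = (LEAST n. P n)"
    unfolding P_def[of "LEAST n. P n"] by blast
  define a where "a = Polynomial.lead_coeff p"
  define b where "b = Polynomial.coeff q (Polynomial.degree p)"
  have "a \<noteq> 0"
    using p(2) by (simp add: a_def)
  have "(a, b) \<in> G"
    using p(1) by (simp add: a_def b_def poly_pair_def)
  define m where "m = smult (inverse a) p"
  have m: "Polynomial.lead_coeff m = 1" "Polynomial.poly m x = 0" "Polynomial.degree m = Polynomial.degree p"
    using \<open>a \<noteq> 0\<close> p(3) by (simp_all add: m_def) (simp add: a_def)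
  have "Polynomial.degree m > 0"
  proof (rule ccontr)
    assume "\<not> Polynomial.degree m > 0"
    then obtain c where "m = [:c:]"
      by (metis degree_eq_zeroE gr0I)
    then show False
      using m by simp
  qed
  moreover have "poly_pair m (smult (inverse b) q)"
    unfolding m_def using p(1) graph_inverse[OF \<open>(a, b) \<in> G\<close> \<open>a \<noteq> 0\<close>] by (intro poly_pair_smult)
  moreover have "Polynomial.degree m \<le> Polynomial.degree p'"
    if "poly_pair p' q'" "Polynomial.poly p' x = 0" "p' \<noteq> 0" for p' q'
    unfolding m(3) p(4) using that by (intro Least_le) (auto simp: P_def)
  ultimately show ?thesis
    using that m by blast
qed

text \<open>The extension sends \<open>poly p x\<close> to \<open>poly q y\<close> for pairs
  \<open>p\<close>, \<open>q\<close>. It is well defined: if \<open>poly p x = 0\<close>, the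
  remainder of \<open>p\<close> modulo \<open>m\<close> vanishes by minimality, hence so does its
  partner, and \<open>q\<close> is a multiple of \<open>m'\<close>, which has the root
  \<open>y\<close>.\<close>

lemma extend_partial_embedding:
  assumes x: "algebraic_number x"
    and m: "poly_pair m m'" "Polynomial.lead_coeff m = 1" "Polynomial.degree m > 0"
    and minimal: "\<forall>p q. poly_pair p q \<longrightarrow> Polynomial.poly p x = 0 \<longrightarrow> p \<noteq> 0 \<longrightarrow>
      Polynomial.degree m \<le> Polynomial.degree p"
    and y: "Polynomial.poly m x = 0" "Polynomial.poly m' y = 0"
  obtains H where "partial_embedding H" "G \<subseteq> H" "(x, y) \<in> H"
proof
  define H where "H = {(Polynomial.poly p x, Polynomial.poly q y) |p q. poly_pair p q}"
  have HI: "poly_pair p q \<Longrightarrow> (Polynomial.poly p x, Polynomial.poly q y) \<in> H" for p q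
    unfolding H_def by blast
  show GH: "G \<subseteq> H"
  proof clarify
    fix a b
    assume "(a, b) \<in> G"
    from HI[OF poly_pair_monom[OF this, of 0]] show "(a, b) \<in> H"
      by (simp add: poly_monom)
  qed
  show "(x, y) \<in> H"
    using HI[OF poly_pair_monom[OF graph_Rats[of 1], of 1]] by (simp add: poly_monom)
  note A = subfield_of_CD[OF subfield_algebraic_numbers]
  have alg: "algebraic_number (Polynomial.poly p x)" if "\<forall>i. algebraic_number (Polynomial.coeff p i)" for p
    using that
  proof (induction p)
    case (pCons a p)
    have "algebraic_number a" "\<forall>i. algebraic_number (Polynomial.coeff p i)"
      using pCons.prems by (metis coeff_pCons_0, metis coeff_pCons_Suc)
    then show ?case
      using pCons.IH A(5,6) x by simp
  qed (use A(1) in simp)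
  have "Polynomial.poly q y = 0" if pq: "poly_pair p q" "Polynomial.poly p x = 0" for p q
  proof -
    obtain a b r s where r: "poly_pair r s" "p = a * m + r" "q = b * m' + s"
        "Polynomial.degree r < Polynomial.degree m"
      using poly_pair_div[OF m pq(1)] by blast
    then have "Polynomial.poly r x = 0"
      using pq(2) y(1) by simp
    then have "r = 0"
      using minimal r(1,4) by fastforce
    then have "s = 0"
      using r(1) poly_pair_0 by blast
    then show ?thesis
      using r(3) y(2) by simp
  qed
  then have H_0: "\<forall>z. (0, z) \<in> H \<longrightarrow> z = 0"
    unfolding H_def by force
  have H_algebraic: "\<forall>(u, v)\<in>H. algebraic_number u"
    unfolding H_def poly_pair_def using alg graph_algebraic by blast
  have H_closed: "(u + u', v + v') \<in> H \<and> (u * u', v * v') \<in> H" if "(u, v) \<in> H" "(u', v') \<in> H" for u v u' v'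
  proof -
    obtain p q p' q' where "poly_pair p q" "poly_pair p' q'" "u = Polynomial.poly p x"
        "v = Polynomial.poly q y" "u' = Polynomial.poly p' x" "v' = Polynomial.poly q' y"
      using \<open>(u, v) \<in> H\<close> \<open>(u', v') \<in> H\<close> unfolding H_def by blast
    then show ?thesis
      using HI[OF poly_pair_add, of p q p' q'] HI[OF poly_pair_mult, of p q p' q'] by simp
  qed
  show "partial_embedding H"
    using H_0 H_algebraic H_closed GH graph_Rats unfolding partial_embedding_def by blast
qed

end

text \<open>A total function for convenience; only its values on algebraic numbers are
  constrained.\<close>

definition embedding :: "(complex \<Rightarrow> complex) \<Rightarrow> bool"
  where "embedding \<phi> \<longleftrightarrow> (\<forall>q\<in>\<rat>. \<phi> q = q) \<and> (\<forall>x y. algebraic_number x \<longrightarrow> algebraic_number y \<longrightarrow>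
    \<phi> (x + y) = \<phi> x + \<phi> y \<and> \<phi> (x * y) = \<phi> x * \<phi> y)"

text \<open>By Zorn's lemma there is a maximal graph. It is defined at every algebraic number,
  because the transported minimal polynomial \<open>m'\<close> has a complex root to which one could
  extend.\<close>

lemma extend_to_embedding:
  assumes G: "partial_embedding G"
  obtains \<phi> where "embedding \<phi>" "\<forall>(x, y)\<in>G. \<phi> x = y"
proof -
  define C where "C = {H. partial_embedding H \<and> G \<subseteq> H}"
  have "\<exists>M\<in>C. \<forall>H\<in>C. M \<subseteq> H \<longrightarrow> H = M"
  proof (rule subset_Zorn_nonempty)
    show "C \<noteq> {}"
      using G by (auto simp: C_def)
    show "\<Union>B \<in> C" if "B \<noteq> {}" "subset.chain C B" for B
    proof -
      have "partial_embedding (\<Union>B)"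
        using that by (intro partial_embedding_Union) (auto simp: C_def subset_chain_def)
      moreover have "G \<subseteq> \<Union>B"
        using that by (fastforce simp: C_def subset_chain_def)
      ultimately show ?thesis
        by (simp add: C_def)
    qed
  qed
  then obtain M where M: "partial_embedding M" "G \<subseteq> M"
      "\<And>H. partial_embedding H \<Longrightarrow> M \<subseteq> H \<Longrightarrow> H = M"
    unfolding C_def by (auto dest: order_trans)
  have "\<exists>y. (x, y) \<in> M" if x: "algebraic_number x" for x
  proof -
    obtain m m' where m: "poly_pair M m m'" "Polynomial.lead_coeff m = 1" "Polynomial.poly m x = 0"
        "Polynomial.degree m > 0" "\<forall>p q. poly_pair M p q \<longrightarrow> Polynomial.poly p x = 0 \<longrightarrow> p \<noteq> 0 \<longrightarrow>
      Polynomial.degree m \<le> Polynomial.degree p"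
      using minimal_poly_pair[OF M(1) x] by metis
    have "\<not> constant (Polynomial.poly m')"
      using poly_pair_monic[OF M(1) m(1,2)] m(4) by (simp add: constant_degree)
    then obtain y where "Polynomial.poly m' y = 0"
      using fundamental_theorem_of_algebra by blast
    then obtain H where "partial_embedding H" "M \<subseteq> H" "(x, y) \<in> H"
      using extend_partial_embedding[OF M(1) x m(1,2,4,5,3)] by blast
    then show ?thesis
      using M(3) by blast
  qed
  then obtain \<phi> where \<phi>: "\<And>x. algebraic_number x \<Longrightarrow> (x, \<phi> x) \<in> M"
    by metis
  have \<phi>_eq: "\<phi> x = y" if "(x, y) \<in> M" for x y
    using graph_unique[OF M(1) _ that] \<phi> graph_algebraic[OF M(1) that] by blast
  have "embedding \<phi>"
    unfolding embedding_def
  proof (intro conjI ballI allI impI)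
    show "\<phi> q = q" if "q \<in> \<rat>" for q
      using graph_Rats[OF M(1) that] by (rule \<phi>_eq)
    fix x y
    assume "algebraic_number x" "algebraic_number y"
    note xy = \<phi>[OF this(1)] \<phi>[OF this(2)]
    show "\<phi> (x + y) = \<phi> x + \<phi> y"
      using graph_add[OF M(1) xy] by (rule \<phi>_eq)
    show "\<phi> (x * y) = \<phi> x * \<phi> y"
      using graph_mult[OF M(1) xy] by (rule \<phi>_eq)
  qed
  then show ?thesis
    by (rule that) (use \<phi>_eq M(2) in blast)
qed

lemma rational_poly_pderiv: "rational_poly p \<Longrightarrow> rational_poly (pderiv p)"
  by (simp add: rational_poly_def coeff_pderiv Rats_mult)

text \<open>\<open>x\<close> can be sent to a root \<open>y\<close> of the cofactor of
  \<open>X - x\<close> in its minimal polynomial. The cofactor is not constant as \<open>x\<close>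
  is irrational, and \<open>y = x\<close> would make \<open>x\<close> a root of the derivative,
  which has smaller degree.\<close>

lemma embedding_moves:
  assumes x: "algebraic_number x" "x \<notin> \<rat>"
  obtains \<phi> where "embedding \<phi>" "\<phi> x \<noteq> x"
proof -
  define G where "G = {(q::complex, q) |q. q \<in> \<rat>}"
  have G: "partial_embedding G"
    unfolding G_def by (rule partial_embedding_Rats)
  have pair_iff: "poly_pair G p q \<longleftrightarrow> rational_poly p \<and> q = p" for p q
    using G by (auto simp: poly_pair_def rational_poly_def G_def poly_eq_iff)
  obtain m m' where m: "poly_pair G m m'" "Polynomial.lead_coeff m = 1" "Polynomial.poly m x = 0"
      "Polynomial.degree m > 0" "\<forall>p q. poly_pair G p q \<longrightarrow> Polynomial.poly p x = 0 \<longrightarrow> p \<noteq> 0 \<longrightarrow>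
      Polynomial.degree m \<le> Polynomial.degree p"
    using minimal_poly_pair[OF G x(1)] by metis
  have rat: "rational_poly m" "m' = m"
    using m(1) pair_iff by auto
  obtain k where k: "m = [:- x, 1:] * k"
    using m(3) by (auto simp: poly_eq_0_iff_dvd)
  have "k \<noteq> 0"
    using k m(4) by auto
  have deg: "Polynomial.degree m = Suc (Polynomial.degree k)"
  proof -
    have "Polynomial.degree ([:- x, 1:] * k) = Polynomial.degree [:- x, 1:] + Polynomial.degree k"
      using \<open>k \<noteq> 0\<close> by (intro degree_mult_eq) auto
    then show ?thesis
      by (simp only: k) simp
  qed
  have "Polynomial.degree k > 0"
  proof (rule ccontr)
    assume "\<not> Polynomial.degree k > 0"
    then obtain c where "k = [:c:]"
      by (metis degree_eq_zeroE gr0I)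
    then have "m = [:- (x * c), c:]"
      by (simp add: k mult.commute)
    moreover have "c = 1"
      using m(2) deg \<open>k = [:c:]\<close> \<open>m = [:- (x * c), c:]\<close> by (simp split: if_splits)
    ultimately have "- x \<in> \<rat>"
      using rat(1) by (auto simp: rational_poly_def dest: spec[of _ 0])
    then show False
      using x(2) Rats_minus_iff by blast
  qed
  then obtain y where y: "Polynomial.poly k y = 0"
    using fundamental_theorem_of_algebra[of k] by (auto simp: constant_degree)
  have "y \<noteq> x"
  proof
    assume "y = x"
    have "Polynomial.poly (pderiv m) x = 0"
      unfolding k pderiv_mult using y \<open>y = x\<close> by (simp add: pderiv_pCons)
    moreover have "pderiv m \<noteq> 0"
      using m(4) by (simp add: pderiv_eq_0_iff)
    moreover have "poly_pair G (pderiv m) (pderiv m)"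
      using rat(1) by (simp add: pair_iff rational_poly_pderiv)
    ultimately have "Polynomial.degree m \<le> Polynomial.degree (pderiv m)"
      using m(5) by blast
    then show False
      using m(4) by (simp add: degree_pderiv)
  qed
  have "Polynomial.poly m' y = 0"
    using y rat(2) by (simp add: k)
  then obtain H where H: "partial_embedding H" "(x, y) \<in> H"
    using extend_partial_embedding[OF G x(1) m(1,2,4,5,3)] by blast
  obtain \<phi> where \<phi>: "embedding \<phi>" "\<forall>(x, y)\<in>H. \<phi> x = y"
    by (rule extend_to_embedding[OF H(1)])
  have "\<phi> x = y"
    using \<phi>(2) H(2) by auto
  with \<open>y \<noteq> x\<close> show ?thesis
    by (intro that[OF \<phi>(1)]) simp
qed

section \<open>Galois and abelian extensions of the rationals\<close>

lemma algebraic_number_Rats: "q \<in> \<rat> \<Longrightarrow> algebraic_number q"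
  using Rats_subset_subfield[OF subfield_algebraic_numbers] by blast

lemma embedding_simps:
  assumes "embedding \<phi>"
  shows "q \<in> \<rat> \<Longrightarrow> \<phi> q = q"
    and "algebraic_number x \<Longrightarrow> algebraic_number y \<Longrightarrow> \<phi> (x + y) = \<phi> x + \<phi> y"
    and "algebraic_number x \<Longrightarrow> algebraic_number y \<Longrightarrow> \<phi> (x * y) = \<phi> x * \<phi> y"
    and "algebraic_number x \<Longrightarrow> \<phi> (- x) = - \<phi> x"
    and "algebraic_number x \<Longrightarrow> \<phi> (inverse x) = inverse (\<phi> x)"
    and "algebraic_number x \<Longrightarrow> \<phi> x = 0 \<longleftrightarrow> x = 0"
    and "algebraic_number x \<Longrightarrow> \<phi> (x ^ n) = \<phi> x ^ n"
    and "algebraic_number x \<Longrightarrow> \<phi> (x powi k) = \<phi> x powi k"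
    and "algebraic_number x \<Longrightarrow> algebraic_number y \<Longrightarrow> \<phi> x = \<phi> y \<longleftrightarrow> x = y"
proof -
  note A = subfield_of_CD[OF subfield_algebraic_numbers, simplified]
  show rat: "\<phi> q = q" if "q \<in> \<rat>" for q
    using assms that by (simp add: embedding_def)
  show add: "\<phi> (x + y) = \<phi> x + \<phi> y" and mult: "\<phi> (x * y) = \<phi> x * \<phi> y"
    if "algebraic_number x" "algebraic_number y" for x y
    using assms that by (simp_all add: embedding_def)
  show minus: "\<phi> (- x) = - \<phi> x" if "algebraic_number x" for x
    using add[of x "- x"] that A rat[of 0] by (simp add: eq_neg_iff_add_eq_0 add.commute)
  have inv: "\<phi> x * \<phi> (inverse x) = 1" if "algebraic_number x" "x \<noteq> 0" for x
    using mult[of x "inverse x"] that A rat[of 1] by simp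
  show zero: "\<phi> x = 0 \<longleftrightarrow> x = 0" if "algebraic_number x" for x
    using inv[OF that] rat[of 0] by (cases "x = 0") auto
  show inverse: "\<phi> (inverse x) = inverse (\<phi> x)" if "algebraic_number x" for x
    using inv[OF that] rat[of 0] by (cases "x = 0") (auto simp: inverse_unique)
  show pow: "\<phi> (x ^ n) = \<phi> x ^ n" if "algebraic_number x" for x n
    using that rat[of 1] mult A(9) by (induction n) auto
  show "\<phi> (x powi k) = \<phi> x powi k" if "algebraic_number x"
    using that pow inverse A(4) by (simp add: power_int_def)
  show "\<phi> x = \<phi> y \<longleftrightarrow> x = y" if "algebraic_number x" "algebraic_number y"
    using zero[of "x - y"] add[of x "- y"] minus[of y] that A by auto
qed

lemma embedding_poly:
  assumes "embedding \<phi>" "algebraic_number x"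
  shows "rational_poly p \<Longrightarrow> \<phi> (Polynomial.poly p x) = Polynomial.poly p (\<phi> x)"
proof -
  have "partial_embedding {(z, \<phi> z) |z. algebraic_number z}"
    using assms(1) embedding_simps[OF assms(1)] algebraic_number_Rats
      subfield_of_CD[OF subfield_algebraic_numbers]
    unfolding partial_embedding_def by (auto 0 4)
  moreover assume "rational_poly p"
  ultimately show ?thesis
    using graph_poly[of _ x "\<phi> x" p] assms(2) by fastforce
qed

lemma embedding_algebraic: "embedding \<phi> \<Longrightarrow> algebraic_number x \<Longrightarrow> algebraic_number (\<phi> x)"
  unfolding algebraic_number_iff[of "\<phi> x"]
  using embedding_poly[of \<phi> x] embedding_simps(1)[of \<phi> 0] algebraic_number_iff[of x] by fastforce

lemma embedding_preimage_subfield: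
  assumes "embedding \<phi>" "subfield_of_C L"
  shows "subfield_of_C {x. algebraic_number x \<and> \<phi> x \<in> L}"
  using subfield_of_CD[OF assms(2)] subfield_of_CD[OF subfield_algebraic_numbers]
    embedding_simps[OF assms(1)]
  by (auto simp: subfield_of_C_def)

text \<open>Surjectivity: the embedding permutes the finitely many roots in \<open>L\<close> of a
  rational polynomial that vanishes at \<open>x\<close>.\<close>

lemma embedding_bij_betw:
  assumes "embedding \<phi>" "\<And>x. x \<in> L \<Longrightarrow> algebraic_number x" "\<phi> ` L \<subseteq> L"
  shows "bij_betw \<phi> L L"
proof -
  have inj: "inj_on \<phi> L"
    using assms(2) embedding_simps(9)[OF assms(1)] by (auto simp: inj_on_def)
  have "x \<in> \<phi> ` L" if x: "x \<in> L" for x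
  proof -
    obtain p where p: "rational_poly p" "p \<noteq> 0" "Polynomial.poly p x = 0"
      using assms(2)[OF x] algebraic_number_iff by blast
    define R where "R = {z \<in> L. Polynomial.poly p z = 0}"
    have "finite R"
      using poly_roots_finite[OF p(2)] by (simp add: R_def)
    moreover have "\<phi> ` R \<subseteq> R"
      using assms(2,3) embedding_poly[OF assms(1) _ p(1)] embedding_simps(1)[OF assms(1), of 0]
      by (force simp: R_def)
    moreover have "inj_on \<phi> R"
      using inj by (rule inj_on_subset) (auto simp: R_def)
    ultimately have "\<phi> ` R = R"
      by (simp add: endo_inj_surj)
    then show ?thesis
      using x p(3) by (auto simp: R_def)
  qed
  with inj assms(3) show ?thesis
    by (auto simp: bij_betw_def)
qed

section \<open>Galois extensions of the rationals as fields stable under embeddings\<close>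

lemma Gal_carrier_iff:
  "\<sigma> \<in> carrier (Gal L F) \<longleftrightarrow> \<sigma> \<in> extensional L \<and> bij_betw \<sigma> L L \<and> (\<forall>x\<in>F. \<sigma> x = x) \<and>
    (\<forall>x\<in>L. \<forall>y\<in>L. \<sigma> (x + y) = \<sigma> x + \<sigma> y \<and> \<sigma> (x * y) = \<sigma> x * \<sigma> y) \<and> \<sigma> 1 = 1"
  by (auto simp: Gal_def Bij_def ring_hom_def Cx_simps bij_betw_def Pi_iff)

lemma embedding_restrict_Gal:
  assumes "embedding \<phi>" "subfield_of_C L" "\<And>x. x \<in> L \<Longrightarrow> algebraic_number x" "\<phi> ` L \<subseteq> L"
  shows "restrict \<phi> L \<in> carrier (Gal L \<rat>)"
  using embedding_bij_betw[OF assms(1,3,4)] embedding_simps(1-3)[OF assms(1)] assms(3)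
    Rats_subset_subfield[OF assms(2)] subfield_of_CD[OF assms(2)]
  unfolding Gal_carrier_iff by (auto simp: bij_betw_restrict_eq)

text \<open>An irrational element of \<open>L\<close> is moved by some embedding, whose restriction
  is an automorphism of \<open>L\<close> by stability; so the fixed field is no larger than the
  rationals.\<close>

theorem galois_extension_Rats_if_embeddings_preserve:
  assumes L: "subfield_of_C L" "\<And>x. x \<in> L \<Longrightarrow> algebraic_number x"
    and stable: "\<And>\<phi>. embedding \<phi> \<Longrightarrow> \<phi> ` L \<subseteq> L"
  shows "galois_extension L \<rat>"
  unfolding galois_extension_def
proof (intro conjI)
  show "subfield \<rat> Cx" "subfield L Cx"
    using L(1) subfield_of_C_Rats by (simp_all add: subfield_Cx_iff)
  show sub: "\<rat> \<subseteq> L"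
    using L(1) by (rule Rats_subset_subfield)
  show "\<forall>x\<in>L. algebraic_number x"
    using L(2) by blast
  have "x \<in> \<rat>" if x: "x \<in> L" "\<forall>\<sigma>\<in>carrier (Gal L \<rat>). \<sigma> x = x" for x
  proof (rule ccontr)
    assume "x \<notin> \<rat>"
    then obtain \<phi> where \<phi>: "embedding \<phi>" "\<phi> x \<noteq> x"
      using embedding_moves L(2) x(1) by blast
    have "restrict \<phi> L \<in> carrier (Gal L \<rat>)"
      using \<phi>(1) L stable by (intro embedding_restrict_Gal) auto
    with x \<phi>(2) show False
      by fastforce
  qed
  moreover have "\<sigma> x = x" if "x \<in> \<rat>" "\<sigma> \<in> carrier (Gal L \<rat>)" for x \<sigma>
    using that by (simp add: Gal_carrier_iff)
  ultimately show "{x \<in> L. \<forall>\<sigma>\<in>carrier (Gal L \<rat>). \<sigma> x = x} = \<rat>"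
    using sub by blast
qed

lemma Gal_extends:
  assumes K: "subfield_of_C K" "\<And>x. x \<in> K \<Longrightarrow> algebraic_number x"
    and \<sigma>: "\<sigma> \<in> carrier (Gal K \<rat>)"
  obtains \<phi> where "embedding \<phi>" "\<forall>x\<in>K. \<phi> x = \<sigma> x"
proof -
  have "\<sigma> 0 = 0"
    using \<sigma> unfolding Gal_carrier_iff by auto
  with \<sigma> have graph: "partial_embedding {(z, \<sigma> z) |z. z \<in> K}"
    using Rats_subset_subfield[OF K(1)] subfield_of_CD[OF K(1)] K(2)
    unfolding Gal_carrier_iff partial_embedding_def by (auto 0 4)
  obtain \<phi> where \<phi>: "embedding \<phi>" "\<forall>(x, y)\<in>{(z, \<sigma> z) |z. z \<in> K}. \<phi> x = y"
    by (rule extend_to_embedding[OF graph])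
  show ?thesis
    by (rule that[OF \<phi>(1)]) (use \<phi>(2) in auto)
qed

text \<open>An embedding respects sums and products of two algebraic numbers, so the coefficients
  are followed through the product one linear factor at a time.\<close>

lemma coeff_prod_roots_embedding:
  assumes \<phi>: "embedding \<phi>" and L: "subfield_of_C L" "\<And>x. x \<in> L \<Longrightarrow> algebraic_number x"
    and "finite R" "R \<subseteq> L"
  shows "Polynomial.coeff (\<Prod>z\<in>R. [:- z, 1:]) i \<in> L \<and>
    \<phi> (Polynomial.coeff (\<Prod>z\<in>R. [:- z, 1:]) i) = Polynomial.coeff (\<Prod>z\<in>R. [:- \<phi> z, 1:]) i"
  using assms(4,5)
proof (induction R arbitrary: i)
  case empty
  show ?case
    using subfield_of_CD[OF L(1)] embedding_simps(1)[OF \<phi>] by (auto simp: coeff_1)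
next
  case (insert w R)
  let ?P = "\<Prod>z\<in>R. [:- z, 1:]"
  let ?Q = "\<Prod>z\<in>R. [:- \<phi> z, 1:]"
  have IH: "Polynomial.coeff ?P j \<in> L" "\<phi> (Polynomial.coeff ?P j) = Polynomial.coeff ?Q j" for j
    using insert by auto
  have w: "w \<in> L"
    using insert by simp
  define c where "c = (case i of 0 \<Rightarrow> 0 | Suc j \<Rightarrow> Polynomial.coeff ?P j)"
  have c: "c \<in> L" "\<phi> c = (case i of 0 \<Rightarrow> 0 | Suc j \<Rightarrow> Polynomial.coeff ?Q j)"
    using IH subfield_of_CD(1)[OF L(1)] embedding_simps(1)[OF \<phi>, of 0]
    by (auto simp: c_def split: nat.split)
  have P: "Polynomial.coeff ([:- w, 1:] * ?P) i = - w * Polynomial.coeff ?P i + c"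
    by (simp add: coeff_pCons c_def split: nat.split)
  have Q: "Polynomial.coeff ([:- \<phi> w, 1:] * ?Q) i = - \<phi> w * Polynomial.coeff ?Q i + \<phi> c"
    by (simp add: coeff_pCons c(2) split: nat.split)
  have prods: "(\<Prod>z\<in>insert w R. [:- z, 1:]) = [:- w, 1:] * ?P"
    "(\<Prod>z\<in>insert w R. [:- \<phi> z, 1:]) = [:- \<phi> w, 1:] * ?Q"
    using insert(1,2) by (simp_all del: mult_pCons_left)
  have in_L: "- w * Polynomial.coeff ?P i \<in> L" "- w \<in> L"
    using subfield_of_CD(3)[OF L(1) w] subfield_of_CD(6)[OF L(1) _ IH(1)] by blast+
  then have "\<phi> (- w * Polynomial.coeff ?P i + c) = - \<phi> w * \<phi> (Polynomial.coeff ?P i) + \<phi> c"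
    using L(2) w c(1) IH(1) by (simp add: embedding_simps[OF \<phi>] del: mult_minus_left)
  then show ?case
    unfolding prods P Q using subfield_of_CD(5)[OF L(1) in_L(1) c(1)] IH(2) by simp
qed

text \<open>Let \<open>p\<close> be a rational polynomial with root \<open>x\<close>. Every
  automorphism of \<open>K\<close> permutes the roots of \<open>p\<close> in \<open>K\<close>, so
  the monic polynomial with exactly these roots has rational coefficients. Then \<phi> sends
  \<open>x\<close> to another of its roots, which lies in \<open>K\<close>.\<close>

lemma galois_extension_embedding:
  assumes K: "galois_extension K \<rat>" and \<phi>: "embedding \<phi>"
  shows "\<phi> ` K \<subseteq> K"
proof clarify
  fix x
  assume x: "x \<in> K"
  have sub: "subfield_of_C K" and alg: "\<And>x. x \<in> K \<Longrightarrow> algebraic_number x"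
    and fixed: "\<And>x. x \<in> K \<Longrightarrow> (\<And>\<sigma>. \<sigma> \<in> carrier (Gal K \<rat>) \<Longrightarrow> \<sigma> x = x) \<Longrightarrow> x \<in> \<rat>"
    using K unfolding galois_extension_def subfield_Cx_iff by blast+
  obtain p where p: "rational_poly p" "p \<noteq> 0" "Polynomial.poly p x = 0"
    using alg[OF x] algebraic_number_iff by blast
  define R where "R = {z \<in> K. Polynomial.poly p z = 0}"
  have R: "finite R" "R \<subseteq> K" "x \<in> R"
    using poly_roots_finite[OF p(2)] x p(3) by (auto simp: R_def)
  let ?P = "\<Prod>z\<in>R. [:- z, 1:]"
  note coeff_P = coeff_prod_roots_embedding[OF _ sub alg R(1,2)]
  have "Polynomial.coeff ?P i \<in> \<rat>" for i
  proof (rule fixed)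
    show "Polynomial.coeff ?P i \<in> K"
      using coeff_P[OF \<phi>] by blast
    fix \<sigma>
    assume \<sigma>: "\<sigma> \<in> carrier (Gal K \<rat>)"
    obtain \<psi> where \<psi>: "embedding \<psi>" "\<forall>x\<in>K. \<psi> x = \<sigma> x"
      by (rule Gal_extends[OF sub alg \<sigma>])
    have \<sigma>_K: "\<sigma> z \<in> K" if "z \<in> K" for z
      using \<sigma> that unfolding Gal_carrier_iff by (auto simp: bij_betw_def)
    have "\<psi> z \<in> R" if "z \<in> R" for z
    proof -
      have z: "z \<in> K" "Polynomial.poly p z = 0"
        using that by (auto simp: R_def)
      then show ?thesis
        using embedding_poly[OF \<psi>(1) alg[OF z(1)] p(1)] embedding_simps(1)[OF \<psi>(1), of 0] \<psi>(2) \<sigma>_K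
        by (simp add: R_def)
    qed
    moreover have inj: "inj_on \<psi> R"
      using embedding_simps(9)[OF \<psi>(1)] alg R(2) by (auto simp: inj_on_def)
    ultimately have "\<psi> ` R = R"
      using R(1) by (intro endo_inj_surj) auto
    then have "(\<Prod>z\<in>R. [:- \<psi> z, 1:]) = ?P"
      using prod.reindex[OF inj, of "\<lambda>z. [:- z, 1:]"] by simp
    then show "\<sigma> (Polynomial.coeff ?P i) = Polynomial.coeff ?P i"
      using coeff_P[OF \<psi>(1)] \<psi>(2) by metis
  qed
  then have "rational_poly ?P"
    by (simp add: rational_poly_def)
  then have "Polynomial.poly ?P (\<phi> x) = \<phi> (Polynomial.poly ?P x)"
    using embedding_poly[OF \<phi> alg[OF x]] by simp
  also have "Polynomial.poly ?P x = 0"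
    using R by (auto simp: poly_prod)
  finally have "Polynomial.poly ?P (\<phi> x) = 0"
    using embedding_simps(1)[OF \<phi>, of 0] by simp
  then show "\<phi> x \<in> K"
    using R by (auto simp: poly_prod)
qed

lemma group_Gal:
  assumes "subfield_of_C L" "F \<subseteq> L"
  shows "Group.group (Gal L F)"
proof -
  interpret B: Group.group "BijGroup L"
    by (rule group_BijGroup)
  have "subgroup (carrier (Gal L F)) (BijGroup L)"
  proof (rule B.subgroupI)
    show "carrier (Gal L F) \<subseteq> carrier (BijGroup L)"
      by (auto simp: Gal_def BijGroup_def)
    have "(\<lambda>x\<in>L. x) \<in> carrier (Gal L F)"
      using assms subfield_of_CD[OF assms(1)]
      unfolding Gal_carrier_iff by (auto simp: bij_betw_def inj_on_def)
    then show "carrier (Gal L F) \<noteq> {}"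
      by blast
  next
    fix \<sigma>
    assume \<sigma>: "\<sigma> \<in> carrier (Gal L F)"
    then have Bij: "\<sigma> \<in> Bij L" and img: "\<And>x. x \<in> L \<Longrightarrow> \<sigma> x \<in> L"
      by (auto simp: Gal_carrier_iff Bij_def bij_betw_def)
    let ?\<tau> = "\<lambda>x\<in>L. inv_into L \<sigma> x"
    have inj: "inj_on \<sigma> L"
      using \<sigma> by (simp add: Gal_carrier_iff bij_betw_def)
    have fixed: "inv_into L \<sigma> x = x" if "x \<in> L" "\<sigma> x = x" for x
      using inv_into_f_f[OF inj, of x] that by simp
    have "?\<tau> \<in> Bij L"
      using Bij by (rule restrict_inv_into_Bij)
    moreover have "inv_into L \<sigma> (x + y) = inv_into L \<sigma> x + inv_into L \<sigma> y"
      "inv_into L \<sigma> (x * y) = inv_into L \<sigma> x * inv_into L \<sigma> y" if "x \<in> L" "y \<in> L" for x y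
      using \<sigma> subfield_of_CD[OF assms(1)] that
        Bij_inv_into_lemma[where g = "(+)" and h = \<sigma> and S = L] Bij
        Bij_inv_into_lemma[where g = "(*)" and h = \<sigma> and S = L]
      by (auto simp: Gal_carrier_iff)
    ultimately have "?\<tau> \<in> carrier (Gal L F)"
      using \<sigma> subfield_of_CD[OF assms(1)] assms(2) fixed
      by (auto simp: Gal_carrier_iff Bij_def)
    then show "inv\<^bsub>BijGroup L\<^esub> \<sigma> \<in> carrier (Gal L F)"
      using inv_BijGroup[OF Bij] by simp
  next
    fix \<sigma> \<tau>
    assume st: "\<sigma> \<in> carrier (Gal L F)" "\<tau> \<in> carrier (Gal L F)"
    then have Bij: "\<sigma> \<in> Bij L" "\<tau> \<in> Bij L" and img: "\<And>x. x \<in> L \<Longrightarrow> \<tau> x \<in> L"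
      by (auto simp: Gal_carrier_iff Bij_def bij_betw_def)
    have "compose L \<sigma> \<tau> \<in> Bij L"
      using Bij by (rule compose_Bij)
    then have "compose L \<sigma> \<tau> \<in> carrier (Gal L F)"
      using st img subfield_of_CD[OF assms(1)] assms(2)
      by (auto simp: Gal_carrier_iff Bij_def compose_def)
    then show "\<sigma> \<otimes>\<^bsub>BijGroup L\<^esub> \<tau> \<in> carrier (Gal L F)"
      using Bij by (simp add: BijGroup_def)
  qed
  from B.subgroup_imp_group[OF this] show ?thesis
    by (simp add: Gal_def)
qed

section \<open>Cyclotomic fields and the maximal abelian extension\<close>

lemma root_of_unity_fraction: "root_of_unity (fraction u d) = cis (2 * pi * of_int u / of_nat d)"
  by (simp add: fraction_def root_of_unity_class of_rat_divide)

lemma root_of_unity_smul: "root_of_unity (smul k x) = root_of_unity x powi k"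
proof -
  obtain u d where "x = fraction u d"
    using fraction_cases by blast
  then show ?thesis
    by (simp add: smul_fraction root_of_unity_fraction cis_power_int mult_ac)
qed

lemma root_of_unity_0: "root_of_unity (rat_class 0) = 1"
  by (simp add: root_of_unity_class)

lemma root_of_unity_eq_1_iff: "root_of_unity x = 1 \<longleftrightarrow> x = rat_class 0"
  using root_of_unity_eq_iff[of x "rat_class 0"] by (simp add: root_of_unity_0)

lemma smul_den: "smul (int (den x)) x = rat_class 0"
proof -
  obtain u where u: "x = fraction u (den x)"
    using fraction_cases by blast
  have "smul (int (den x)) (fraction u (den x)) = rat_class (of_int u)"
    using den_pos[of x] by (simp add: fraction_def smul_rat_class)
  also have "\<dots> = rat_class 0"
    by (simp add: rat_class_eq_iff)
  finally show ?thesis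
    using u by metis
qed

lemma root_of_unity_power_den: "root_of_unity x ^ den x = 1"
  using root_of_unity_smul[of "int (den x)" x] by (simp add: smul_den root_of_unity_0)

lemma roots_of_unity_powers:
  assumes "n > 0" "z ^ n = 1"
  obtains k :: nat where "z = root_of_unity (fraction 1 n) ^ k"
proof -
  have "z \<in> (\<lambda>k. cis (2 * pi * real k / real n)) ` {..<n}"
    using bij_betw_roots_unity[OF assms(1)] assms(2) by (simp add: bij_betw_def)
  then obtain k where "z = cis (2 * pi * real k / real n)"
    by blast
  then have "z = root_of_unity (fraction 1 n) ^ k"
    by (simp add: root_of_unity_fraction DeMoivre mult_ac)
  then show ?thesis
    by (rule that)
qed

lemma algebraic_root_of_unity:
  assumes "n > 0" "z ^ n = 1"
  shows "algebraic_number z"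
proof -
  let ?p = "Polynomial.monom 1 n - 1 :: complex Polynomial.poly"
  have "Polynomial.coeff ?p n = 1"
    using assms(1) by (simp add: coeff_1)
  then have "?p \<noteq> 0"
    by (metis coeff_0 zero_neq_one)
  moreover have "rational_poly ?p"
    by (simp add: rational_poly_def coeff_1)
  moreover have "Polynomial.poly ?p z = 0"
    using assms(2) by (simp add: poly_monom)
  ultimately show ?thesis
    using algebraic_number_iff by blast
qed

text \<open>Every embedding sends \<zeta> to a power of \<zeta>. Hence the field is stable, and two
  embeddings commute on the generator; the numbers on which they commute form a subfield, so they
  commute on the whole field.\<close>

lemma abelian_extension_cyclotomic:
  assumes "n > 0"
  shows "abelian_extension (generate_field Cx {root_of_unity (fraction 1 n)}) \<rat>"
proof -
  define \<zeta> where "\<zeta> = root_of_unity (fraction 1 n)"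
  define L where "L = generate_field Cx {\<zeta>}"
  have "\<zeta> ^ n = root_of_unity (smul (int n) (fraction 1 n))"
    by (simp add: \<zeta>_def root_of_unity_smul)
  also have "smul (int n) (fraction 1 n) = rat_class 0"
    using assms by (simp add: fraction_def smul_rat_class rat_class_eq_iff)
  finally have \<zeta>: "\<zeta> ^ n = 1"
    by (simp add: root_of_unity_0)
  have sub: "subfield_of_C L"
    unfolding L_def by (rule generate_field_subfield)
  have \<zeta>_L: "\<zeta> \<in> L"
    using generate_field_subset[of "{\<zeta>}"] by (simp add: L_def)
  have \<zeta>_alg: "algebraic_number \<zeta>"
    using algebraic_root_of_unity[OF assms \<zeta>] .
  have "L \<subseteq> {x. algebraic_number x}"
    unfolding L_def using \<zeta>_alg by (intro generate_field_least subfield_algebraic_numbers) auto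
  then have alg: "algebraic_number x" if "x \<in> L" for x
    using that by blast
  have \<phi>_\<zeta>: "\<exists>k::nat. \<phi> \<zeta> = \<zeta> ^ k" if "embedding \<phi>" for \<phi>
  proof -
    have "\<phi> \<zeta> ^ n = 1"
      using embedding_simps(7)[OF that \<zeta>_alg, of n] embedding_simps(1)[OF that, of 1] \<zeta> by simp
    then show ?thesis
      using roots_of_unity_powers[OF assms] unfolding \<zeta>_def by metis
  qed
  have stable: "\<phi> ` L \<subseteq> L" if "embedding \<phi>" for \<phi>
  proof -
    have "\<phi> \<zeta> \<in> L"
      using \<phi>_\<zeta>[OF that] \<zeta>_L subfield_of_CD(9)[OF sub] by metis
    then have "L \<subseteq> {x. algebraic_number x \<and> \<phi> x \<in> L}"
      using \<zeta>_alg unfolding L_def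
      by (intro generate_field_least embedding_preimage_subfield[OF that]) (simp_all add: sub[unfolded L_def])
    then show ?thesis
      by blast
  qed
  have "galois_extension L \<rat>"
    using sub alg stable by (rule galois_extension_Rats_if_embeddings_preserve)
  moreover have "comm_group (Gal L \<rat>)"
  proof (rule group.group_comm_groupI)
    show "Group.group (Gal L \<rat>)"
      using sub Rats_subset_subfield[OF sub] by (rule group_Gal)
    fix \<sigma> \<tau>
    assume st: "\<sigma> \<in> carrier (Gal L \<rat>)" "\<tau> \<in> carrier (Gal L \<rat>)"
    obtain \<phi> where \<phi>: "embedding \<phi>" "\<forall>x\<in>L. \<phi> x = \<sigma> x"
      by (rule Gal_extends[OF sub alg st(1)])
    obtain \<psi> where \<psi>: "embedding \<psi>" "\<forall>x\<in>L. \<psi> x = \<tau> x"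
      by (rule Gal_extends[OF sub alg st(2)])
    obtain i j :: nat where "\<phi> \<zeta> = \<zeta> ^ i" "\<psi> \<zeta> = \<zeta> ^ j"
      using \<phi>_\<zeta> \<phi>(1) \<psi>(1) by metis
    then have "\<phi> (\<psi> \<zeta>) = \<psi> (\<phi> \<zeta>)"
      using \<zeta>_alg by (simp add: embedding_simps(7)[OF \<phi>(1)] embedding_simps(7)[OF \<psi>(1)] mult.commute
          flip: power_mult)
    moreover have "subfield_of_C {x. algebraic_number x \<and> \<phi> (\<psi> x) = \<psi> (\<phi> x)}"
      using subfield_of_CD[OF subfield_algebraic_numbers] embedding_simps[OF \<phi>(1)]
        embedding_simps[OF \<psi>(1)] embedding_algebraic[OF \<phi>(1)] embedding_algebraic[OF \<psi>(1)]
      by (simp add: subfield_of_C_def)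
    ultimately have commuting: "L \<subseteq> {x. algebraic_number x \<and> \<phi> (\<psi> x) = \<psi> (\<phi> x)}"
      unfolding L_def using \<zeta>_alg by (intro generate_field_least) auto
    have "\<sigma> (\<tau> x) = \<tau> (\<sigma> x)" if "x \<in> L" for x
    proof -
      have "\<phi> x \<in> L" "\<psi> x \<in> L" "\<phi> (\<psi> x) = \<psi> (\<phi> x)"
        using that stable[OF \<phi>(1)] stable[OF \<psi>(1)] commuting by auto
      then show ?thesis
        using \<phi>(2) \<psi>(2) that by simp
    qed
    then have "compose L \<sigma> \<tau> = compose L \<tau> \<sigma>"
      by (auto simp: compose_def)
    then show "\<sigma> \<otimes>\<^bsub>Gal L \<rat>\<^esub> \<tau> = \<tau> \<otimes>\<^bsub>Gal L \<rat>\<^esub> \<sigma>"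
      using st by (auto simp: Gal_def BijGroup_def)
  qed
  ultimately show ?thesis
    by (simp add: abelian_extension_def L_def \<zeta>_def)
qed

lemma Q_ab_subfield: "subfield_of_C Q_ab"
  unfolding Q_ab_def by (rule generate_field_subfield)

lemmas Q_ab_closed = subfield_of_CD[OF Q_ab_subfield]

lemma abelian_extension_subset_Q_ab: "abelian_extension K \<rat> \<Longrightarrow> K \<subseteq> Q_ab"
  unfolding Q_ab_def by (rule order_trans[OF _ generate_field_subset]) auto

lemma Q_ab_algebraic: "x \<in> Q_ab \<Longrightarrow> algebraic_number x"
proof -
  have "Q_ab \<subseteq> {x. algebraic_number x}"
    unfolding Q_ab_def
    by (intro generate_field_least subfield_algebraic_numbers)
      (auto simp: abelian_extension_def galois_extension_def)
  then show "x \<in> Q_ab \<Longrightarrow> algebraic_number x"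
    by blast
qed

lemma root_of_unity_in_Q_ab:
  assumes "n > 0" "z ^ n = 1"
  shows "z \<in> Q_ab"
proof -
  have "root_of_unity (fraction 1 n) \<in> Q_ab"
    using abelian_extension_subset_Q_ab[OF abelian_extension_cyclotomic[OF assms(1)]]
      generate_field_subset[of "{root_of_unity (fraction 1 n)}"] by blast
  then show ?thesis
    using roots_of_unity_powers[OF assms] Q_ab_closed(9) by metis
qed

lemma root_of_unity_Q_ab: "root_of_unity x \<in> Q_ab"
  using root_of_unity_in_Q_ab[OF den_pos root_of_unity_power_den] .

text \<open>Each abelian extension is Galois, hence stable, so the numbers sent into
  \<open>Q_ab\<close> form a subfield that contains all generators of \<open>Q_ab\<close>.\<close>

lemma embedding_Q_ab:
  assumes "embedding \<phi>" "x \<in> Q_ab"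
  shows "\<phi> x \<in> Q_ab"
proof -
  have "K \<subseteq> {x. algebraic_number x \<and> \<phi> x \<in> Q_ab}" if "abelian_extension K \<rat>" for K
  proof -
    have K: "galois_extension K \<rat>"
      using that by (simp add: abelian_extension_def)
    then show ?thesis
      using galois_extension_embedding[OF K assms(1)] abelian_extension_subset_Q_ab[OF that]
      by (auto simp: galois_extension_def)
  qed
  then have "Q_ab \<subseteq> {x. algebraic_number x \<and> \<phi> x \<in> Q_ab}"
    unfolding Q_ab_def[symmetric]
    by (subst Q_ab_def) (intro generate_field_least embedding_preimage_subfield[OF assms(1)] Q_ab_subfield, blast)
  with assms(2) show ?thesis
    by blast
qed

section \<open>Sines modulo squares\<close>

definition Q_ab_squares :: "complex set"
  where "Q_ab_squares = {y\<^sup>2 |y. y \<in> Q_ab \<and> y \<noteq> 0}"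

lemma Q_ab_squares_1: "1 \<in> Q_ab_squares"
  using Q_ab_closed(2) unfolding Q_ab_squares_def by (intro CollectI exI[of _ 1]) auto

lemma Q_ab_squares_mult: "x \<in> Q_ab_squares \<Longrightarrow> y \<in> Q_ab_squares \<Longrightarrow> x * y \<in> Q_ab_squares"
  unfolding Q_ab_squares_def using Q_ab_closed(6) by (force simp: power_mult_distrib[symmetric])

lemma Q_ab_squares_inverse: "x \<in> Q_ab_squares \<Longrightarrow> inverse x \<in> Q_ab_squares"
  unfolding Q_ab_squares_def using Q_ab_closed(4) by (force simp: power_inverse)

lemma Q_ab_squares_divide: "x \<in> Q_ab_squares \<Longrightarrow> y \<in> Q_ab_squares \<Longrightarrow> x / y \<in> Q_ab_squares"
  using Q_ab_squares_mult[OF _ Q_ab_squares_inverse] by (simp add: divide_inverse)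

lemma Q_ab_squares_prod: "(\<And>i. i \<in> S \<Longrightarrow> f i \<in> Q_ab_squares) \<Longrightarrow> (\<Prod>i\<in>S. f i) \<in> Q_ab_squares"
  by (induction S rule: infinite_finite_induct) (auto simp: Q_ab_squares_1 Q_ab_squares_mult)

lemma Q_ab_squares_power2: "x \<in> Q_ab \<Longrightarrow> x \<noteq> 0 \<Longrightarrow> x * x \<in> Q_ab_squares"
  unfolding Q_ab_squares_def by (auto simp: power2_eq_square)

text \<open>A square root of an \<open>n\<close>-th root of unity is a root of unity of order
  dividing \<open>2 * n\<close>, hence lies in \<open>Q_ab\<close>.\<close>

lemma Q_ab_squares_root_of_unity:
  assumes "n > 0" "z ^ n = 1"
  shows "z \<in> Q_ab_squares"
proof -
  have "csqrt z ^ (2 * n) = 1"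
    using assms by (simp add: power_mult)
  then have "csqrt z \<in> Q_ab"
    using assms by (intro root_of_unity_in_Q_ab[of "2 * n"]) auto
  moreover have "z \<noteq> 0"
    using assms by (auto simp: power_0_left)
  ultimately show ?thesis
    unfolding Q_ab_squares_def by (intro CollectI exI[of _ "csqrt z"]) auto
qed

lemma rat_mod_1_cases:
  obtains "x = rat_class 0" | a where "x = rat_class a" "0 < a" "a < 1"
proof -
  obtain a where a: "x = rat_class a"
    by (metis Quotient_rat_mod_1 Quotient_abs_rep rat_class.abs_eq)
  have "x = rat_class (frac a)"
    unfolding a rat_class_eq_iff by (simp add: frac_def)
  moreover have "0 \<le> frac a" "frac a < 1"
    by (auto simp: frac_lt_1)
  ultimately show ?thesis
    using that by (cases "frac a = 0") auto
qed

lemma sin_class_frac: "0 < a \<Longrightarrow> a < 1 \<Longrightarrow> sin_class (rat_class a) = of_real (2 * sin (pi * of_rat a))"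
  using sin_hom_symbol[of a] by (simp add: sin_hom_def)

lemma sin_class_0: "sin_class (rat_class 0) = 1"
  using sin_hom_symbol_0 by (simp add: sin_hom_def)

text \<open>With \<theta> equal to pi times \<open>a\<close>, this is \<open>2 * sin \<theta> = \<i>
  * cis (- \<theta>) * (1 - cis (2 * \<theta>))\<close>.\<close>

lemma sin_class_eq_root_of_unity:
  assumes "x \<noteq> rat_class 0"
  obtains \<eta> n where "n > 0" "\<eta> ^ n = 1" "sin_class x = (1 - root_of_unity x) * \<eta>"
proof (rule rat_mod_1_cases[of x])
  assume "x = rat_class 0"
  with assms show ?thesis
    by simp
next
  fix a
  assume a: "x = rat_class a" "0 < a" "a < 1"
  define \<theta> where "\<theta> = pi * of_rat a"
  define \<eta> where "\<eta> = \<i> * cis (- \<theta>)"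
  have "(1 - root_of_unity x) * \<eta> = \<i> * (cis (- \<theta>) - cis (2 * \<theta>) * cis (- \<theta>))"
    by (simp add: \<eta>_def a root_of_unity_class \<theta>_def algebra_simps)
  also have "\<dots> = \<i> * (cis (- \<theta>) - cis \<theta>)"
    by (simp add: cis_mult)
  also have "\<dots> = of_real (2 * sin \<theta>)"
    by (simp add: complex_eq_iff)
  finally have "sin_class x = (1 - root_of_unity x) * \<eta>"
    using a by (simp add: sin_class_frac \<theta>_def)
  moreover obtain u v where uv: "a = of_int u / of_int v" "v > 0"
    using quotient_of_div[of a] quotient_of_denom_pos[of a] by (metis surj_pair)
  then have "cis (- \<theta>) ^ (nat v * 2) = cis (- (2 * pi * of_int u))"
    by (simp add: DeMoivre \<theta>_def of_rat_divide mult.assoc)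
  then have "cis (- \<theta>) ^ (nat v * 2) = 1"
    using cis_multiple_2pi[of "- of_int u"] by simp
  \<comment> \<open>For \<open>a = u / v\<close> the exponent \<open>2 * v\<close> kills
    \<open>cis (- \<theta>)\<close>, and the factor 4 kills \<open>\<i>\<close>.\<close>
  then have "\<eta> ^ (nat v * 2 * 4) = 1"
    unfolding \<eta>_def power_mult_distrib
    by (subst power_mult[of "cis (- \<theta>)"]) (simp add: power_mult mult.commute[of _ 4])
  ultimately show ?thesis
    using that[of "nat v * 2 * 4" \<eta>] uv(2) by simp
qed

lemma sin_class_mod_squares:
  assumes "x \<noteq> rat_class 0"
  shows "sin_class x / (1 - root_of_unity x) \<in> Q_ab_squares"
proof -
  obtain \<eta> n where \<eta>: "n > 0" "\<eta> ^ n = 1" "sin_class x = (1 - root_of_unity x) * \<eta>"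
    using sin_class_eq_root_of_unity[OF assms] .
  then have "sin_class x / (1 - root_of_unity x) = \<eta>"
    using assms by (simp add: root_of_unity_eq_1_iff[symmetric])
  then show ?thesis
    using \<eta> Q_ab_squares_root_of_unity by simp
qed

lemma sin_class_Q_ab: "sin_class x \<in> Q_ab"
proof (cases "x = rat_class 0")
  case False
  then obtain \<eta> n where "n > 0" "\<eta> ^ n = 1" "sin_class x = (1 - root_of_unity x) * \<eta>"
    by (rule sin_class_eq_root_of_unity)
  then show ?thesis
    using root_of_unity_in_Q_ab root_of_unity_Q_ab Q_ab_closed by metis
qed (simp add: sin_class_0 Q_ab_closed)

lemma sin_hom_Q_ab: "sin_hom z \<in> Q_ab"
  unfolding sin_hom_def by (intro subfield_of_C_prod[OF Q_ab_subfield] Q_ab_closed sin_class_Q_ab)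

lemma sin_hom_0: "sin_hom 0 = 1"
  by (simp add: sin_hom_def)

lemma sin_hom_nonzero: "sin_hom z \<noteq> 0"
  by (simp add: sin_hom_def sin_class_nonzero)

lemma sin_hom_minus: "sin_hom (- z) = inverse (sin_hom z)"
  using sin_hom_add[of z "- z"] by (simp add: sin_hom_0 inverse_unique)

lemma sin_hom_diff: "sin_hom (x - y) = sin_hom x / sin_hom y"
  using sin_hom_add[of x "- y"] by (simp add: sin_hom_minus divide_inverse)

lemma sin_hom_sum: "sin_hom (\<Sum>i\<in>S. f i) = (\<Prod>i\<in>S. sin_hom (f i))"
  by (induction S rule: infinite_finite_induct) (simp_all add: sin_hom_0 sin_hom_add)

lemma sin_hom_frag_of: "sin_hom (frag_of x) = sin_class x"
  by (simp add: sin_hom_def)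

section \<open>Sines of the relations are squares\<close>

lemma Q_ab_squares_frag:
  assumes "f 0 = 1" "\<And>x y. f (x - y) = f x / f y" "\<And>x. x \<in> Poly_Mapping.keys z \<Longrightarrow> f (frag_of x) \<in> Q_ab_squares"
  shows "f z \<in> Q_ab_squares"
  by (rule frag_induction[of z "Poly_Mapping.keys z" "\<lambda>z. f z \<in> Q_ab_squares"])
    (use assms in \<open>auto simp: Q_ab_squares_1 Q_ab_squares_divide\<close>)

text \<open>The monic polynomial with the roots \<open>root_of_unity b\<close> is
  \<open>X ^ k - root_of_unity x\<close>; evaluate it at 1.\<close>

lemma prod_one_minus_root_of_unity:
  assumes "k > 0"
  shows "(\<Prod>b\<in>divisors k x. 1 - root_of_unity b) = 1 - root_of_unity x"
proof -
  let ?p = "\<Prod>b\<in>divisors k x. [:- root_of_unity b, 1:]"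
  let ?q = "Polynomial.monom 1 k - [:root_of_unity x:]"
  have inj: "inj_on root_of_unity (divisors k x)"
    by (simp add: inj_on_def root_of_unity_eq_iff)
  have fin: "finite (divisors k x)"
    using assms by (rule finite_divisors)
  have deg_p: "Polynomial.degree ?p = k"
    using card_divisors[OF assms, of x] by (subst degree_prod_eq_sum_degree) auto
  have lead_p: "Polynomial.coeff ?p k = 1"
    using deg_p lead_coeff_prod[of "\<lambda>b. [:- root_of_unity b, 1:]" "divisors k x"] by simp
  \<comment> \<open>The leading terms cancel, so the difference has degree below \<open>k\<close>,
    but it vanishes at \<open>k\<close> points.\<close>
  have "?p - ?q = 0"
  proof (rule poly_eqI_degree)
    show "Polynomial.poly (?p - ?q) z = Polynomial.poly 0 z" if z: "z \<in> root_of_unity ` divisors k x" for z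
    proof -
      obtain b where b: "b \<in> divisors k x" "z = root_of_unity b"
        using z by blast
      then have "root_of_unity b ^ k = root_of_unity x"
        using root_of_unity_smul[of "int k" b] by (simp add: divisors_def)
      moreover have "Polynomial.poly ?p z = 0"
        using b fin by (auto simp: poly_prod)
      ultimately show ?thesis
        by (simp add: b(2) poly_monom)
    qed
    have card: "card (root_of_unity ` divisors k x) = k"
      using card_divisors[OF assms] by (simp add: card_image[OF inj])
    have "Polynomial.coeff (?p - ?q) i = 0" if "i \<ge> k" for i
    proof (cases "i = k")
      case True
      then show ?thesis
        using lead_p assms by (simp add: coeff_pCons split: nat.split)
    next
      case False
      then have "Polynomial.coeff ?p i = 0"
        using that deg_p by (intro coeff_eq_0) simp
      then show ?thesis
        using that False assms by (simp add: coeff_pCons split: nat.split)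
    qed
    then have "Polynomial.degree (?p - ?q) \<le> k - 1"
      using assms by (intro degree_le) auto
    then show "Polynomial.degree (?p - ?q) < card (root_of_unity ` divisors k x)"
      using assms card by simp
    show "Polynomial.degree 0 < card (root_of_unity ` divisors k x)"
      using assms card by simp
  qed
  then have "Polynomial.poly ?p 1 = Polynomial.poly ?q 1"
    by simp
  then show ?thesis
    by (simp add: poly_prod poly_monom)
qed

lemma sin_class_uminus: "sin_class (smul (- 1) x) = sin_class x"
proof (rule rat_mod_1_cases[of x])
  assume "x = rat_class 0"
  then show ?thesis
    by (simp add: smul_rat_class)
next
  fix a
  assume a: "x = rat_class a" "0 < a" "a < 1"
  have "smul (- 1) x = rat_class (1 - a)"
    by (simp add: a smul_rat_class rat_class_eq_iff)
  moreover have "sin (pi * of_rat (1 - a)) = sin (pi * of_rat a)"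
    by (simp add: of_rat_diff right_diff_distrib sin_diff)
  ultimately show ?thesis
    using a sin_class_frac[of a] sin_class_frac[of "1 - a"] by simp
qed

lemma sin_hom_even: "sin_hom (w + dilate (- 1) w) \<in> Q_ab_squares"
  by (rule Q_ab_squares_frag[where f = "\<lambda>w. sin_hom (w + dilate (- 1) w)"])
    (simp_all add: sin_hom_0 dilate_simps dilate_frag_of sin_hom_add sin_hom_diff sin_hom_frag_of
      sin_class_uminus Q_ab_squares_power2 sin_class_Q_ab sin_class_nonzero)

text \<open>For odd \<open>p\<close> the factors at \<open>i\<close> and \<open>p - i\<close>
  coincide, so the product is the square of its first half. For \<open>p = 2\<close> it is 2, which
  is the square of \<open>1 + \<i>\<close> divided by the root of unity \<open>\<i>\<close>.\<close>

lemma prime_sine_product_square: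
  assumes "Factorial_Ring.prime p"
  shows "(\<Prod>b\<in>divisors p (rat_class 0). sin_class b) \<in> Q_ab_squares"
proof -
  have p: "p > 0"
    using assms prime_gt_0_nat by auto
  define f where "f i = sin_class (fraction (int i) p)" for i
  have zero: "rat_class 0 = fraction 0 1"
    by (simp add: fraction_def)
  have "(\<Prod>b\<in>divisors p (rat_class 0). sin_class b) = (\<Prod>i<p. f i)"
    unfolding zero divisors_fraction[OF p zero_less_one]
    using inj_on_divisors[OF p zero_less_one, of 0] by (simp add: prod.reindex f_def)
  also have "\<dots> = f 0 * (\<Prod>i\<in>{1..<p}. f i)"
    using p by (metis lessThan_atLeast0 One_nat_def prod.atLeast_Suc_lessThan)
  also have "f 0 = 1"
    using sin_class_0 by (simp add: f_def fraction_def)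
  finally have prod: "(\<Prod>b\<in>divisors p (rat_class 0). sin_class b) = (\<Prod>i\<in>{1..<p}. f i)"
    by simp
  have sym: "f (p - i) = f i" if "i \<le> p" for i
  proof -
    have "smul (- 1) (fraction (int i) p) = fraction (int (p - i)) p"
      using that p by (simp add: smul_fraction fraction_eq_iff cong_iff_dvd_diff of_nat_diff)
    then show ?thesis
      using sin_class_uminus[of "fraction (int i) p"] by (simp add: f_def)
  qed
  have f_Q_ab: "(\<Prod>i\<in>S. f i) \<in> Q_ab" "(\<Prod>i\<in>S. f i) \<noteq> 0" if "finite S" for S
    using that sin_class_Q_ab sin_class_nonzero
    by (auto simp: f_def intro: subfield_of_C_prod[OF Q_ab_subfield])
  show ?thesis
  proof (cases "p = 2")
    case True
    have "f 1 = 2"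
      using sin_class_frac[of "1 / 2"] by (simp add: f_def fraction_def True of_rat_divide)
    moreover have "(2::complex) = (1 + \<i>) * (1 + \<i>) * inverse \<i>"
      by (simp add: complex_eq_iff)
    moreover have "\<i> \<in> Q_ab_squares" "1 + \<i> \<in> Q_ab"
      using Q_ab_squares_root_of_unity[of 4 "\<i>"] root_of_unity_in_Q_ab[of 4 "\<i>"] Q_ab_closed by auto
    moreover have "1 + \<i> \<noteq> 0"
      by (simp add: complex_eq_iff)
    ultimately have "f 1 \<in> Q_ab_squares"
      using Q_ab_squares_mult Q_ab_squares_power2 Q_ab_squares_inverse by metis
    moreover have "{1..<p} = {1}"
      using True by auto
    ultimately show ?thesis
      by (simp add: prod)
  next
    case False
    then obtain h where h: "p = 2 * h + 1"
      using assms prime_odd_nat[of p] prime_ge_2_nat[of p] by (auto elim: oddE)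
    have "{1..<p} = {1..h} \<union> {h+1..2*h}" "{1..h} \<inter> {h+1..2*h} = {}"
      using h by auto
    then have "(\<Prod>i\<in>{1..<p}. f i) = (\<Prod>i\<in>{1..h}. f i) * (\<Prod>i\<in>{h+1..2*h}. f i)"
      by (simp add: prod.union_disjoint)
    also have "(\<Prod>i\<in>{h+1..2*h}. f i) = (\<Prod>i\<in>{1..h}. f i)"
      by (rule prod.reindex_bij_witness[of _ "\<lambda>i. p - i" "\<lambda>i. p - i"]) (use h sym in auto)
    finally show ?thesis
      using f_Q_ab[of "{1..h}"] by (simp add: prod Q_ab_squares_power2)
  qed
qed

text \<open>Away from 0 the sines may be replaced, modulo squares, by the numbers
  \<open>1 - root_of_unity b\<close>, for which the distribution relation holds exactly. At 0 these
  vanish while the sine of \<open>[0]\<close> is 1 by convention, so this case is separate.\<close>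

lemma sin_hom_Y:
  assumes "Factorial_Ring.prime p"
  shows "sin_hom (Y p y) \<in> Q_ab_squares"
proof (rule Q_ab_squares_frag[where f = "\<lambda>y. sin_hom (Y p y)"])
  show "sin_hom (Y p 0) = 1" "sin_hom (Y p (x - y)) = sin_hom (Y p x) / sin_hom (Y p y)" for x y
    by (simp_all add: Y_simps sin_hom_0 sin_hom_diff)
  fix x
  have p: "p > 0"
    using assms prime_gt_0_nat by auto
  have eq: "sin_hom (Y p (frag_of x)) = sin_class x / (\<Prod>b\<in>divisors p x. sin_class b)"
    using p by (simp add: Y_eq_split split_frag_of sin_hom_diff sin_hom_sum sin_hom_frag_of)
  show "sin_hom (Y p (frag_of x)) \<in> Q_ab_squares"
  proof (cases "x = rat_class 0")
    case True
    show ?thesis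
      using Q_ab_squares_inverse[OF prime_sine_product_square[OF assms]]
      unfolding eq by (simp add: True sin_class_0 divide_inverse)
  next
    case False
    have nonzero: "b \<noteq> rat_class 0" if "b \<in> divisors p x" for b
      using that False by (auto simp: divisors_def smul_rat_class)
    have "(\<Prod>b\<in>divisors p x. sin_class b / (1 - root_of_unity b)) \<in> Q_ab_squares"
      using nonzero by (intro Q_ab_squares_prod sin_class_mod_squares)
    then have "(\<Prod>b\<in>divisors p x. sin_class b) / (1 - root_of_unity x) \<in> Q_ab_squares"
      using prod_one_minus_root_of_unity[OF p, of x] by (simp add: prod_dividef)
    from Q_ab_squares_divide[OF sin_class_mod_squares[OF False] this] show ?thesis
      using False root_of_unity_eq_1_iff[of x] by (simp add: eq)
  qed
qed

lemma sin_hom_odd_relations: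
  assumes "\<And>k. k \<in> I \<Longrightarrow> Factorial_Ring.prime k" "z \<in> odd_relations I"
  shows "sin_hom z \<in> Q_ab_squares"
proof -
  obtain w y where "z = w + dilate (- 1) w + (\<Sum>k\<in>I. Y k (y k))"
    using assms(2) unfolding odd_relations_def by blast
  then have "sin_hom z = sin_hom (w + dilate (- 1) w) * (\<Prod>k\<in>I. sin_hom (Y k (y k)))"
    by (simp add: sin_hom_add sin_hom_sum)
  then show ?thesis
    using sin_hom_even sin_hom_Y assms(1) by (simp add: Q_ab_squares_mult Q_ab_squares_prod)
qed

text \<open>\<open>t\<close> is the exponent by which \<phi> acts on a primitive \<open>M\<close>-th
  root of unity. A common factor of \<open>t\<close> and \<open>M\<close> would give a nontrivial
  root of unity sent to 1, against injectivity.\<close>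

lemma embedding_root_of_unity:
  assumes \<phi>: "embedding \<phi>" and M: "M > 0"
  obtains t where "coprime t (int M)"
    "\<And>x. den x dvd M \<Longrightarrow> \<phi> (root_of_unity x) = root_of_unity (smul t x)"
proof -
  define \<zeta> where "\<zeta> = root_of_unity (fraction 1 M)"
  have \<zeta>_powi: "\<zeta> powi j = root_of_unity (fraction j M)" for j
    using root_of_unity_smul[of j "fraction 1 M"] by (simp add: \<zeta>_def smul_fraction)
  have \<zeta>_eq_1: "\<zeta> powi j = 1 \<longleftrightarrow> int M dvd j" for j
  proof -
    have "rat_class 0 = fraction 0 M"
      by (simp add: fraction_def)
    then show ?thesis
      using M unfolding \<zeta>_powi root_of_unity_eq_1_iff by (simp add: fraction_eq_iff cong_0_iff)
  qed
  have \<zeta>: "\<zeta> ^ M = 1"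
    using \<zeta>_eq_1[of "int M"] by simp
  have alg: "algebraic_number \<zeta>"
    using algebraic_root_of_unity[OF M \<zeta>] .
  have "\<phi> \<zeta> ^ M = 1"
    using embedding_simps(7)[OF \<phi> alg, of M] embedding_simps(1)[OF \<phi>, of 1] \<zeta> by simp
  then obtain k :: nat where k: "\<phi> \<zeta> = \<zeta> ^ k"
    using roots_of_unity_powers[OF M] unfolding \<zeta>_def by metis
  have \<phi>_powi: "\<phi> (\<zeta> powi j) = \<zeta> powi (int k * j)" for j
    using embedding_simps(8)[OF \<phi> alg, of j] k by (simp add: power_int_mult)
  have "coprime (int k) (int M)"
  proof (rule coprimeI)
    fix g
    assume g: "g dvd int k" "g dvd int M"
    then obtain j where j: "int M = g * j"
      by (elim dvdE)
    obtain i where i: "int k = g * i"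
      using g(1) by (elim dvdE)
    have "\<zeta> powi (int k * j) = 1"
      unfolding \<zeta>_eq_1 using i j by simp
    then have "\<phi> (\<zeta> powi j) = \<phi> 1"
      using \<phi>_powi embedding_simps(1)[OF \<phi>, of 1] by simp
    then have "\<zeta> powi j = 1"
      using embedding_simps(9)[OF \<phi>, of "\<zeta> powi j" 1] alg algebraic_number_Rats[of 1]
        subfield_of_CD(10)[OF subfield_algebraic_numbers, of \<zeta> j] by simp
    then have "g * j dvd 1 * j"
      using \<zeta>_eq_1 j by simp
    moreover have "j \<noteq> 0"
      using j M by auto
    ultimately show "is_unit g"
      by (simp only: dvd_mult_cancel_right) simp
  qed
  moreover have "\<phi> (root_of_unity x) = root_of_unity (smul (int k) x)" if x_M: "den x dvd M" for x
  proof -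
    obtain e where e: "M = den x * e"
      using x_M by (elim dvdE)
    then have "e > 0"
      using M by (cases e) auto
    obtain u where "x = fraction u (den x)"
      using fraction_cases by blast
    then have x: "x = fraction (int e * u) M"
      using fraction_cancel[OF \<open>e > 0\<close>, of u "den x"] e by (metis mult.commute)
    have "\<phi> (root_of_unity (fraction (int e * u) M)) = root_of_unity (smul (int k) (fraction (int e * u) M))"
      unfolding smul_fraction \<zeta>_powi[symmetric] by (rule \<phi>_powi)
    then show ?thesis
      using x by metis
  qed
  ultimately show ?thesis
    by (rule that)
qed

lemma embedding_Q_ab_squares:
  assumes "embedding \<phi>" "x \<in> Q_ab_squares"
  shows "\<phi> x \<in> Q_ab_squares"
proof -
  obtain y where y: "y \<in> Q_ab" "y \<noteq> 0" "x = y\<^sup>2"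
    using assms(2) unfolding Q_ab_squares_def by blast
  then have "\<phi> x = (\<phi> y)\<^sup>2" "\<phi> y \<noteq> 0"
    using embedding_simps(6,7)[OF assms(1) Q_ab_algebraic[OF y(1)]] by auto
  then show ?thesis
    using embedding_Q_ab[OF assms(1) y(1)] unfolding Q_ab_squares_def by blast
qed

lemma embedding_divide:
  assumes "embedding \<phi>" "algebraic_number x" "algebraic_number y"
  shows "\<phi> (x / y) = \<phi> x / \<phi> y"
  using embedding_simps(3,5)[OF assms(1)] assms(2,3)
    subfield_of_CD(4)[OF subfield_algebraic_numbers, of y]
  by (simp add: divide_inverse)

text \<open>\<phi> maps \<open>1 - root_of_unity x\<close> exactly to
  \<open>1 - root_of_unity (smul t x)\<close>, and passing between these numbers and the sines costs
  only squares.\<close>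

lemma embedding_sin_hom:
  assumes \<phi>: "embedding \<phi>"
    and t: "\<And>x. x \<in> Poly_Mapping.keys a \<Longrightarrow> \<phi> (root_of_unity x) = root_of_unity (smul t x)"
  shows "\<phi> (sin_hom a) / sin_hom (dilate t a) \<in> Q_ab_squares"
proof (rule Q_ab_squares_frag[where f = "\<lambda>a. \<phi> (sin_hom a) / sin_hom (dilate t a)"])
  show "\<phi> (sin_hom 0) / sin_hom (dilate t 0) = 1"
    using embedding_simps(1)[OF \<phi>, of 1] by (simp add: sin_hom_0 dilate_simps)
  show "\<phi> (sin_hom (x - y)) / sin_hom (dilate t (x - y)) =
      \<phi> (sin_hom x) / sin_hom (dilate t x) / (\<phi> (sin_hom y) / sin_hom (dilate t y))" for x y
    using Q_ab_algebraic[OF sin_hom_Q_ab]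
    by (simp add: sin_hom_diff dilate_simps embedding_divide[OF \<phi>])
  fix x
  assume x: "x \<in> Poly_Mapping.keys a"
  show "\<phi> (sin_hom (frag_of x)) / sin_hom (dilate t (frag_of x)) \<in> Q_ab_squares"
  proof (cases "x = rat_class 0")
    case True
    then show ?thesis
      using embedding_simps(1)[OF \<phi>, of 1]
      by (simp add: sin_hom_frag_of dilate_frag_of smul_rat_class sin_class_0 Q_ab_squares_1)
  next
    case False
    have alg: "algebraic_number (root_of_unity y)" "algebraic_number (sin_class y)" for y
      using Q_ab_algebraic root_of_unity_Q_ab sin_class_Q_ab by auto
    note A = subfield_of_CD[OF subfield_algebraic_numbers, simplified]
    have one_minus: "\<phi> (1 - root_of_unity x) = 1 - root_of_unity (smul t x)"
      using embedding_simps(2)[OF \<phi>, of 1 "- root_of_unity x"] embedding_simps(4)[OF \<phi> alg(1)]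
        embedding_simps(1)[OF \<phi>, of 1] t[OF x] alg A by simp
    have "root_of_unity x \<noteq> 1"
      using False root_of_unity_eq_1_iff by blast
    then have "\<phi> (1 - root_of_unity x) \<noteq> 0"
      using embedding_simps(6)[OF \<phi>, of "1 - root_of_unity x"] alg(1)[of x] A by simp
    then have nonzero: "1 - root_of_unity (smul t x) \<noteq> 0"
      by (simp add: one_minus)
    then have tx: "smul t x \<noteq> rat_class 0"
      using root_of_unity_0 by auto
    have "\<phi> (sin_class x / (1 - root_of_unity x)) \<in> Q_ab_squares"
      using False sin_class_mod_squares embedding_Q_ab_squares[OF \<phi>] by blast
    also have "\<phi> (sin_class x / (1 - root_of_unity x)) = \<phi> (sin_class x) / (1 - root_of_unity (smul t x))"
      using embedding_divide[OF \<phi>, of "sin_class x" "1 - root_of_unity x"] alg A one_minus by simp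
    finally have "\<phi> (sin_class x) / (1 - root_of_unity (smul t x)) \<in> Q_ab_squares" .
    from Q_ab_squares_divide[OF this sin_class_mod_squares[OF tx]] show ?thesis
      using nonzero by (simp add: sin_hom_frag_of dilate_frag_of)
  qed
qed

section \<open>From torsion in \<open>U_minus\<close> to relations with finitely many primes\<close>

lemma cis_Q_ab: "cis (2 * pi * of_rat a) \<in> Q_ab"
  using root_of_unity_Q_ab[of "rat_class a"] by (simp add: root_of_unity_class)

lemma symbol_action_sigma_minus_1: "symbol_action sigma_minus_1 x = dilate (- 1) x"
proof (rule frag_additive_eqI[where z = x])
  show "additive (symbol_action sigma_minus_1)"
    by (simp add: symbol_action_def additive_frag_extend)
  show "additive (dilate (- 1))"
    by (rule additive_operators)
  fix q
  obtain u d where "q = rat_class (of_int u / of_nat d)"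
    using fraction_cases unfolding fraction_def by blast
  then show "symbol_action sigma_minus_1 (frag_of q) = dilate (- 1) (frag_of q)"
    using sigma_minus_1_symbol[OF cis_Q_ab] by (simp add: dilate_frag_of smul_rat_class)
qed

text \<open>The generated subgroup is built from single generators, each of which involves at most
  one prime; sums are handled by enlarging both sets of primes to their union.\<close>

lemma odd_distribution_relations_finite:
  assumes "x \<in> odd_distribution_relations"
  shows "\<exists>I. finite I \<and> (\<forall>k\<in>I. Factorial_Ring.prime k) \<and> x \<in> odd_relations I"
  using assms unfolding odd_distribution_relations_def
proof (induction x rule: generate.induct)
  case one
  then show ?case
    using odd_relations_even[of 0 "{}"] by (auto simp: dilate_simps)
next
  case (incl h)
  then consider w where "h = w + dilate (- 1) w" | p y where "Factorial_Ring.prime p" "h = Y p y"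
    by (auto simp: symbol_action_sigma_minus_1)
  then show ?case
  proof cases
    case 1
    then show ?thesis
      using odd_relations_even[of w "{}"] by auto
  next
    case (2 p y)
    then show ?thesis
      using odd_relations_Y[of "{p}" p y] by (intro exI[of _ "{p}"]) auto
  qed
next
  case (inv h)
  then consider w where "h = w + dilate (- 1) w" | p y where "Factorial_Ring.prime p" "h = Y p y"
    by (auto simp: symbol_action_sigma_minus_1)
  then show ?case
  proof cases
    case 1
    then show ?thesis
      using odd_relations_minus[OF odd_relations_even[of w "{}"]] by auto
  next
    case (2 p y)
    then show ?thesis
      using odd_relations_minus[OF odd_relations_Y[of "{p}" p y]] by (intro exI[of _ "{p}"]) auto
  qed
next
  case (eng x y)
  then obtain I J where "finite I" "\<forall>k\<in>I. Factorial_Ring.prime k" "x \<in> odd_relations I"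
      "finite J" "\<forall>k\<in>J. Factorial_Ring.prime k" "y \<in> odd_relations J"
    by blast
  then show ?case
    using odd_relations_mono[of "I \<union> J" I] odd_relations_mono[of "I \<union> J" J]
    by (intro exI[of _ "I \<union> J"]) (auto intro!: odd_relations_add)
qed

lemma torsion_element_U_minusD:
  assumes "torsion_element U_minus (U_minus_class a)"
  obtains n where "n \<noteq> 0" "frag_cmul n a \<in> odd_distribution_relations"
proof -
  obtain n :: nat where n: "n > 0" "U_minus_class a [^]\<^bsub>U_minus\<^esub> n = \<one>\<^bsub>U_minus\<^esub>"
    using assms unfolding torsion_element_def by blast
  let ?G = "symbol_group" and ?H = "odd_distribution_relations"
  interpret G: comm_group ?G
    by (rule abelian_free_Abelian_group)
  have sub: "subgroup ?H ?G"
    unfolding odd_distribution_relations_def by (rule G.generate_is_subgroup) (simp only: carrier_symbol_group subset_UNIV)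
  then have normal: "?H \<lhd> ?G"
    by (rule G.subgroup_imp_normal)
  have "(\<lambda>x. ?H #>\<^bsub>?G\<^esub> x) \<in> hom ?G U_minus"
    unfolding U_minus_def using normal by (rule normal.r_coset_hom_Mod)
  moreover have "Group.group U_minus"
    unfolding U_minus_def using normal by (rule normal.factorgroup_is_group)
  ultimately have "?H #>\<^bsub>?G\<^esub> (a [^]\<^bsub>?G\<^esub> n) = U_minus_class a [^]\<^bsub>U_minus\<^esub> n"
    unfolding U_minus_class_def by (intro hom_nat_pow) (auto simp: carrier_symbol_group G.is_group)
  also have "\<dots> = ?H"
    unfolding n(2) by (simp add: U_minus_def FactGroup_def)
  finally have "a [^]\<^bsub>?G\<^esub> n \<in> ?H"
    using G.coset_join1[OF _ _ sub] sub by (simp add: carrier_symbol_group)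
  then have "frag_cmul (int n) a \<in> ?H"
    by simp
  with n(1) show ?thesis
    by (intro that[of "int n"]) auto
qed

text \<open>Substitute the square of the variable into a polynomial that annihilates
  \<open>x\<close>.\<close>

lemma algebraic_csqrt:
  assumes "algebraic_number x"
  shows "algebraic_number (csqrt x)"
proof -
  obtain p where p: "rational_poly p" "p \<noteq> 0" "Polynomial.poly p x = 0"
    using assms algebraic_number_iff by blast
  let ?q = "Polynomial.monom 1 2 :: complex Polynomial.poly"
  have "rational_poly (pcompose p ?q)"
    using p(1)
  proof (induction p)
    case (pCons a p)
    then have "a \<in> \<rat>" "rational_poly p"
      unfolding rational_poly_def by (metis coeff_pCons_0, metis coeff_pCons_Suc)
    then show ?case
      using pCons.IH by (auto simp: rational_poly_def pcompose_pCons coeff_monom_mult coeff_pCons split: nat.split)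
  qed (simp add: rational_poly_def)
  moreover have "pcompose p ?q \<noteq> 0"
    using p(2) by (simp add: pcompose_eq_0_iff degree_monom_eq)
  moreover have "Polynomial.poly (pcompose p ?q) (csqrt x) = 0"
    using p(3) by (simp add: poly_pcompose poly_monom)
  ultimately show ?thesis
    using algebraic_number_iff by blast
qed

theorem proposition4p1p8:
  fixes a :: symbols
  assumes "torsion_element U_minus (U_minus_class a)"
  shows "galois_extension (adjoin Q_ab {csqrt (sin_hom a)}) \<rat>"
proof -
  define \<alpha> where "\<alpha> = sin_hom a"
  define L where "L = adjoin Q_ab {csqrt \<alpha>}"
  have L: "subfield_of_C L"
    unfolding L_def adjoin_def by (rule generate_field_subfield)
  have sub: "Q_ab \<subseteq> L" "csqrt \<alpha> \<in> L"
    using generate_field_subset[of "Q_ab \<union> {csqrt \<alpha>}"] by (auto simp: L_def adjoin_def)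
  have L_least: "L \<subseteq> E" if "subfield_of_C E" "Q_ab \<subseteq> E" "csqrt \<alpha> \<in> E" for E
    unfolding L_def adjoin_def using that by (intro generate_field_least) auto
  have \<alpha>: "\<alpha> \<in> Q_ab" "\<alpha> \<noteq> 0"
    by (simp_all add: \<alpha>_def sin_hom_Q_ab sin_hom_nonzero)
  then have alg: "algebraic_number (csqrt \<alpha>)"
    by (intro algebraic_csqrt Q_ab_algebraic)
  have "L \<subseteq> {x. algebraic_number x}"
    using subfield_algebraic_numbers Q_ab_algebraic alg by (intro L_least) auto
  then have L_alg: "algebraic_number x" if "x \<in> L" for x
    using that by blast
  obtain n where n: "n \<noteq> 0" "frag_cmul n a \<in> odd_distribution_relations"
    using torsion_element_U_minusD[OF assms] .
  obtain I where I: "finite I" "\<And>k. k \<in> I \<Longrightarrow> Factorial_Ring.prime k" "frag_cmul n a \<in> odd_relations I"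
    using odd_distribution_relations_finite[OF n(2)] by blast
  obtain M J where M: "M > 0" "\<And>k. k \<in> J \<Longrightarrow> Factorial_Ring.prime k"
      "\<And>x. x \<in> Poly_Mapping.keys a \<Longrightarrow> den x dvd M"
      "\<And>t. coprime t (int M) \<Longrightarrow> dilate t a - a \<in> odd_relations J"
    using odd_distribution_torsion_invariant[OF I(1,2) n(1) I(3)] by metis
  have "\<phi> ` L \<subseteq> L" if \<phi>: "embedding \<phi>" for \<phi>
  proof -
    obtain t where t: "coprime t (int M)"
        "\<And>x. den x dvd M \<Longrightarrow> \<phi> (root_of_unity x) = root_of_unity (smul t x)"
      using embedding_root_of_unity[OF \<phi> M(1)] by metis
    \<comment> \<open>The quotient of \<open>\<phi> \<alpha>\<close> by \<alpha> is split at the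
      sine of the dilated symbol: the first factor is a square by the action on sines, the second
      because \<open>dilate t a - a\<close> is a relation.\<close>
    have "\<phi> \<alpha> / sin_hom (dilate t a) \<in> Q_ab_squares"
      unfolding \<alpha>_def using \<phi> t(2) M(3) by (intro embedding_sin_hom) auto
    moreover have "sin_hom (dilate t a) / \<alpha> \<in> Q_ab_squares"
      unfolding \<alpha>_def sin_hom_diff[symmetric] using M(2) M(4)[OF t(1)] by (rule sin_hom_odd_relations)
    ultimately have "\<phi> \<alpha> / sin_hom (dilate t a) * (sin_hom (dilate t a) / \<alpha>) \<in> Q_ab_squares"
      by (rule Q_ab_squares_mult)
    then have "\<phi> \<alpha> / \<alpha> \<in> Q_ab_squares"
      using sin_hom_nonzero[of "dilate t a"] by simp
    then obtain \<beta> where \<beta>: "\<beta> \<in> Q_ab" "\<phi> \<alpha> = \<alpha> * \<beta>\<^sup>2"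
      using \<alpha>(2) unfolding Q_ab_squares_def by (auto simp: field_simps)
    have "(\<phi> (csqrt \<alpha>))\<^sup>2 = (csqrt \<alpha> * \<beta>)\<^sup>2"
      using embedding_simps(7)[OF \<phi> alg, of 2] \<beta>(2) by (simp add: power_mult_distrib)
    then have "\<phi> (csqrt \<alpha>) = csqrt \<alpha> * \<beta> \<or> \<phi> (csqrt \<alpha>) = - (csqrt \<alpha> * \<beta>)"
      by (simp add: power2_eq_iff)
    moreover have "csqrt \<alpha> * \<beta> \<in> L"
      using sub \<beta>(1) subfield_of_CD(6)[OF L] by blast
    ultimately have "\<phi> (csqrt \<alpha>) \<in> L"
      using subfield_of_CD(3)[OF L] by auto
    then have "L \<subseteq> {x. algebraic_number x \<and> \<phi> x \<in> L}"
      using embedding_preimage_subfield[OF \<phi> L] Q_ab_algebraic embedding_Q_ab[OF \<phi>] sub(1) alg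
      by (intro L_least) auto
    then show ?thesis
      by blast
  qed
  with L L_alg have "galois_extension L \<rat>"
    by (rule galois_extension_Rats_if_embeddings_preserve)
  then show ?thesis
    by (simp add: L_def \<alpha>_def)
qed

end
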